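(* Let $N\ge 1$, let $L\in C(\mathbb{R},\mathbb{R}^{N\times N})$ with $L(t)$ symmetric for every $t$, and let $W\in C^{1}(\mathbb{R}\times\mathbb{R}^{N},\mathbb{R})$. Assume: (L1) there exist $\alpha>1$ and $M>0$ such that $\lim_{R\to+\infty}\operatorname{meas}\big(\{t\in\mathbb{R}:|t|\ge R,\ l(t)\le M|t|\ln^{\alpha}|t|\}\big)=0$, where $l(t)=\min_{|x|=1}(L(t)x,x)$; (L2) there exists $L_0>0$ such that $(L(t)x,x)\ge -L_0|x|^2$ for all $(t,x)\in\mathbb{R}\times\mathbb{R}^N$; (W1) $W(t,0)=0$ for all $t$, and there is $b_1>0$ with $|\nabla W(t,x)|\le b_1|x|$ for all $(t,x)$; (W2) there exist $b_2,r_1>0$ and $\mu>1$ such that $\widetilde W(t,x)\ge b_2|x|^{\mu}$ for all $t\in\mathbb{R}$ and $|x|\ge r_1$; (W3) there exists $b_3>0$ such that $\widetilde W(t,x)\ge -b_3|x|$ for all $t\in\mathbb{R}$ and $|x|<r_1$; (W4) there exist $r_2,\sigma_0>0$ such that $|W(t,x)|\le \frac{\lambda_{\bar n+1}-\sigma_0}{2}|x|^2$ for all $t\in\mathbb{R}$ and $|x|\le r_2$; (W5) there exist $\varepsilon_0>0$, $r_\infty>0$ such that $W(t,x)\ge \big(\frac{\lambda_{\bar n+1}}{2}+\varepsilon_0\big)|x|^2$ for all $t\in\mathbb{R}$ and $|x|\ge r_\infty$; (W6) $W(t,x)\ge 0$ for all $(t,x)\in\mathbb{R}\times\mathbb{R}^N$.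 Then the system $\ddot u(t)-L(t)u(t)+\nabla W(t,u(t))=0$ has a nontrivial homoclinic solution.
   Context: $\nabla W$ denotes the gradient of $W$ with respect to $x$, $(\cdot,\cdot)$ the Euclidean inner product on $\mathbb{R}^N$, and $\widetilde W(t,x)=2W(t,x)-(\nabla W(t,x),x)$. Let $\mathcal{H}$ be the self-adjoint extension in $L^2(\mathbb{R},\mathbb{R}^N)$ of the operator $-\frac{d^2}{dt^2}+L(t)$. Under (L1) and (L2) the spectrum of $\mathcal{H}$ consists of eigenvalues $\lambda_1\le\lambda_2\le\cdots\to+\infty$ (repeated according to multiplicity), with eigenfunctions $e_n$ ($\mathcal{H}e_n=\lambda_n e_n$) forming an orthogonal basis of $L^2$. $\bar n$ denotes the number of nonpositive eigenvalues, so $\lambda_{\bar n+1}$ is the smallest positive eigenvalue. A solution $u$ is homoclinic if $u(t)\to 0$ as $t\to\pm\infty$, and nontrivial if $u\not\equiv 0$. *)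

theory Defs
  imports "HOL-Analysis.Analysis"
begin

definition C1_fun :: "('a::real_normed_vector \<Rightarrow> 'b::real_normed_vector) \<Rightarrow> bool" where
  "C1_fun f \<longleftrightarrow> (\<exists>f'. (\<forall>p. (f has_derivative blinfun_apply (f' p)) (at p)) \<and> continuous_on UNIV f')"

definition gradW :: "(real \<Rightarrow> real^'n \<Rightarrow> real) \<Rightarrow> real \<Rightarrow> real^'n \<Rightarrow> real^'n" where
  "gradW W t x = (\<chi> i. frechet_derivative (W t) (at x) (axis i 1))"

definition Wtilde :: "(real \<Rightarrow> real^'n \<Rightarrow> real) \<Rightarrow> real \<Rightarrow> real^'n \<Rightarrow> real" where
  "Wtilde W t x = 2 * W t x - gradW W t x \<bullet> x"

definition lmin :: "(real \<Rightarrow> real^'n^'n) \<Rightarrow> real \<Rightarrow> real" where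
  "lmin L t = Inf {(L t *v x) \<bullet> x | x. norm x = 1}"

text \<open>lambda is an eigenvalue of H = -d^2/dt^2 + L(t) in L^2(R,R^N):
  there is a nonzero square integrable (classical) solution of -e'' + L(t) e = lambda e.\<close>
definition is_eigenvalue :: "(real \<Rightarrow> real^'n^'n) \<Rightarrow> real \<Rightarrow> bool" where
  "is_eigenvalue L lam \<longleftrightarrow> (\<exists>e e'.
     (\<forall>t. (e has_vector_derivative e' t) (at t) \<and>
          (e' has_vector_derivative (L t *v e t - lam *\<^sub>R e t)) (at t)) \<and>
     (\<exists>t. e t \<noteq> 0) \<and>
     integrable lborel (\<lambda>t. (norm (e t))\<^sup>2))"

definition lambda_pos :: "(real \<Rightarrow> real^'n^'n) \<Rightarrow> real" where
  "lambda_pos L = Inf {lam. lam > 0 \<and> is_eigenvalue L lam}"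

definition is_solution :: "(real \<Rightarrow> real^'n^'n) \<Rightarrow> (real \<Rightarrow> real^'n \<Rightarrow> real) \<Rightarrow> (real \<Rightarrow> real^'n) \<Rightarrow> bool" where
  "is_solution L W u \<longleftrightarrow> (\<exists>u'. \<forall>t. (u has_vector_derivative u' t) (at t) \<and>
      (u' has_vector_derivative (L t *v u t - gradW W t (u t))) (at t))"

definition homoclinic :: "(real \<Rightarrow> real^'n) \<Rightarrow> bool" where
  "homoclinic u \<longleftrightarrow> (u \<longlongrightarrow> 0) at_top \<and> (u \<longlongrightarrow> 0) at_bot"

end

theory Submission
  imports Defs "HOL-Complex_Analysis.Great_Picard" "HOL-Library.Function_Algebras"
begin

text \<open>
  Solutions are critical points of \<open>J(u) = (1/2) \<integral> (\<bar>u'\<bar>\<^sup>2 + L u \<cdot> u) - \<integral> W(t, u)\<close>. On the span of the first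
  \<open>m\<close> eigenfunctions of \<open>H\<close> a linking argument gives almost critical points at levels bounded below by some
  \<open>\<delta> > 0\<close> independent of \<open>m\<close>. Condition (L1) bounds the \<open>L\<^sup>1\<close> norm by the energy norm, which makes \<open>J\<close>
  nonpositive far out on the span of the eigenfunctions up to the first positive eigenvalue and, with (W2) and
  (W3), bounds the almost critical points independently of \<open>m\<close>. By compactness in \<open>L\<^sup>2\<close> they have a limit,
  which satisfies the equation tested with piecewise linear hats and therefore classically; it is nonzero
  because \<open>J \<ge> \<delta>\<close>. The eigenfunctions themselves are successive minimisers of the quadratic form, and a
  Wronskian identity shows that there are no other square integrable classical eigenfunctions, so that
  \<^const>\<open>lambda_pos\<close> is the first positive eigenvalue obtained in this way.
\<close>

section \<open>Linking in finite dimensions\<close>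

text \<open>The crossing of the smallest positive eigenvalue is what links: (W4) keeps
  \<open>W\<close> below it near 0, (W5) above it near infinity, so \<open>J\<close> is positive on
  a small sphere over the positive eigenvalues and nonpositive on the faces of a large box that
  contains a single positive direction. The quadratic form of \<open>H\<close> may be indefinite;
  adding \<open>c0 = L0 + 1\<close> makes it an energy that dominates the \<open>L^2\<close> norm,
  and the functional subtracts \<open>c0\<close> again. Two exponents decide:
  \<open>\<alpha> > 1\<close> makes \<open>1 / (|t| ln^\<alpha> |t|)\<close> integrable at infinity,
  from which Young's inequality yields the \<open>L^1\<close> bound, and \<open>\<mu> > 1\<close> in
  (W2) makes the final inequality for the energy norm sublinear. The equation is tested with hats
  because the kinetic form against a hat is a second difference of \<open>u\<close>, so that no weak
  derivatives have to be defined.\<close>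

lemma LIMSEQ_coordinatewise:
  fixes X :: "nat \<Rightarrow> 'a \<Rightarrow> 'b::topological_space"
  assumes "\<And>i. (\<lambda>j. X j i) \<longlonglongrightarrow> x i"
  shows "X \<longlonglongrightarrow> x"
proof -
  have "limitin (product_topology (\<lambda>i. euclidean) UNIV) X x sequentially"
    using assms by (simp add: limitin_componentwise)
  then show ?thesis
    by (simp add: euclidean_product_topology flip: limitin_canonical_iff)
qed

text \<open>Kuhn's combinatorial lemma on the grid of mesh \<open>1 / P\<close>, followed by
  compactness: some small grid cube has, for every coordinate \<open>i\<close>, vertices where
  \<open>f _ i\<close> has either weak sign. Points of the cube are sequences vanishing from index
  \<open>n\<close> on, so that the dimension can be a variable.\<close>

lemma poincare_miranda:
  fixes f :: "(nat \<Rightarrow> real) \<Rightarrow> nat \<Rightarrow> real" and n :: nat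
  defines "Q \<equiv> {x. (\<forall>i<n. 0 \<le> x i \<and> x i \<le> 1) \<and> (\<forall>i\<ge>n. x i = 0)}"
  assumes cont: "\<And>i. i < n \<Longrightarrow> continuous_on Q (\<lambda>x. f x i)"
    and lo: "\<And>x i. x \<in> Q \<Longrightarrow> i < n \<Longrightarrow> x i = 0 \<Longrightarrow> f x i \<le> 0"
    and hi: "\<And>x i. x \<in> Q \<Longrightarrow> i < n \<Longrightarrow> x i = 1 \<Longrightarrow> f x i \<ge> 0"
  shows "\<exists>x\<in>Q. \<forall>i<n. f x i = 0"
proof -
  have "\<exists>X\<in>Q. \<forall>i<n. \<exists>r\<in>Q. \<exists>s\<in>Q. (\<forall>j. \<bar>r j - X j\<bar> \<le> 1 / Suc p \<and> \<bar>s j - X j\<bar> \<le> 1 / Suc p)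
      \<and> f r i \<le> 0 \<and> f s i \<ge> 0" for p
  proof -
    define P where "P = Suc p"
    define pt where "pt x = (\<lambda>i. if i < n then real (x i) / P else 0)" for x :: "nat \<Rightarrow> nat"
    have P0: "real P > 0" by (simp add: P_def)
    have ptQ: "pt x \<in> Q" if "\<forall>i<n. x i \<le> P" for x
      using that P0 by (auto simp: Q_def pt_def)
    \<comment> \<open>Kuhn's lemma prescribes the labels on the faces; \<open>lo\<close> and
      \<open>hi\<close> ensure that even there label 0 means \<open>f <= 0\<close> and label 1 means
      \<open>f >= 0\<close>.\<close>
    define label where "label x i = (if x i = 0 then 0 else if x i = P then 1 else if f (pt x) i \<ge> 0 then 1 else (0::nat))"
      for x i
    have lab0: "f (pt x) i \<le> 0" if "\<forall>i<n. x i \<le> P" "i < n" "label x i = 0" for x i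
      using that lo[of "pt x" i] ptQ[of x] by (auto simp: label_def pt_def P_def split: if_splits)
    have lab1: "f (pt x) i \<ge> 0" if "\<forall>i<n. x i \<le> P" "i < n" "label x i = 1" for x i
      using that hi[of "pt x" i] ptQ[of x] P0 by (auto simp: label_def pt_def split: if_splits)
    obtain q where q: "\<forall>i<n. q i < P"
      and q': "\<forall>i<n. \<exists>r s. (\<forall>j<n. q j \<le> r j \<and> r j \<le> q j + 1) \<and> (\<forall>j<n. q j \<le> s j \<and> s j \<le> q j + 1) \<and> label r i \<noteq> label s i"
      by (rule kuhn_lemma[of P n label]) (auto simp: label_def P_def)
    have dist: "\<bar>pt r j - pt q j\<bar> \<le> 1 / P" if "\<forall>j<n. q j \<le> r j \<and> r j \<le> q j + 1" for r j
    proof (cases "j < n")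
      case True
      then have "real (q j) \<le> r j" "real (r j) \<le> real (q j) + 1" using that by force+
      then show ?thesis using P0 True
        by (simp add: pt_def abs_le_iff flip: diff_divide_distrib add_divide_distrib) (simp add: divide_simps)
    qed (simp add: pt_def)
    show ?thesis
    proof (rule bexI[of _ "pt q"], intro allI impI)
      show "pt q \<in> Q" using q by (intro ptQ) (auto intro: less_imp_le)
      fix i assume i: "i < n"
      obtain r s where r: "\<forall>j<n. q j \<le> r j \<and> r j \<le> q j + 1" and s: "\<forall>j<n. q j \<le> s j \<and> s j \<le> q j + 1"
        and rs: "label r i \<noteq> label s i" using q' i by blast
      have rP: "\<forall>j<n. r j \<le> P" and sP: "\<forall>j<n. s j \<le> P" using r s q by force+
      have "label r i = 0 \<and> label s i = 1 \<or> label r i = 1 \<and> label s i = 0"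
        using rs by (auto simp: label_def split: if_splits)
      then show "\<exists>r\<in>Q. \<exists>s\<in>Q. (\<forall>j. \<bar>r j - pt q j\<bar> \<le> 1 / Suc p \<and> \<bar>s j - pt q j\<bar> \<le> 1 / Suc p)
          \<and> f r i \<le> 0 \<and> f s i \<ge> 0"
        using lab0[OF rP i] lab1[OF rP i] lab0[OF sP i] lab1[OF sP i] ptQ[OF rP] ptQ[OF sP] dist[OF r] dist[OF s]
        unfolding P_def by blast
    qed
  qed
  then obtain X where XQ: "\<And>p. X p \<in> Q" and X: "\<And>p i. i < n \<Longrightarrow> \<exists>r\<in>Q. \<exists>s\<in>Q.
      (\<forall>j. \<bar>r j - X p j\<bar> \<le> 1 / Suc p \<and> \<bar>s j - X p j\<bar> \<le> 1 / Suc p) \<and> f r i \<le> 0 \<and> f s i \<ge> 0"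
    by metis
  have "norm (X p i) \<le> 1" for p i using XQ[of p] by (cases "i < n") (auto simp: Q_def)
  then obtain k where k: "strict_mono (k::nat\<Rightarrow>nat)" and "\<And>i. \<exists>l. (\<lambda>p. X (k p) i) \<longlonglongrightarrow> l"
    using function_convergent_subsequence[of "UNIV::nat set" X 1] by (metis UNIV_I countableI_type)
  then obtain x where x: "\<And>i. (\<lambda>p. X (k p) i) \<longlonglongrightarrow> x i" by metis
  have xQ: "x \<in> Q"
  proof -
    have "0 \<le> x i \<and> x i \<le> 1" if "i < n" for i
      using that XQ by (intro conjI LIMSEQ_le_const[OF x] LIMSEQ_le_const2[OF x]) (auto simp: Q_def)
    moreover have "x i = 0" if "i \<ge> n" for i
    proof -
      have "X (k p) i = 0" for p using XQ[of "k p"] that by (auto simp: Q_def)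
      then show ?thesis using x[of i] by (simp add: LIMSEQ_const_iff)
    qed
    ultimately show ?thesis by (auto simp: Q_def)
  qed
  have lim0: "(\<lambda>p. 1 / real (Suc (k p))) \<longlonglongrightarrow> 0"
    using LIMSEQ_subseq_LIMSEQ[OF LIMSEQ_inverse_real_of_nat k] by (simp add: o_def inverse_eq_divide)
  have lim: "(\<lambda>p. f (r p) i) \<longlonglongrightarrow> f x i" if "i < n" "\<And>p. r p \<in> Q" "\<And>p j. \<bar>r p j - X (k p) j\<bar> \<le> 1 / Suc (k p)" for r i
  proof -
    have "(\<lambda>p. r p j) \<longlonglongrightarrow> x j" for j
    proof -
      have "(\<lambda>p. r p j - X (k p) j) \<longlonglongrightarrow> 0"
        by (rule Lim_null_comparison[OF _ lim0]) (use that in auto)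
      from tendsto_add[OF this x[of j]] show ?thesis by simp
    qed
    then have "r \<longlonglongrightarrow> x" by (rule LIMSEQ_coordinatewise)
    then show ?thesis
      using cont[OF that(1)] xQ that(2) unfolding continuous_on_sequentially by (auto simp: o_def)
  qed
  have "f x i = 0" if i: "i < n" for i
  proof -
    obtain r s where r: "\<And>p. r p \<in> Q" "\<And>p j. \<bar>r p j - X (k p) j\<bar> \<le> 1 / Suc (k p)" "\<And>p. f (r p) i \<le> 0"
      and s: "\<And>p. s p \<in> Q" "\<And>p j. \<bar>s p j - X (k p) j\<bar> \<le> 1 / Suc (k p)" "\<And>p. f (s p) i \<ge> 0"
      using X[OF i, of "k _"] by metis
    have "f x i \<le> 0" by (rule LIMSEQ_le_const2[OF lim[OF i r(1,2)]]) (use r(3) in auto)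
    moreover have "f x i \<ge> 0" by (rule LIMSEQ_le_const[OF lim[OF i s(1,2)]]) (use s(3) in auto)
    ultimately show ?thesis by simp
  qed
  with xQ show ?thesis by blast
qed

text \<open>Without almost critical points, finitely many Euler steps \<open>T\<close> along the truncated negative gradient push
  the cube below the level \<open>\<delta>\<close> while fixing its boundary. The Poincare-Miranda theorem nevertheless yields
  a point of the cube whose image lies on the sphere.\<close>

lemma linking_almost_critical:
  fixes J :: "(nat \<Rightarrow> real) \<Rightarrow> real" and g :: "(nat \<Rightarrow> real) \<Rightarrow> nat \<Rightarrow> real" and lam :: "nat \<Rightarrow> real"
    and k m :: nat
  defines "V \<equiv> {c. \<forall>i\<ge>m. c i = 0}" and "N \<equiv> \<lambda>c. L2_set c {..<m}"
  assumes km: "k < m"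
    and contJ: "continuous_on UNIV J"
    and contg: "\<And>i. i < m \<Longrightarrow> continuous_on UNIV (\<lambda>c. g c i)"
    and diff: "\<And>b \<epsilon>. \<epsilon> > 0 \<Longrightarrow> \<exists>s>0. \<forall>c\<in>V. \<forall>d\<in>V. N c \<le> b \<longrightarrow> N d \<le> s \<longrightarrow>
        \<bar>J (\<lambda>i. c i + d i) - J c - (\<Sum>i<m. g c i * d i)\<bar> \<le> \<epsilon> * N d"
    and sphere: "\<And>c. c \<in> V \<Longrightarrow> (\<And>i. i < k \<Longrightarrow> c i = 0) \<Longrightarrow> (\<Sum>i=k..<m. lam i * (c i)\<^sup>2) = \<rho>\<^sup>2 \<Longrightarrow> \<delta> \<le> J c"
    and low: "\<And>c. (\<And>i. i > k \<Longrightarrow> c i = 0) \<Longrightarrow> c k = 0 \<or> (\<exists>i\<le>k. \<bar>c i\<bar> \<ge> R) \<Longrightarrow> J c \<le> 0"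
    and bdd: "\<And>c. (\<And>i. i > k \<Longrightarrow> c i = 0) \<Longrightarrow> (\<And>i. \<bar>c i\<bar> \<le> R) \<Longrightarrow> J c \<le> C"
    and pos: "\<delta> > 0" "R > 0" "C \<ge> 0" "\<epsilon> > 0"
    and R: "\<rho>\<^sup>2 \<le> lam k * R\<^sup>2"
  shows "\<exists>c\<in>V. \<delta> / 2 \<le> J c \<and> N (g c) \<le> \<epsilon>"
proof (rule ccontr)
  assume contra: "\<not> ?thesis"
  have gbig: "N (g c) > \<epsilon>" if "c \<in> V" "J c \<ge> \<delta> / 2" for c
    using contra that by force
  \<comment> \<open>\<open>B\<close> bounds the norm on the box of \<open>m\<close> coordinates of
    size at most \<open>R\<close>; \<open>b\<close> adds the length of a whole trajectory,
    \<open>n\<close> steps of size at most \<open>s\<close> with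
    \<open>n * s <= 2 * C / \<epsilon> + 2\<close> below.\<close>
  define B where "B = real m * R"
  define b where "b = B + 2 * C / \<epsilon> + 2"
  obtain s0 where s0: "s0 > 0" and diff0: "\<And>c d. c \<in> V \<Longrightarrow> d \<in> V \<Longrightarrow> N c \<le> b \<Longrightarrow> N d \<le> s0 \<Longrightarrow>
        \<bar>J (\<lambda>i. c i + d i) - J c - (\<Sum>i<m. g c i * d i)\<bar> \<le> \<epsilon> / 2 * N d"
    using diff[of "\<epsilon> / 2" b] pos by (meson half_gt_zero)
  define s where "s = min s0 1"
  have s: "s > 0" "s \<le> s0" "s \<le> 1" using s0 by (auto simp: s_def)
  \<comment> \<open>The cutoff switches the descent off below \<open>\<delta> / 2\<close>, which
    keeps the boundary of the box (where \<open>J <= 0\<close>) fixed, and fully on from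
    \<open>\<delta>\<close>, which is where each step has to gain.\<close>
  define \<theta> where "\<theta> c = min 1 (max 0 ((J c - \<delta> / 2) / (\<delta> / 2)))" for c
  have \<theta>01: "0 \<le> \<theta> c" "\<theta> c \<le> 1" for c by (auto simp: \<theta>_def)
  have \<theta>0: "\<theta> c = 0" if "J c \<le> \<delta> / 2" for c
    using that pos by (simp add: \<theta>_def divide_le_0_iff)
  have \<theta>1: "\<theta> c = 1" if "J c \<ge> \<delta>" for c
  proof -
    have "(J c - \<delta> / 2) / (\<delta> / 2) \<ge> 1" using that pos by (simp add: pos_le_divide_eq)
    then show ?thesis by (simp add: \<theta>_def)
  qed
  \<comment> \<open>For \<open>c\<close> in \<open>V\<close> with nonzero \<open>\<theta> c\<close>
    the gradient exceeds \<open>\<epsilon>\<close>, so the maximum is its norm and the step has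
    length \<open>s * \<theta> c\<close>; elsewhere the maximum only keeps \<open>D\<close>
    continuous.\<close>
  define D where "D c = (\<lambda>i. if i < m then - (s * \<theta> c / max \<epsilon> (N (g c))) * g c i else 0)" for c
  define T where "T c = (\<lambda>i. c i + D c i)" for c
  have DV: "D c \<in> V" for c by (simp add: D_def V_def)
  have TV: "T c \<in> V" if "c \<in> V" for c using that DV[of c] by (simp add: T_def V_def)
  have ND: "N (D c) = s * \<theta> c * (N (g c) / max \<epsilon> (N (g c)))" for c
  proof -
    have "N (D c) = L2_set (\<lambda>i. (s * \<theta> c / max \<epsilon> (N (g c))) * g c i) {..<m}"
      unfolding N_def D_def L2_set_def by (intro arg_cong[where f=sqrt] sum.cong) (auto simp: power_mult_distrib)
    also have "\<dots> = (s * \<theta> c / max \<epsilon> (N (g c))) * N (g c)"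
      using s \<theta>01[of c] pos(4) by (subst L2_set_right_distrib[symmetric]) (auto simp: N_def)
    finally show ?thesis by simp
  qed
  have N0: "N c \<ge> 0" for c by (simp add: N_def)
  have NDs: "N (D c) \<le> s" for c
  proof -
    have "N (g c) / max \<epsilon> (N (g c)) \<le> 1" using pos(4) by (simp add: divide_le_eq)
    then have "s * \<theta> c * (N (g c) / max \<epsilon> (N (g c))) \<le> s * 1 * 1"
      using s \<theta>01[of c] pos(4) N0[of "g c"] by (intro mult_mono) auto
    then show ?thesis by (simp add: ND)
  qed
  have NT: "N (T c) \<le> N c + s" for c
    using L2_set_triangle_ineq[of c "D c" "{..<m}"] NDs[of c] by (simp add: N_def T_def)
  have fixed: "T c = c" if "J c \<le> \<delta> / 2" for c
    using \<theta>0[OF that] by (auto simp: T_def D_def)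
  have desc: "J (T c) \<le> J c - \<epsilon> / 2 * s * \<theta> c" if c: "c \<in> V" "N c \<le> b" for c
  proof (cases "J c \<le> \<delta> / 2")
    case True
    then show ?thesis using fixed[OF True] \<theta>0[OF True] by simp
  next
    case False
    then have gb: "N (g c) > \<epsilon>" using gbig[OF c(1)] by simp
    then have NDe: "N (D c) = s * \<theta> c" using pos by (simp add: ND)
    have "(\<Sum>i<m. g c i * D c i) = - (s * \<theta> c / N (g c)) * (\<Sum>i<m. (g c i)\<^sup>2)"
      unfolding sum_distrib_left using gb by (intro sum.cong) (auto simp: D_def power2_eq_square)
    also have "(\<Sum>i<m. (g c i)\<^sup>2) = (N (g c))\<^sup>2"
      by (simp add: N_def L2_set_def sum_nonneg)
    finally have e: "(\<Sum>i<m. g c i * D c i) = - s * \<theta> c * N (g c)"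
      using gb pos by (simp add: power2_eq_square)
    have "J (T c) \<le> J c + (\<Sum>i<m. g c i * D c i) + \<epsilon> / 2 * N (D c)"
      using diff0[OF c(1) DV c(2), of c] NDs[of c] s unfolding T_def by linarith
    also have "\<dots> = J c - s * \<theta> c * N (g c) + \<epsilon> / 2 * s * \<theta> c" by (simp add: e NDe)
    also have "\<dots> \<le> J c - s * \<theta> c * \<epsilon> + \<epsilon> / 2 * s * \<theta> c"
      using mult_left_mono[of \<epsilon> "N (g c)" "s * \<theta> c"] gb s \<theta>01[of c] mult_nonneg_nonneg[of s "\<theta> c"]
      by linarith
    finally show ?thesis by (simp add: algebra_simps)
  qed
  have contN: "continuous_on UNIV (\<lambda>c. N (g c))"
    unfolding N_def L2_set_def by (intro continuous_intros contg) auto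
  have contT: "continuous_on UNIV T"
  proof (rule continuous_on_coordinatewise_then_product)
    fix i
    show "continuous_on UNIV (\<lambda>c. T c i)"
    proof (cases "i < m")
      case True
      have "max \<epsilon> (N (g c)) \<noteq> 0" for c using pos by (simp add: max_def)
      then show ?thesis unfolding T_def D_def \<theta>_def using True contg[OF True] contJ contN pos
        by (auto intro!: continuous_intros continuous_on_product_coordinates)
    next
      case False
      then show ?thesis by (simp add: T_def D_def continuous_on_product_coordinates)
    qed
  qed
  \<comment> \<open>Enough steps for a total descent \<open>n * (\<epsilon> / 2 * s)\<close> above
    the bound \<open>C\<close> of \<open>J\<close> on the box: a trajectory that stayed at or above
    \<open>\<delta>\<close> would end below 0.\<close>
  define n where "n = nat \<lceil>2 * C / (\<epsilon> * s)\<rceil> + 1"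
  have n1: "real n * (\<epsilon> / 2 * s) > C"
  proof -
    have "2 * C / (\<epsilon> * s) < real n" by (simp add: n_def) linarith
    then show ?thesis using pos s by (simp add: field_simps)
  qed
  have n2: "real n * s \<le> 2 * C / \<epsilon> + 2"
  proof -
    have "real n \<le> 2 * C / (\<epsilon> * s) + 2"
      using pos s by (simp add: n_def) linarith
    then have "real n * s \<le> (2 * C / (\<epsilon> * s) + 2) * s" using s by (simp add: mult_right_mono)
    also have "\<dots> = 2 * C / \<epsilon> + 2 * s" using s pos by (simp add: field_simps)
    finally show ?thesis using s by simp
  qed
  \<comment> \<open>\<open>J\<close> never increases along the iteration, so a value of at least
    \<open>\<delta>\<close> after \<open>j\<close> steps means that all earlier values were too, and
    every step made its full gain.\<close>
  have iter: "(T ^^ j) c \<in> V \<and> N ((T ^^ j) c) \<le> B + j * s \<and> J ((T ^^ j) c) \<le> J c \<and>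
      (J ((T ^^ j) c) \<ge> \<delta> \<longrightarrow> J ((T ^^ j) c) \<le> J c - j * (\<epsilon> / 2 * s))"
    if c: "c \<in> V" "N c \<le> B" and j: "j \<le> n" for c j
    using j
  proof (induction j)
    case 0
    then show ?case using c by simp
  next
    case (Suc j)
    define e where "e = (T ^^ j) c"
    have IH: "e \<in> V" "N e \<le> B + j * s" "J e \<le> J c" "J e \<ge> \<delta> \<Longrightarrow> J e \<le> J c - j * (\<epsilon> / 2 * s)"
      using Suc by (auto simp: e_def)
    have "real j * s \<le> real n * s" using Suc.prems s by (intro mult_right_mono) auto
    then have "N e \<le> b" using IH(2) n2 by (simp add: b_def)
    note d = desc[OF IH(1) this]
    have d': "J (T e) \<le> J e" using d \<theta>01[of e] s pos by (smt (verit) mult_nonneg_nonneg divide_nonneg_pos)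
    have "J (T e) \<le> J c - Suc j * (\<epsilon> / 2 * s)" if "J (T e) \<ge> \<delta>"
    proof -
      have "J e \<ge> \<delta>" using that d' by simp
      then show ?thesis using d \<theta>1[of e] IH(4) by (simp add: field_simps)
    qed
    moreover have "(T ^^ Suc j) c = T e" by (simp add: e_def)
    moreover have "N (T e) \<le> B + Suc j * s" using NT[of e] IH(2) by (simp add: algebra_simps)
    moreover have "J (T e) \<le> J c" using IH(3) d' by simp
    ultimately show ?case using TV[OF IH(1)] by metis
  qed
  have fin: "J ((T ^^ n) c) < \<delta>" if c: "c \<in> V" "N c \<le> B" "J c \<le> C" for c
  proof (rule ccontr)
    assume "\<not> ?thesis"
    then have "J ((T ^^ n) c) \<le> J c - n * (\<epsilon> / 2 * s)" using iter[OF c(1,2) order_refl] by simp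
    with c(3) n1 pos \<open>\<not> ?thesis\<close> show False by linarith
  qed
  define Q where "Q = {x::nat\<Rightarrow>real. (\<forall>i<Suc k. 0 \<le> x i \<and> x i \<le> 1) \<and> (\<forall>i\<ge>Suc k. x i = 0)}"
  \<comment> \<open>\<open>P\<close> maps the unit cube with \<open>k + 1\<close> coordinates onto
    the product of \<open>k\<close> intervals \<open>[-R, R]\<close> and one interval
    \<open>[0, R]\<close>; by \<open>low\<close> all faces of this box lie in
    \<open>J <= 0\<close>.\<close>
  define P where "P z = (\<lambda>i. if i < k then R * (2 * z i - 1) else if i = k then R * z i else 0)" for z :: "nat \<Rightarrow> real"
  define y where "y z = (T ^^ n) (P z)" for z
  \<comment> \<open>A common zero gives a point whose image has no component below \<open>k\<close>
    and lies on the sphere. The sphere equation takes the place of coordinate \<open>k\<close>,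
    along which the box leaves the sphere's interior.\<close>
  define f where "f z i = (if i < k then y z i else (\<Sum>j=k..<m. lam j * (y z j)\<^sup>2) - \<rho>\<^sup>2)" for z i
  have PV: "P z \<in> V" for z using km by (auto simp: P_def V_def)
  have Pk: "P z i = 0" if "i > k" for z i using that by (simp add: P_def)
  have PR: "\<bar>P z i\<bar> \<le> R" if "z \<in> Q" for z i
  proof -
    have "\<bar>2 * z i - 1\<bar> \<le> 1" "\<bar>z i\<bar> \<le> 1" if "i \<le> k" using \<open>z \<in> Q\<close> that by (auto simp: Q_def abs_le_iff)
    then show ?thesis using pos by (auto simp: P_def abs_mult mult_left_le)
  qed
  have NP: "N (P z) \<le> B" if "z \<in> Q" for z
  proof -
    have "N (P z) \<le> (\<Sum>i<m. \<bar>P z i\<bar>)" unfolding N_def by (rule L2_set_le_sum_abs)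
    also have "\<dots> \<le> (\<Sum>i<m. R)" using PR[OF that] by (intro sum_mono) auto
    finally show ?thesis by (simp add: B_def)
  qed
  have contTn: "continuous_on UNIV (T ^^ j)" for j
  proof (induction j)
    case (Suc j)
    have "continuous_on UNIV (\<lambda>x. T ((T ^^ j) x))" by (rule continuous_on_compose2[OF contT Suc]) simp
    then show ?case by (simp add: o_def)
  qed (simp add: id_def)
  have contP: "continuous_on UNIV P"
  proof (rule continuous_on_coordinatewise_then_product)
    fix i
    show "continuous_on UNIV (\<lambda>z. P z i)"
      unfolding P_def by (cases "i < k"; cases "i = k") (auto intro!: continuous_intros continuous_on_product_coordinates)
  qed
  have conty: "continuous_on UNIV (\<lambda>z. y z i)" for i
    unfolding y_def
    by (rule continuous_on_product_then_coordinatewise, rule continuous_on_compose2[OF contTn contP]) simp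
  have "\<exists>x\<in>Q. \<forall>i<Suc k. f x i = 0"
    unfolding Q_def
  proof (rule poincare_miranda, unfold Q_def[symmetric])
    fix i
    show "continuous_on Q (\<lambda>x. f x i)"
      by (rule continuous_on_subset[of UNIV], cases "i < k")
         (simp_all add: f_def conty continuous_intros)
  next
    fix z i assume z: "z \<in> Q" "i < Suc k" "z i = 0"
    have "J (P z) \<le> 0"
    proof (rule low)
      show "P z k = 0 \<or> (\<exists>i\<le>k. R \<le> \<bar>P z i\<bar>)"
        using z pos by (cases "i = k") (auto simp: P_def intro!: exI[of _ i])
    qed (rule Pk)
    then have "J (P z) \<le> \<delta> / 2" using pos by simp
    from fixed[OF this] have "(T ^^ j) (P z) = P z" for j by (induction j) auto
    then have yP: "y z = P z" by (simp add: y_def)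
    show "f z i \<le> 0"
    proof (cases "i < k")
      case True
      then show ?thesis using z pos by (simp add: f_def yP P_def)
    next
      case False
      then have i: "i = k" using z by simp
      have "(\<Sum>j=k..<m. lam j * (P z j)\<^sup>2) = 0"
        using z i by (intro sum.neutral) (auto simp: P_def)
      then show ?thesis using i by (simp add: f_def yP)
    qed
  next
    fix z i assume z: "z \<in> Q" "i < Suc k" "z i = 1"
    have "J (P z) \<le> 0"
    proof (rule low)
      show "P z k = 0 \<or> (\<exists>i\<le>k. R \<le> \<bar>P z i\<bar>)"
        using z pos by (auto simp: P_def intro!: exI[of _ i])
    qed (rule Pk)
    then have "J (P z) \<le> \<delta> / 2" using pos by simp
    from fixed[OF this] have "(T ^^ j) (P z) = P z" for j by (induction j) auto
    then have yP: "y z = P z" by (simp add: y_def)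
    show "0 \<le> f z i"
    proof (cases "i < k")
      case True
      then show ?thesis using z pos by (simp add: f_def yP P_def)
    next
      case False
      then have i: "i = k" using z by simp
      have "(\<Sum>j=k..<m. lam j * (P z j)\<^sup>2) = lam k * (P z k)\<^sup>2 + (\<Sum>j=Suc k..<m. lam j * (P z j)\<^sup>2)"
        using km by (rule sum.atLeast_Suc_lessThan)
      also have "(\<Sum>j=Suc k..<m. lam j * (P z j)\<^sup>2) = 0"
        by (intro sum.neutral) (auto simp: P_def)
      finally show ?thesis using i z R by (simp add: f_def yP P_def)
    qed
  qed
  then obtain z where z: "z \<in> Q" "\<And>i. i < Suc k \<Longrightarrow> f z i = 0" by blast
  have yV: "y z \<in> V" unfolding y_def using iter[OF PV NP[OF z(1)] order_refl] by blast
  have "\<delta> \<le> J (y z)"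
  proof (rule sphere[OF yV])
    show "y z i = 0" if "i < k" for i using z(2)[of i] that by (simp add: f_def)
    show "(\<Sum>i=k..<m. lam i * (y z i)\<^sup>2) = \<rho>\<^sup>2" using z(2)[of k] by (simp add: f_def)
  qed
  moreover have "J (y z) < \<delta>" unfolding y_def
    using bdd[OF Pk PR[OF z(1)]] by (intro fin PV NP z(1)) auto
  ultimately show False by simp
qed

section \<open>Compact pairs of quadratic forms\<close>

text \<open>A semidefinite form on a subspace instead of an inner product type: the same functions
  carry several forms, and Cauchy-Schwarz is also applied to forms with a kernel, such as
  \<open>a\<close> minus \<open>a u u\<close> times \<open>h\<close> at a minimiser
  \<open>u\<close>.\<close>

locale psd_form =
  fixes E :: "'v::real_vector set" and b :: "'v \<Rightarrow> 'v \<Rightarrow> real"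
  assumes subspace: "subspace E"
    and sym: "u \<in> E \<Longrightarrow> v \<in> E \<Longrightarrow> b u v = b v u"
    and add: "u \<in> E \<Longrightarrow> v \<in> E \<Longrightarrow> w \<in> E \<Longrightarrow> b (u + v) w = b u w + b v w"
    and scale: "u \<in> E \<Longrightarrow> v \<in> E \<Longrightarrow> b (r *\<^sub>R u) v = r * b u v"
    and nonneg: "u \<in> E \<Longrightarrow> 0 \<le> b u u"
begin

lemmas mem = subspace_add[OF subspace] subspace_diff[OF subspace] subspace_scale[OF subspace]
  subspace_0[OF subspace] subspace_sum[OF subspace]

lemma add2: "u \<in> E \<Longrightarrow> v \<in> E \<Longrightarrow> w \<in> E \<Longrightarrow> b w (u + v) = b w u + b w v"
  using add[of u v w] sym[of w u] sym[of w v] sym[of w "u + v"] mem(1)[of u v] by simp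

lemma scale2: "u \<in> E \<Longrightarrow> v \<in> E \<Longrightarrow> b v (r *\<^sub>R u) = r * b v u"
  using scale[of u v r] sym[of v u] sym[of v "r *\<^sub>R u"] mem(3)[of u r] by simp

lemma zero: "u \<in> E \<Longrightarrow> b 0 u = 0"
  using scale[of u u 0] by simp

lemma diff: "u \<in> E \<Longrightarrow> v \<in> E \<Longrightarrow> w \<in> E \<Longrightarrow> b (u - v) w = b u w - b v w"
  using add[of u "(-1) *\<^sub>R v" w] scale[of v w "-1"] mem(3)[of v "-1"] by simp

lemma diff2: "u \<in> E \<Longrightarrow> v \<in> E \<Longrightarrow> w \<in> E \<Longrightarrow> b w (u - v) = b w u - b w v"
  using diff[of u v w] sym[of w u] sym[of w v] sym[of w "u - v"] mem(2)[of u v] by simp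

lemma sum: "finite I \<Longrightarrow> (\<And>i. i \<in> I \<Longrightarrow> f i \<in> E) \<Longrightarrow> v \<in> E \<Longrightarrow>
    b (\<Sum>i\<in>I. c i *\<^sub>R f i) v = (\<Sum>i\<in>I. c i * b (f i) v)"
  by (induction rule: finite_induct) (simp_all add: zero add scale mem)

lemma quad_diff: "u \<in> E \<Longrightarrow> v \<in> E \<Longrightarrow> b (u - v) (u - v) = b u u - 2 * b u v + b v v"
  by (simp add: diff diff2 mem sym[of v u])

lemma cauchy_schwarz:
  assumes "u \<in> E" "v \<in> E"
  shows "(b u v)\<^sup>2 \<le> b u u * b v v"
proof -
  have q: "0 \<le> b u u - 2 * t * b u v + t\<^sup>2 * b v v" for t
    using nonneg[of "u - t *\<^sub>R v"] assms quad_diff[of u "t *\<^sub>R v"]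
    by (simp add: mem scale scale2 power2_eq_square algebra_simps)
  show ?thesis
  proof (cases "b v v = 0")
    case True
    have "b u v = 0"
    proof (rule ccontr)
      \<comment> \<open>With \<open>b v v = 0\<close> the expression in \<open>q\<close> is affine
        in \<open>t\<close>; the chosen \<open>t\<close> gives it the value -1.\<close>
      assume "b u v \<noteq> 0"
      then show False using q[of "(b u u + 1) / (2 * b u v)"] True by simp
    qed
    then show ?thesis by (simp add: True)
  next
    case False
    then have p: "b v v > 0" using nonneg[OF assms(2)] by simp
    have "0 \<le> b v v * (b u u - 2 * (b u v / b v v) * b u v + (b u v / b v v)\<^sup>2 * b v v)"
      using p q[of "b u v / b v v"] by (intro mult_nonneg_nonneg) auto
    also have "\<dots> = b u u * b v v - (b u v)\<^sup>2"
      using p by (simp add: field_simps power2_eq_square)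
    finally show ?thesis by simp
  qed
qed

lemma quad_add_le: "u \<in> E \<Longrightarrow> v \<in> E \<Longrightarrow> b (u + v) (u + v) \<le> 2 * b u u + 2 * b v v"
  using nonneg[of "u - v"] by (simp add: mem add add2 diff diff2 sym[of v u])

lemma quad_diff_le: "u \<in> E \<Longrightarrow> v \<in> E \<Longrightarrow> b (u - v) (u - v) \<le> 2 * b u u + 2 * b v v"
  using nonneg[of "u + v"] by (simp add: mem add add2 diff diff2 sym[of v u])

lemma abs_le:
  assumes "u \<in> E" "v \<in> E"
  shows "\<bar>b u v\<bar> \<le> sqrt (b u u) * sqrt (b v v)"
  using real_sqrt_le_mono[OF cauchy_schwarz[OF assms]] by (simp add: real_sqrt_mult)

lemma tendsto_form:
  assumes U: "\<And>j. U j \<in> E" "u \<in> E" and v: "v \<in> E" and lim: "(\<lambda>j. b (U j - u) (U j - u)) \<longlonglongrightarrow> 0"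
  shows "(\<lambda>j. b (U j) v) \<longlonglongrightarrow> b u v"
proof -
  have 1: "(\<lambda>j. sqrt (b (U j - u) (U j - u)) * sqrt (b v v)) \<longlonglongrightarrow> 0"
    using tendsto_mult_right[OF tendsto_real_sqrt[OF lim], of "sqrt (b v v)"] by simp
  have 2: "norm (b (U j) v - b u v) \<le> sqrt (b (U j - u) (U j - u)) * sqrt (b v v)" for j
    using abs_le[of "U j - u" v] U v mem(2)[of "U j" u] by (simp add: diff)
  have "(\<lambda>j. b (U j) v - b u v) \<longlonglongrightarrow> 0"
    by (rule Lim_null_comparison[OF always_eventually 1]) (use 2 in blast)
  then show ?thesis by (rule LIM_zero_cancel)
qed

lemma tendsto_quad:
  assumes U: "\<And>j. U j \<in> E" "u \<in> E" and lim: "(\<lambda>j. b (U j - u) (U j - u)) \<longlonglongrightarrow> 0"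
  shows "(\<lambda>j. b (U j) (U j)) \<longlonglongrightarrow> b u u"
proof -
  have 1: "(\<lambda>j. b (U j) (U j)) = (\<lambda>j. b (U j - u) (U j - u) + 2 * b (U j) u - b u u)"
    using quad_diff[of "U _" u] U by (intro ext) simp
  have 2: "0 + 2 * b u u - b u u = b u u" by simp
  have "(\<lambda>j. b (U j - u) (U j - u) + 2 * b (U j) u - b u u) \<longlonglongrightarrow> 0 + 2 * b u u - b u u"
    by (intro tendsto_diff tendsto_add tendsto_mult tendsto_const lim tendsto_form[OF U U(2) lim])
  then show ?thesis unfolding 1 2 .
qed

definition proj :: "'v set \<Rightarrow> 'v \<Rightarrow> 'v" where
  "proj X v = (\<Sum>x\<in>X. b v x *\<^sub>R x)"

definition orthonormal :: "'v set \<Rightarrow> bool" where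
  "orthonormal X \<longleftrightarrow> finite X \<and> X \<subseteq> E \<and> (\<forall>x\<in>X. \<forall>y\<in>X. b x y = (if x = y then 1 else 0))"

lemma proj_mem: "orthonormal X \<Longrightarrow> proj X v \<in> E"
  unfolding proj_def orthonormal_def by (auto intro!: mem)

lemma form_proj:
  assumes X: "orthonormal X" and v: "v \<in> E" "w \<in> E"
  shows "b (proj X v) w = (\<Sum>x\<in>X. b v x * b x w)"
  unfolding proj_def using X v by (intro sum) (auto simp: orthonormal_def)

lemma form_proj_basis:
  assumes X: "orthonormal X" and v: "v \<in> E" "x \<in> X"
  shows "b (proj X v) x = b v x"
proof -
  have "x \<in> E" and fin: "finite X" using X v(2) by (auto simp: orthonormal_def)
  then have "b (proj X v) x = (\<Sum>y\<in>X. b v y * b y x)" by (intro form_proj[OF X v(1)])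
  also have "\<dots> = (\<Sum>y\<in>X. if y = x then b v y else 0)"
    using X v(2) by (intro sum.cong) (auto simp: orthonormal_def)
  finally show ?thesis using fin v(2) by simp
qed

lemma quad_diff_proj:
  assumes X: "orthonormal X" and v: "v \<in> E"
  shows "b (v - proj X v) (v - proj X v) = b v v - (\<Sum>x\<in>X. (b v x)\<^sup>2)"
proof -
  have "b (proj X v) (proj X v) = (\<Sum>x\<in>X. (b v x)\<^sup>2)"
    using X v form_proj_basis[OF X v] unfolding orthonormal_def
    by (subst form_proj[OF X v proj_mem[OF X]])
       (auto intro!: sum.cong simp: power2_eq_square sym[of _ "proj X v"] proj_mem[OF X])
  moreover have "b v (proj X v) = (\<Sum>x\<in>X. (b v x)\<^sup>2)"
    using X v unfolding orthonormal_def
    by (subst sym[OF v proj_mem[OF X]], subst form_proj[OF X v v])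
       (auto intro!: sum.cong simp: power2_eq_square sym[of _ v])
  ultimately show ?thesis using quad_diff[OF v proj_mem[OF X]] by simp
qed

lemma bessel: "orthonormal X \<Longrightarrow> v \<in> E \<Longrightarrow> (\<Sum>x\<in>X. (b v x)\<^sup>2) \<le> b v v"
  using quad_diff_proj nonneg[of "v - proj X v"] by (simp add: mem proj_mem)

end

text \<open>Abstracts a compact embedding. In the absence of a weak topology, the lower
  semicontinuity of \<open>a\<close> is part of \<open>compact\<close>: any bound that
  \<open>a\<close> satisfies eventually along the sequence passes to the limit.
  \<open>infinite_dim\<close> keeps the successive minimisation from running out of vectors.\<close>

locale compact_form_pair =
  A: psd_form E a + H: psd_form E h for E :: "'v::real_vector set" and a h +
  assumes le: "u \<in> E \<Longrightarrow> h u u \<le> a u u"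
    and compact: "(\<And>j::nat. U j \<in> E) \<Longrightarrow> (\<And>j. a (U j) (U j) \<le> C) \<Longrightarrow>
      \<exists>r u. strict_mono (r::nat\<Rightarrow>nat) \<and> u \<in> E \<and> (\<lambda>j. h (U (r j) - u) (U (r j) - u)) \<longlonglongrightarrow> 0 \<and>
        (\<forall>c. (\<forall>\<^sub>F j in sequentially. a (U j) (U j) \<le> c) \<longrightarrow> a u u \<le> c)"
    and infinite_dim: "\<exists>f::nat\<Rightarrow>'v. \<forall>i j. f i \<in> E \<and> h (f i) (f j) = (if i = j then 1 else 0)"
begin

text \<open>Dimension count through Bessel: if each of \<open>card X + 1\<close> orthonormal vectors
  had a projection onto \<open>X\<close> of square norm at least 1, summing in the other order would
  give \<open>card X + 1 <= card X\<close>. A vector with a smaller projection leaves a remainder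
  that can be normalised.\<close>

lemma exists_unit_orthogonal:
  assumes X: "H.orthonormal X"
  shows "\<exists>u\<in>E. h u u = 1 \<and> (\<forall>x\<in>X. h u x = 0)"
proof -
  obtain f :: "nat \<Rightarrow> 'v" where f0: "\<forall>i j. f i \<in> E \<and> h (f i) (f j) = (if i = j then 1 else 0)"
    using infinite_dim by (rule exE)
  have f: "f i \<in> E" "h (f i) (f j) = (if i = j then 1 else 0)" for i j
    by (simp_all add: f0)
  have inj: "inj f"
  proof (rule injI)
    fix i j assume "f i = f j"
    then have "h (f i) (f j) = 1" using f(2)[of i i] by simp
    then show "i = j" using f(2)[of i j] by (simp split: if_splits)
  qed
  define F where "F = f ` {..card X}"
  have F: "H.orthonormal F" using f inj by (auto simp: F_def H.orthonormal_def inj_eq)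
  have XE: "X \<subseteq> E" "finite X" using X by (auto simp: H.orthonormal_def)
  have "\<exists>v\<in>F. (\<Sum>x\<in>X. (h v x)\<^sup>2) < 1"
  proof (rule ccontr)
    assume "\<not> ?thesis"
    then have "(\<Sum>v\<in>F. 1) \<le> (\<Sum>v\<in>F. \<Sum>x\<in>X. (h v x)\<^sup>2)" by (intro sum_mono) (auto simp: not_less)
    also have "\<dots> = (\<Sum>x\<in>X. \<Sum>v\<in>F. (h x v)\<^sup>2)"
      using XE F by (subst sum.swap) (auto intro!: sum.cong simp: H.sym H.orthonormal_def subset_iff)
    also have "\<dots> \<le> (\<Sum>x\<in>X. h x x)" using XE by (intro sum_mono H.bessel F) auto
    also have "\<dots> = card X" using X by (simp add: H.orthonormal_def)
    finally have "card F \<le> card X" by simp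
    moreover have "card F = Suc (card X)" unfolding F_def using inj by (subst card_image) (auto intro: inj_on_subset)
    ultimately show False by simp
  qed
  then obtain v where v: "v \<in> F" "(\<Sum>x\<in>X. (h v x)\<^sup>2) < 1" by blast
  have vE: "v \<in> E" and vv: "h v v = 1" using v(1) F by (auto simp: H.orthonormal_def)
  define w where "w = v - H.proj X v"
  have wE: "w \<in> E" using vE X by (simp add: w_def H.mem H.proj_mem)
  have wp: "h w w > 0" using H.quad_diff_proj[OF X vE] v vv by (simp add: w_def)
  have wX: "h w x = 0" if "x \<in> X" for x
    using H.form_proj_basis[OF X vE that] that XE vE X unfolding w_def
    by (subst H.diff) (auto simp: H.proj_mem)
  show ?thesis
  proof (intro bexI[of _ "(1 / sqrt (h w w)) *\<^sub>R w"] conjI ballI)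
    show "h ((1 / sqrt (h w w)) *\<^sub>R w) ((1 / sqrt (h w w)) *\<^sub>R w) = 1"
      using wE wp by (simp add: H.scale H.scale2 H.mem)
    show "h ((1 / sqrt (h w w)) *\<^sub>R w) x = 0" if "x \<in> X" for x
      using wE wX[OF that] that XE by (auto simp: H.scale)
  qed (use wE H.mem in auto)
qed

text \<open>\<open>u\<close> minimises the Rayleigh quotient of \<open>a\<close> over
  \<open>h\<close> on the complement of \<open>X\<close>; without a division, vectors with
  \<open>h v v = 0\<close> need no exception.\<close>

definition minimal :: "'v set \<Rightarrow> 'v \<Rightarrow> bool" where
  "minimal X u \<longleftrightarrow> u \<in> E \<and> h u u = 1 \<and> (\<forall>x\<in>X. h u x = 0) \<and>
     (\<forall>v\<in>E. (\<forall>x\<in>X. h v x = 0) \<longrightarrow> a u u * h v v \<le> a v v)"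

text \<open>Direct method: a minimising sequence on the unit sphere of \<open>h\<close> is bounded
  in \<open>a\<close>; convergence in \<open>h\<close> preserves the constraints, and semicontinuity
  of \<open>a\<close> gives the minimum.\<close>

lemma exists_minimal:
  assumes X: "H.orthonormal X"
  shows "\<exists>u. minimal X u"
proof -
  define S where "S = {u\<in>E. h u u = 1 \<and> (\<forall>x\<in>X. h u x = 0)}"
  define \<mu> where "\<mu> = (INF u\<in>S. a u u)"
  have XE: "X \<subseteq> E" using X by (auto simp: H.orthonormal_def)
  have Sne: "S \<noteq> {}" using exists_unit_orthogonal[OF X] by (auto simp: S_def)
  have bdd: "bdd_below ((\<lambda>u. a u u) ` S)"
    using A.nonneg by (intro bdd_belowI[of _ 0]) (auto simp: S_def)
  have low: "\<mu> \<le> a u u" if "u \<in> S" for u unfolding \<mu>_def by (rule cINF_lower[OF bdd that])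
  have "\<exists>u\<in>S. a u u < \<mu> + 1 / Suc j" for j
    using cInf_lessD[of "(\<lambda>u. a u u) ` S" "\<mu> + 1 / Suc j"] Sne by (auto simp: \<mu>_def)
  then obtain U where U: "\<And>j. U j \<in> S" "\<And>j. a (U j) (U j) < \<mu> + 1 / Suc j" by metis
  have UE: "U j \<in> E" for j using U(1) by (auto simp: S_def)
  have "a (U j) (U j) \<le> \<mu> + 1" for j using U(2)[of j] by (smt (verit) divide_le_eq_1 of_nat_0_le_iff of_nat_Suc)
  then obtain r u where r: "strict_mono r" and u: "u \<in> E" and lim: "(\<lambda>j. h (U (r j) - u) (U (r j) - u)) \<longlonglongrightarrow> 0"
    and lsc: "\<And>c. (\<forall>\<^sub>F j in sequentially. a (U j) (U j) \<le> c) \<Longrightarrow> a u u \<le> c"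
    using compact[of U "\<mu> + 1"] UE by blast
  have "h (U j) (U j) = 1" for j using U(1) by (auto simp: S_def)
  then have 1: "h u u = 1" using H.tendsto_quad[OF UE u lim] by (simp add: LIMSEQ_const_iff)
  have 2: "h u x = 0" if "x \<in> X" for x
  proof -
    have "h (U j) x = 0" for j using U(1) that by (auto simp: S_def)
    then show ?thesis using H.tendsto_form[OF UE u _ lim, of x] XE that by (auto simp: LIMSEQ_const_iff)
  qed
  \<comment> \<open>The values fall below \<open>\<mu> + e\<close> only eventually, which is why
    semicontinuity is formulated with eventual bounds.\<close>
  have "a u u \<le> \<mu> + e" if "e > 0" for e
  proof (rule lsc)
    have "\<forall>\<^sub>F j in sequentially. inverse (real (Suc j)) < e"
      using order_tendstoD(2)[OF LIMSEQ_inverse_real_of_nat that] .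
    then show "\<forall>\<^sub>F j in sequentially. a (U j) (U j) \<le> \<mu> + e"
    proof eventually_elim
      case (elim j)
      then show ?case using U(2)[of j] by (simp add: inverse_eq_divide)
    qed
  qed
  then have au: "a u u \<le> \<mu>" by (rule field_le_epsilon)
  have "a u u * h v v \<le> a v v" if v: "v \<in> E" "\<forall>x\<in>X. h v x = 0" for v
  proof (cases "h v v = 0")
    case True
    then show ?thesis using A.nonneg v by simp
  next
    case False
    then have p: "h v v > 0" using H.nonneg[OF v(1)] by simp
    define w where "w = (1 / sqrt (h v v)) *\<^sub>R v"
    have "w \<in> S" using v p XE by (auto simp: S_def w_def H.mem H.scale H.scale2 subset_iff)
    moreover have "a w w = a v v / h v v" using v p by (simp add: w_def A.scale A.scale2 A.mem)
    ultimately have "a u u \<le> a v v / h v v" using low[of w] au by simp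
    then show ?thesis using p by (simp add: field_simps)
  qed
  then show ?thesis using u 1 2 unfolding minimal_def by blast
qed

text \<open>The form \<open>a - a u u \<cdot> h\<close> is positive semidefinite on the orthogonal complement of \<open>X\<close> and
  vanishes at the minimiser, so by Cauchy-Schwarz the minimiser is in its kernel.\<close>

lemma minimal_euler:
  assumes X: "H.orthonormal X" and m: "minimal X u" and v: "v \<in> E"
    and eig: "\<And>x. x \<in> X \<Longrightarrow> a x u = \<nu> x * h x u"
  shows "a u v = a u u * h u v"
proof -
  define E' where "E' = {v\<in>E. \<forall>x\<in>X. h v x = 0}"
  have XE: "X \<subseteq> E" and fin: "finite X" using X by (auto simp: H.orthonormal_def)
  have u: "u \<in> E" "h u u = 1" "\<And>x. x \<in> X \<Longrightarrow> h u x = 0" using m by (auto simp: minimal_def)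
  interpret B: psd_form E' "\<lambda>v w. a v w - a u u * h v w"
  proof
    show "subspace E'" unfolding subspace_def E'_def
      using XE by (auto simp: H.mem H.add H.scale H.zero subset_iff)
    show "0 \<le> a w w - a u u * h w w" if "w \<in> E'" for w
      using m that by (auto simp: minimal_def E'_def)
  qed (use XE in \<open>auto simp: E'_def A.sym H.sym A.add H.add A.scale H.scale algebra_simps\<close>)
  have uE': "u \<in> E'" using u by (simp add: E'_def)
  define w where "w = v - H.proj X v"
  have wE: "w \<in> E" using v X by (simp add: w_def H.mem H.proj_mem)
  have wE': "w \<in> E'"
    using H.form_proj_basis[OF X v] XE v X wE unfolding w_def E'_def
    by (auto simp: H.diff H.proj_mem subset_iff)
  have "(a u w - a u u * h u w)\<^sup>2 \<le> 0"
    using B.cauchy_schwarz[OF uE' wE'] u(2) by simp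
  then have uw: "a u w = a u u * h u w" by simp
  \<comment> \<open>The members of \<open>X\<close> satisfy the eigenvalue equation tested with
    \<open>u\<close>, so \<open>u\<close> is orthogonal to them in \<open>a\<close> as well as in
    \<open>h\<close>, and the projected part of \<open>v\<close> contributes nothing to either
    side.\<close>
  have "a u (H.proj X v) = (\<Sum>x\<in>X. h v x * a x u)"
    unfolding H.proj_def using XE fin u(1) by (subst A.sym) (auto intro!: A.mem A.sum)
  also have "\<dots> = 0" using eig u XE by (intro sum.neutral) (auto simp: H.sym subset_iff)
  finally have 1: "a u (H.proj X v) = 0" .
  have "h u (H.proj X v) = (\<Sum>x\<in>X. h v x * h x u)"
    using X u(1) v by (subst H.sym) (auto intro!: H.proj_mem H.form_proj)
  also have "\<dots> = 0" using u XE by (intro sum.neutral) (auto simp: H.sym subset_iff)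
  finally have 2: "h u (H.proj X v) = 0" .
  show ?thesis
    using uw 1 2 u(1) v X unfolding w_def by (simp add: A.diff2 H.diff2 H.proj_mem)
qed

text \<open>Successive minimisation under growing constraints, hence \<open>incseq \<mu>\<close>.
  The last estimate serves as completeness: the remainder of \<open>v\<close> is admissible at stage
  \<open>m\<close>, and removing the projection lowers \<open>a v v\<close> by a sum of nonnegative
  terms. Since \<open>\<mu> m\<close> tends to infinity, the remainder becomes small in
  \<open>h\<close>.\<close>

theorem spectral:
  obtains e :: "nat \<Rightarrow> 'v" and \<mu> :: "nat \<Rightarrow> real"
  where "\<And>i. e i \<in> E" and "\<And>i j. h (e i) (e j) = (if i = j then 1 else 0)"
    and "\<And>i v. v \<in> E \<Longrightarrow> a (e i) v = \<mu> i * h (e i) v"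
    and "incseq \<mu>" and "filterlim \<mu> at_top sequentially"
    and "\<And>m v. v \<in> E \<Longrightarrow> \<mu> m * h (v - (\<Sum>i<m. h v (e i) *\<^sub>R e i)) (v - (\<Sum>i<m. h v (e i) *\<^sub>R e i)) \<le> a v v"
proof -
  define pick where "pick X = (SOME u. minimal X u)" for X
  define S where "S = rec_nat {} (\<lambda>_ X. insert (pick X) X)"
  define e where "e k = pick (S k)" for k
  define \<mu> where "\<mu> k = a (e k) (e k)" for k
  have S0: "S 0 = {}" and SS: "S (Suc k) = insert (e k) (S k)" for k by (auto simp: S_def e_def)
  have Se: "S k = e ` {..<k}" for k by (induction k) (auto simp: S0 SS lessThan_Suc)
  have pick: "minimal X (pick X)" if "H.orthonormal X" for X
    unfolding pick_def using exists_minimal[OF that] by (rule someI_ex)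
  have on: "H.orthonormal (S k)" for k
  proof (induction k)
    case (Suc k)
    have "minimal (S k) (e k)" unfolding e_def by (rule pick[OF Suc])
    then show ?case using Suc unfolding SS H.orthonormal_def minimal_def
      by (auto simp: H.sym subset_iff)
  qed (simp add: S0 H.orthonormal_def)
  have min: "minimal (S k) (e k)" for k unfolding e_def by (rule pick[OF on])
  have eE: "e k \<in> E" for k using min by (auto simp: minimal_def)
  have ee: "h (e i) (e j) = (if i = j then 1 else 0)" for i j
  proof -
    have "h (e i) (e j) = 0" if "j < i" for i j
      using min[of i] that by (auto simp: minimal_def Se)
    then show ?thesis using min[of i] eE H.sym[of "e i" "e j"]
      by (cases i j rule: linorder_cases) (auto simp: minimal_def)
  qed
  have inj: "inj_on e A" for A
    by (rule inj_onI) (metis ee one_neq_zero)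
  have eig: "a (e i) v = \<mu> i * h (e i) v" if "v \<in> E" for i v
    using that
  proof (induction i arbitrary: v rule: less_induct)
    case (less i)
    show ?case unfolding \<mu>_def
    proof (rule minimal_euler[OF on min less.prems, where \<nu>="\<lambda>x. a x x"])
      fix x assume "x \<in> S i"
      then obtain j where "j < i" "x = e j" by (auto simp: Se)
      then show "a x (e i) = a x x * h x (e i)" using less.IH[of j "e i"] eE by (simp add: \<mu>_def)
    qed
  qed
  have \<mu>0: "\<mu> i \<ge> 0" for i using A.nonneg eE by (simp add: \<mu>_def)
  have mono: "incseq \<mu>"
  proof (rule incseq_SucI)
    fix k
    show "\<mu> k \<le> \<mu> (Suc k)"
      using min[of k] min[of "Suc k"] unfolding minimal_def SS \<mu>_def by auto
  qed
  have unbdd: "\<exists>i. \<mu> i > C" for C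
  proof (rule ccontr)
    assume "\<not> ?thesis"
    then have C: "a (e i) (e i) \<le> C" for i by (simp add: not_less \<mu>_def)
    then obtain r u where r: "strict_mono r" and u: "u \<in> E"
      and lim: "(\<lambda>j. h (e (r j) - u) (e (r j) - u)) \<longlonglongrightarrow> 0"
      using compact[of e C] eE by blast
    \<comment> \<open>Orthonormal vectors have square distance 2, so they cannot have a subsequence
      that converges in \<open>h\<close>.\<close>
    have 1: "2 \<le> 2 * h (e (r (Suc j)) - u) (e (r (Suc j)) - u) + 2 * h (e (r j) - u) (e (r j) - u)" for j
    proof -
      have "r j \<noteq> r (Suc j)" using r by (simp add: strict_mono_eq)
      then have two: "h (e (r (Suc j)) - e (r j)) (e (r (Suc j)) - e (r j)) = 2"
        using eE by (simp add: H.quad_diff ee)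
      have split: "e (r (Suc j)) - e (r j) = (e (r (Suc j)) - u) + (u - e (r j))" by simp
      have "h (u - e (r j)) (u - e (r j)) = h (e (r j) - u) (e (r j) - u)"
        using H.sym[OF u eE[of "r j"]] by (simp add: H.quad_diff eE u)
      then show ?thesis
        using H.quad_add_le[of "e (r (Suc j)) - u" "u - e (r j)"] H.mem(2)[OF eE u, of "r (Suc j)"] H.mem(2)[OF u eE, of "r j"]
        unfolding split[symmetric] two by simp
    qed
    have 2: "(\<lambda>j. 2 * h (e (r (Suc j)) - u) (e (r (Suc j)) - u) + 2 * h (e (r j) - u) (e (r j) - u)) \<longlonglongrightarrow> 2 * 0 + 2 * 0"
      by (rule tendsto_add[OF tendsto_mult_left[OF LIMSEQ_Suc[OF lim]] tendsto_mult_left[OF lim]])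
    have "2 \<le> (2 * 0 + 2 * 0 :: real)"
      by (rule LIMSEQ_le_const[OF 2]) (use 1 in blast)
    then show False by simp
  qed
  have top: "filterlim \<mu> at_top sequentially"
    unfolding filterlim_at_top eventually_sequentially
  proof
    fix Z
    obtain i where "\<mu> i > Z" using unbdd by blast
    then show "\<exists>N. \<forall>n\<ge>N. Z \<le> \<mu> n" using mono by (meson incseqD less_imp_le order_trans)
  qed
  have bd: "\<mu> m * h (v - (\<Sum>i<m. h v (e i) *\<^sub>R e i)) (v - (\<Sum>i<m. h v (e i) *\<^sub>R e i)) \<le> a v v" if v: "v \<in> E" for m v
  proof -
    define p where "p = H.proj (S m) v"
    have p: "p = (\<Sum>i<m. h v (e i) *\<^sub>R e i)"
      unfolding p_def H.proj_def Se by (subst sum.reindex) (auto simp: inj)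
    have pE: "p \<in> E" by (simp add: p_def H.proj_mem on)
    have "\<mu> m * h (v - p) (v - p) \<le> a (v - p) (v - p)"
    proof -
      have "h (v - p) x = 0" if "x \<in> S m" for x
        using H.form_proj_basis[OF on v that] that v pE on[of m] by (simp add: H.diff p_def H.orthonormal_def subset_iff)
      then show ?thesis using min[of m] H.mem(2)[OF v pE] by (auto simp: minimal_def \<mu>_def)
    qed
    also have "\<dots> = a v v - 2 * a p v + a p p" using v pE by (simp add: A.quad_diff A.sym[of v p])
    also have "a p v = (\<Sum>i<m. \<mu> i * (h v (e i))\<^sup>2)"
      unfolding p using v eE by (subst A.sum) (auto intro!: sum.cong simp: eig power2_eq_square H.sym)
    also have "a p p = (\<Sum>i<m. h v (e i) * (\<mu> i * h p (e i)))"
      using pE eE unfolding p[symmetric] by (subst (1) p, subst A.sum) (auto intro!: sum.cong simp: eig H.sym[of _ p])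
    also have "\<dots> = (\<Sum>i<m. \<mu> i * (h v (e i))\<^sup>2)"
      using H.form_proj_basis[OF on v, of _ m] unfolding p_def
      by (intro sum.cong) (auto simp: power2_eq_square Se)
    finally have "\<mu> m * h (v - p) (v - p) \<le> a v v - (\<Sum>i<m. \<mu> i * (h v (e i))\<^sup>2)" by simp
    moreover have "0 \<le> (\<Sum>i<m. \<mu> i * (h v (e i))\<^sup>2)" using \<mu>0 by (intro sum_nonneg) auto
    ultimately show ?thesis by (simp add: p)
  qed
  show ?thesis by (rule that[OF eE ee eig mono top bd])
qed

end

section \<open>The form domain\<close>

instantiation "fun" :: (type, real_vector) real_vector
begin

definition scaleR_fun :: "real \<Rightarrow> ('a \<Rightarrow> 'b) \<Rightarrow> 'a \<Rightarrow> 'b" where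
  "scaleR_fun r f = (\<lambda>x. r *\<^sub>R f x)"

instance
  by standard (simp_all add: scaleR_fun_def fun_eq_iff scaleR_add_right scaleR_add_left)

end

lemma scaleR_fun_apply [simp]: "(r *\<^sub>R f) x = r *\<^sub>R f x"
  by (simp add: scaleR_fun_def)

lemma sum_fun_apply: "(\<Sum>i\<in>I. f i) x = (\<Sum>i\<in>I. f i x)"
  by (induction I rule: infinite_finite_induct) simp_all

text \<open>Takes the place of a Sobolev space: the domain consists of the elements along which the
  increasing forms stay bounded, and their limit is again a form there.\<close>

locale increasing_psd_forms =
  fixes E :: "'v::real_vector set" and b :: "nat \<Rightarrow> 'v \<Rightarrow> 'v \<Rightarrow> real"
  assumes form: "psd_form E (b n)"
    and mono: "u \<in> E \<Longrightarrow> b n u u \<le> b (Suc n) u u"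
begin

definition dom :: "'v set" where "dom = {u\<in>E. \<exists>C. \<forall>n. b n u u \<le> C}"

definition lim_form :: "'v \<Rightarrow> 'v \<Rightarrow> real" where "lim_form u v = lim (\<lambda>n. b n u v)"

lemma incseq_form: "u \<in> E \<Longrightarrow> incseq (\<lambda>n. b n u u)"
  using mono by (intro incseq_SucI)

lemma dom_E: "u \<in> dom \<Longrightarrow> u \<in> E"
  by (simp add: dom_def)

lemma subspace_dom: "subspace dom"
proof -
  interpret b: psd_form E "b n" for n by (rule form)
  show ?thesis
    unfolding subspace_def
  proof (intro conjI ballI allI)
    show "0 \<in> dom" using b.zero by (auto simp: dom_def b.mem)
  next
    fix u v assume "u \<in> dom" "v \<in> dom"
    then obtain C C' where u: "u \<in> E" "\<And>n. b n u u \<le> C" and v: "v \<in> E" "\<And>n. b n v v \<le> C'"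
      by (auto simp: dom_def)
    have "b n (u + v) (u + v) \<le> 2 * C + 2 * C'" for n
      using b.quad_add_le[OF u(1) v(1), of n] u(2)[of n] v(2)[of n] by linarith
    then show "u + v \<in> dom" using u v by (auto simp: dom_def b.mem)
  next
    fix r u assume "u \<in> dom"
    then obtain C where u: "u \<in> E" "\<And>n. b n u u \<le> C" by (auto simp: dom_def)
    have "b n (r *\<^sub>R u) (r *\<^sub>R u) \<le> (r * r) * C" for n
      using u mult_left_mono[OF u(2), of "r * r" n] by (simp add: b.scale b.scale2 b.mem mult.assoc)
    then show "r *\<^sub>R u \<in> dom" using u by (auto simp: dom_def b.mem)
  qed
qed

text \<open>Monotonicity gives convergence only on the diagonal; polarisation transfers it to
  \<open>b n u v\<close>.\<close>

lemma tendsto_lim_form: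
  assumes "u \<in> dom" "v \<in> dom"
  shows "(\<lambda>n. b n u v) \<longlonglongrightarrow> lim_form u v"
proof -
  interpret b: psd_form E "b n" for n by (rule form)
  have conv: "convergent (\<lambda>n. b n w w)" if w: "w \<in> dom" for w
  proof -
    obtain C where C: "\<forall>n. b n w w \<le> C" and wE: "w \<in> E" using w by (auto simp: dom_def)
    obtain l where "(\<lambda>n. b n w w) \<longlonglongrightarrow> l"
      using incseq_convergent[OF incseq_form[OF wE] C] by metis
    then show ?thesis by (auto simp: convergent_def)
  qed
  have "b n u v = (b n (u + v) (u + v) - b n u u - b n v v) / 2" for n
    using assms by (simp add: dom_E b.add b.add2 b.mem b.sym[of v u])
  moreover have "convergent (\<lambda>n. (b n (u + v) (u + v) - b n u u - b n v v) / 2)"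
  proof -
    obtain x y z where "(\<lambda>n. b n u u) \<longlonglongrightarrow> x" "(\<lambda>n. b n v v) \<longlonglongrightarrow> y" "(\<lambda>n. b n (u + v) (u + v)) \<longlonglongrightarrow> z"
      using conv[OF assms(1)] conv[OF assms(2)] conv[OF subspace_add[OF subspace_dom assms]]
      unfolding convergent_def by (elim exE)
    then have "(\<lambda>n. (b n (u + v) (u + v) - b n u u - b n v v) / 2) \<longlonglongrightarrow> (z - x - y) / 2"
      by (intro tendsto_divide tendsto_diff tendsto_const) auto
    then show ?thesis by (rule convergentI)
  qed
  ultimately have "convergent (\<lambda>n. b n u v)" by presburger
  then show ?thesis unfolding lim_form_def by (rule convergent_LIMSEQ_iff[THEN iffD1])
qed

lemma form_le: "u \<in> dom \<Longrightarrow> b n u u \<le> lim_form u u"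
  using incseq_le[OF incseq_form[OF dom_E] tendsto_lim_form] by blast

lemma lim_form_le: "u \<in> dom \<Longrightarrow> (\<And>n. b n u u \<le> C) \<Longrightarrow> lim_form u u \<le> C"
  by (rule LIMSEQ_le_const2[OF tendsto_lim_form]) auto

sublocale psd_form dom lim_form
proof -
  interpret b: psd_form E "b n" for n by (rule form)
  show "psd_form dom lim_form"
  proof
    fix u v w r
    show "subspace dom" by (rule subspace_dom)
    show "lim_form u v = lim_form v u" if "u \<in> dom" "v \<in> dom"
      unfolding lim_form_def using that b.sym[OF dom_E dom_E] by simp
    show "lim_form (u + v) w = lim_form u w + lim_form v w" if d: "u \<in> dom" "v \<in> dom" "w \<in> dom"
    proof (rule LIMSEQ_unique[OF tendsto_lim_form])
      show "(\<lambda>n. b n (u + v) w) \<longlonglongrightarrow> lim_form u w + lim_form v w"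
        using d by (simp add: b.add dom_E tendsto_add tendsto_lim_form)
    qed (use d subspace_add[OF subspace_dom] in auto)
    show "lim_form (r *\<^sub>R u) v = r * lim_form u v" if d: "u \<in> dom" "v \<in> dom"
    proof (rule LIMSEQ_unique[OF tendsto_lim_form])
      show "(\<lambda>n. b n (r *\<^sub>R u) v) \<longlonglongrightarrow> r * lim_form u v"
        using d by (simp add: b.scale dom_E tendsto_mult_left tendsto_lim_form)
    qed (use d subspace_scale[OF subspace_dom] in auto)
    show "0 \<le> lim_form u u" if "u \<in> dom"
      using form_le[OF that, of 0] b.nonneg[OF dom_E[OF that], of 0] by simp
  qed
qed

end

text \<open>The kinetic energy on \<open>[-n, n]\<close> is replaced by that of the piecewise linear interpolation on the
  grid of mesh \<open>2\<^sup>-\<^sup>n\<close>. It increases with \<open>n\<close>, so that the form domain needs no weak derivatives.\<close>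

definition dyad :: "nat \<Rightarrow> int \<Rightarrow> real" where "dyad n j = of_int j / 2 ^ n"

definition dyad_diff :: "nat \<Rightarrow> (real \<Rightarrow> 'a::real_inner) \<Rightarrow> int \<Rightarrow> 'a" where
  "dyad_diff n u j = u (dyad n (j + 1)) - u (dyad n j)"

definition kinetic :: "nat \<Rightarrow> (real \<Rightarrow> 'a) \<Rightarrow> (real \<Rightarrow> 'a::real_inner) \<Rightarrow> real" where
  "kinetic n u v = (\<Sum>j\<in>{- int n * 2 ^ n..<int n * 2 ^ n}. 2 ^ n * (dyad_diff n u j \<bullet> dyad_diff n v j))"

lemma dyad_floor_tendsto: "(\<lambda>n. dyad n \<lfloor>2 ^ n * t\<rfloor>) \<longlonglongrightarrow> t"
proof -
  have lim: "(\<lambda>n. (1/2) ^ n) \<longlonglongrightarrow> (0::real)" by (rule LIMSEQ_power_zero) simp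
  have "norm (dyad n \<lfloor>2 ^ n * t\<rfloor> - t) \<le> (1/2) ^ n" for n
  proof -
    have "dyad n \<lfloor>2 ^ n * t\<rfloor> - t = - frac (2 ^ n * t) / 2 ^ n" by (simp add: dyad_def frac_def field_simps)
    then show ?thesis using frac_ge_0[of "2 ^ n * t"] frac_lt_1[of "2 ^ n * t"]
      by (simp add: power_divide abs_div divide_right_mono)
  qed
  then have "(\<lambda>n. dyad n \<lfloor>2 ^ n * t\<rfloor> - t) \<longlonglongrightarrow> 0"
    by (intro Lim_null_comparison[OF always_eventually lim]) blast
  then show ?thesis by (rule LIM_zero_cancel)
qed

lemma sum_dyad_diff:
  assumes "p \<le> q"
  shows "(\<Sum>j\<in>{p..<q}. dyad_diff n u j) = u (dyad n q) - u (dyad n p)"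
  using assms
proof (induction q rule: int_ge_induct)
  case (step q)
  have "{p..<q+1} = insert q {p..<q}" using step by auto
  then have "(\<Sum>j\<in>{p..<q+1}. dyad_diff n u j) = dyad_diff n u q + (\<Sum>j\<in>{p..<q}. dyad_diff n u j)" by simp
  then show ?case unfolding step.IH by (simp add: dyad_diff_def)
qed simp

lemma kinetic_nonneg: "0 \<le> kinetic n u u"
  unfolding kinetic_def by (intro sum_nonneg) simp

lemma psd_form_kinetic: "psd_form (Collect (continuous_on UNIV)) (kinetic n)"
proof
  show "subspace (Collect (continuous_on UNIV) :: (real \<Rightarrow> 'a) set)"
    unfolding subspace_def by (auto simp: plus_fun_def scaleR_fun_def zero_fun_def intro!: continuous_intros)
qed (auto simp: kinetic_nonneg, auto simp: kinetic_def dyad_diff_def inner_commute algebra_simps sum.distrib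
       sum_distrib_left sum_subtractf simp flip: scaleR_diff_right intro!: sum.cong)

lemma sum_int_double:
  fixes f :: "int \<Rightarrow> 'a::comm_monoid_add"
  assumes "a \<le> b"
  shows "(\<Sum>j\<in>{2*a..<2*b}. f j) = (\<Sum>j\<in>{a..<b}. f (2*j) + f (2*j+1))"
  using assms
proof (induction b rule: int_ge_induct)
  case (step b)
  have 1: "{2*a..<2*(b+1)} = insert (2*b+1) (insert (2*b) {2*a..<2*b})" using step by auto
  have 2: "{a..<b+1} = insert b {a..<b}" using step by auto
  show ?case unfolding 1 2 using step by (simp add: ac_simps)
qed simp

text \<open>Halving a cell doubles the factor \<open>2 ^ n\<close>, and
  \<open>|x + y|^2 <= 2 |x|^2 + 2 |y|^2\<close> says exactly that this is enough; the larger window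
  only adds nonnegative terms.\<close>

lemma kinetic_mono: "kinetic n u u \<le> kinetic (Suc n) u u"
proof -
  define I where "I = {- int n * 2 ^ n..<int n * 2 ^ n}"
  have eq: "dyad_diff n u j = dyad_diff (Suc n) u (2*j) + dyad_diff (Suc n) u (2*j+1)" for j
  proof -
    have "dyad (Suc n) (2*j) = dyad n j" "dyad (Suc n) (2*j+1+1) = dyad n (j+1)"
      by (simp_all add: dyad_def field_simps)
    then show ?thesis by (simp add: dyad_diff_def)
  qed
  have "kinetic n u u \<le> (\<Sum>j\<in>I. 2 ^ Suc n * (dyad_diff (Suc n) u (2*j) \<bullet> dyad_diff (Suc n) u (2*j)) +
      2 ^ Suc n * (dyad_diff (Suc n) u (2*j+1) \<bullet> dyad_diff (Suc n) u (2*j+1)))"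
    unfolding kinetic_def I_def[symmetric]
  proof (rule sum_mono)
    fix j
    have sq: "(x + y) \<bullet> (x + y) \<le> 2 * (x \<bullet> x) + 2 * (y \<bullet> y)" for x y :: 'a
      using inner_ge_zero[of "x - y"] by (simp add: inner_add inner_diff inner_commute)
    then show "2 ^ n * (dyad_diff n u j \<bullet> dyad_diff n u j) \<le> 2 ^ Suc n * (dyad_diff (Suc n) u (2*j) \<bullet> dyad_diff (Suc n) u (2*j)) +
      2 ^ Suc n * (dyad_diff (Suc n) u (2*j+1) \<bullet> dyad_diff (Suc n) u (2*j+1))"
      unfolding eq
      using mult_left_mono[OF sq[of "dyad_diff (Suc n) u (2*j)" "dyad_diff (Suc n) u (2*j+1)"], of "2 ^ n"]
      by (simp add: distrib_left mult.assoc mult.left_commute)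
  qed
  also have "\<dots> = (\<Sum>j\<in>{2 * (- int n * 2 ^ n)..<2 * (int n * 2 ^ n)}. 2 ^ Suc n * (dyad_diff (Suc n) u j \<bullet> dyad_diff (Suc n) u j))"
    unfolding I_def by (subst sum_int_double) auto
  also have "\<dots> \<le> kinetic (Suc n) u u"
    unfolding kinetic_def by (intro sum_mono2) (auto simp: algebra_simps)
  finally show ?thesis .
qed

lemma abs_inner_le_squares: "\<bar>x \<bullet> y\<bar> \<le> x \<bullet> x + y \<bullet> (y::'a::real_inner)"
  using inner_ge_zero[of "x - y"] inner_ge_zero[of "x + y"] inner_ge_zero[of x] inner_ge_zero[of y]
  by (simp add: inner_add inner_diff inner_commute abs_le_iff)

lemma integrable_inner_of_squares:
  fixes u v :: "'b \<Rightarrow> 'a::euclidean_space"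
  assumes [measurable]: "u \<in> borel_measurable M" "v \<in> borel_measurable M"
    and "integrable M (\<lambda>t. u t \<bullet> u t)" "integrable M (\<lambda>t. v t \<bullet> v t)"
  shows "integrable M (\<lambda>t. u t \<bullet> v t)"
proof (rule Bochner_Integration.integrable_bound)
  show "integrable M (\<lambda>t. u t \<bullet> u t + v t \<bullet> v t)" using assms by simp
  show "AE t in M. norm (u t \<bullet> v t) \<le> norm (u t \<bullet> u t + v t \<bullet> v t)"
    by (simp add: abs_of_nonneg abs_inner_le_squares)
qed measurable

lemma integrable_on_interval:
  fixes f :: "real \<Rightarrow> real"
  shows "continuous_on UNIV f \<Longrightarrow> integrable lborel (\<lambda>t. indicator {a..b} t * f t)"
  using borel_integrable_compact[of "{a..b}" f] by (simp add: continuous_on_subset)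

lemma integrable_indicator_Icc: "integrable lborel (indicat_real {a..b::real})"
  using integrable_on_interval[of "\<lambda>_. 1" a b] by simp

lemma integrable_indicator_times:
  fixes f :: "'b \<Rightarrow> real"
  shows "A \<in> sets M \<Longrightarrow> integrable M f \<Longrightarrow> integrable M (\<lambda>x. indicator A x * f x)"
  using integrable_mult_indicator[of A M f] by simp

lemma integrable_bounded_intervals:
  fixes f :: "real \<Rightarrow> real"
  assumes f: "continuous_on UNIV f" and nn: "\<And>t. 0 \<le> f t"
    and le: "\<And>n::nat. (LBINT t. indicator {- real n..real n} t * f t) \<le> C"
  shows "integrable lborel f" and "(LBINT t. f t) \<le> C"
proof -
  define I where "I n = (LBINT t. indicator {- real n..real n} t * f t)" for n :: nat
  have "incseq I"
    unfolding I_def using f nn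
    by (intro incseq_SucI integral_mono integrable_on_interval) (auto simp: indicator_def)
  then obtain l where l: "I \<longlonglongrightarrow> l"
    using incseq_convergent[of I C] le unfolding I_def by metis
  have lim: "(\<lambda>n. indicator {- real n..real n} t * f t) \<longlonglongrightarrow> f t" for t
  proof (rule tendsto_eventually)
    obtain N :: nat where "\<bar>t\<bar> \<le> N" using real_arch_simple by blast
    then have "\<forall>n\<ge>N. indicator {- real n..real n} t * f t = f t"
      by (auto simp: indicator_def)
    then show "\<forall>\<^sub>F n in sequentially. indicator {- real n..real n} t * f t = f t"
      unfolding eventually_sequentially by blast
  qed
  have mono: "mono (\<lambda>n. indicator {- real n..real n} t * f t)" for t
    by (rule monoI) (auto simp: indicator_def nn)
  have m: "f \<in> borel_measurable lborel" using borel_measurable_continuous_onI[OF f] by simp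
  note mc = integral_monotone_convergence_nonneg[OF integrable_on_interval[OF f] AE_I2[OF mono] AE_I2
      AE_I2[OF lim] l[unfolded I_def] m]
  show "integrable lborel f" by (rule mc) (simp add: nn)
  have "(LBINT t. f t) = l" by (rule mc) (simp add: nn)
  also have "l \<le> C" by (rule LIMSEQ_le_const2[OF l]) (use le in \<open>simp add: I_def\<close>)
  finally show "(LBINT t. f t) \<le> C" .
qed

text \<open>\<open>A\<close> stands for \<open>L\<close> shifted by a constant that makes it at
  least the identity. \<open>growth\<close> is (L1) with the set where \<open>L\<close> is small
  split off as \<open>B\<close>, and \<open>weight_int\<close> is what \<open>\<alpha> > 1\<close>
  provides. The bound 3 exceeds Euler's number, so that the logarithm in the weight is at least
  1.\<close>

locale schroedinger_form =
  fixes A :: "real \<Rightarrow> 'a::euclidean_space \<Rightarrow> 'a" and \<omega> :: "real \<Rightarrow> real"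
  assumes cont_A: "continuous_on UNIV (\<lambda>p. A (fst p) (snd p))"
    and lin_A: "linear (A t)"
    and sym_A: "A t x \<bullet> y = A t y \<bullet> x"
    and coercive: "x \<bullet> x \<le> A t x \<bullet> x"
    and weight_pos: "\<bar>t\<bar> \<ge> 3 \<Longrightarrow> \<omega> t > 0"
    and weight_int: "integrable lborel (\<lambda>t. indicator {t. \<bar>t\<bar> \<ge> 3} t / \<omega> t)"
    and weight_top: "filterlim \<omega> at_top at_infinity"
    and growth: "\<epsilon> > 0 \<Longrightarrow> \<exists>R\<ge>3. \<exists>B\<in>sets lborel. emeasure lborel B \<le> ennreal \<epsilon> \<and>
      (\<forall>t x. \<bar>t\<bar> \<ge> R \<longrightarrow> t \<notin> B \<longrightarrow> \<omega> t * (x \<bullet> x) \<le> A t x \<bullet> x)"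
begin

definition potential :: "nat \<Rightarrow> (real \<Rightarrow> 'a) \<Rightarrow> (real \<Rightarrow> 'a) \<Rightarrow> real" where
  "potential n u v = (LBINT t. indicator {- real n..real n} t * (A t (u t) \<bullet> v t))"

definition trunc :: "nat \<Rightarrow> (real \<Rightarrow> 'a) \<Rightarrow> (real \<Rightarrow> 'a) \<Rightarrow> real" where
  "trunc n u v = kinetic n u v + potential n u v"

lemma continuous_A: "continuous_on S u \<Longrightarrow> continuous_on S (\<lambda>t. A t (u t))"
  using continuous_on_compose2[OF cont_A continuous_on_Pair[OF continuous_on_id]] by simp

lemma A_nonneg: "0 \<le> A t x \<bullet> x"
  using coercive[of x t] inner_ge_zero[of x] by linarith

lemma potential_integrable:
  "continuous_on UNIV u \<Longrightarrow> continuous_on UNIV v \<Longrightarrow>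
    integrable lborel (\<lambda>t. indicator {a..b} t * (A t (u t) \<bullet> v t))"
  by (intro integrable_on_interval continuous_intros continuous_A)

lemma potential_nonneg: "0 \<le> potential n u u"
  unfolding potential_def by (intro integral_nonneg_AE) (simp add: A_nonneg)

lemma psd_form_trunc: "psd_form (Collect (continuous_on UNIV)) (trunc n)"
proof -
  interpret K: psd_form "Collect (continuous_on UNIV)" "kinetic n :: _ \<Rightarrow> (real \<Rightarrow> 'a) \<Rightarrow> _" by (rule psd_form_kinetic)
  show ?thesis
  proof
    fix u v w :: "real \<Rightarrow> 'a" and r
    assume u: "u \<in> Collect (continuous_on UNIV)"
    show "0 \<le> trunc n u u"
      using K.nonneg[OF u] potential_nonneg by (simp add: trunc_def)
    assume v: "v \<in> Collect (continuous_on UNIV)"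
    have "potential n (r *\<^sub>R u) v = r * potential n u v"
      unfolding potential_def by (simp add: linear_cmul[OF lin_A] mult.left_commute)
    then show "trunc n (r *\<^sub>R u) v = r * trunc n u v" using K.scale[OF u v] by (simp add: trunc_def distrib_left)
    show "trunc n u v = trunc n v u"
      using K.sym[OF u v] by (simp add: trunc_def potential_def sym_A[of _ "u _" "v _"])
    assume w: "w \<in> Collect (continuous_on UNIV)"
    have "potential n (u + v) w = potential n u w + potential n v w"
      unfolding potential_def using u v w
      by (simp add: linear_add[OF lin_A] inner_add_left distrib_left potential_integrable)
    then show "trunc n (u + v) w = trunc n u w + trunc n v w"
      using K.add[OF u v w] by (simp add: trunc_def)
  qed (rule K.subspace)
qed

sublocale F: increasing_psd_forms "Collect (continuous_on UNIV)" trunc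
proof (rule increasing_psd_forms.intro)
  fix n show "psd_form (Collect (continuous_on UNIV)) (trunc n)" by (rule psd_form_trunc)
  fix u :: "real \<Rightarrow> 'a" assume u: "u \<in> Collect (continuous_on UNIV)"
  have "potential n u u \<le> potential (Suc n) u u"
    unfolding potential_def using u
    by (intro integral_mono potential_integrable) (auto simp: indicator_def A_nonneg)
  then show "trunc n u u \<le> trunc (Suc n) u u" using kinetic_mono[of n u] by (simp add: trunc_def)
qed

abbreviation "Dom \<equiv> F.dom"
abbreviation "a \<equiv> F.lim_form"

lemma dom_cont: "u \<in> Dom \<Longrightarrow> continuous_on UNIV u"
  using F.dom_E by blast

lemma dom_measurable: "u \<in> Dom \<Longrightarrow> u \<in> borel_measurable lborel"
  using borel_measurable_continuous_onI[OF dom_cont] by simp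

lemma dom_potential:
  assumes u: "u \<in> Dom"
  shows "integrable lborel (\<lambda>t. A t (u t) \<bullet> u t)" and "(LBINT t. A t (u t) \<bullet> u t) \<le> a u u"
proof -
  have "potential n u u \<le> a u u" for n
    using F.form_le[OF u, of n] kinetic_nonneg[of n u] by (simp add: trunc_def)
  then have le: "(LBINT t. indicator {- real n..real n} t * (A t (u t) \<bullet> u t)) \<le> a u u" for n
    by (simp add: potential_def)
  have c: "continuous_on UNIV (\<lambda>t. A t (u t) \<bullet> u t)" by (intro continuous_intros continuous_A dom_cont u)
  show "integrable lborel (\<lambda>t. A t (u t) \<bullet> u t)" and "(LBINT t. A t (u t) \<bullet> u t) \<le> a u u"
    using integrable_bounded_intervals[OF c A_nonneg le] by blast+
qed

lemma dom_square:
  assumes u: "u \<in> Dom"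
  shows "integrable lborel (\<lambda>t. u t \<bullet> u t)" and "(LBINT t. u t \<bullet> u t) \<le> a u u"
proof -
  note [measurable] = dom_measurable[OF u]
  show i: "integrable lborel (\<lambda>t. u t \<bullet> u t)"
    by (rule Bochner_Integration.integrable_bound[OF dom_potential(1)[OF u]])
       (simp_all add: coercive order_trans[OF coercive abs_ge_self])
  have "(LBINT t. u t \<bullet> u t) \<le> (LBINT t. A t (u t) \<bullet> u t)"
    by (intro integral_mono i dom_potential u coercive)
  then show "(LBINT t. u t \<bullet> u t) \<le> a u u" using dom_potential(2)[OF u] by simp
qed

definition l2 :: "(real \<Rightarrow> 'a) \<Rightarrow> (real \<Rightarrow> 'a) \<Rightarrow> real" where
  "l2 u v = (LBINT t. u t \<bullet> v t)"

lemma dom_inner: "u \<in> Dom \<Longrightarrow> v \<in> Dom \<Longrightarrow> integrable lborel (\<lambda>t. u t \<bullet> v t)"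
  by (rule integrable_inner_of_squares[OF dom_measurable dom_measurable dom_square(1) dom_square(1)])

lemma psd_form_l2: "psd_form Dom l2"
proof
qed (auto simp: F.subspace_dom l2_def inner_commute inner_add_right dom_inner)

text \<open>Discrete form of the estimate of \<open>|u t - u s|^2\<close> by \<open>|t - s|\<close>
  times the integral of \<open>|u'|^2\<close>: telescope, and apply Cauchy-Schwarz to the sum of the
  increments.\<close>

lemma dyad_holder:
  assumes u: "u \<in> Dom" and pq: "- int n * 2 ^ n \<le> p" "p \<le> q" "q \<le> int n * 2 ^ n"
  shows "(norm (u (dyad n q) - u (dyad n p)))\<^sup>2 \<le> (dyad n q - dyad n p) * a u u"
proof -
  have tele: "u (dyad n q) - u (dyad n p) = (\<Sum>j\<in>{p..<q}. dyad_diff n u j)"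
    by (rule sum_dyad_diff[OF pq(2), symmetric])
  have "(norm (u (dyad n q) - u (dyad n p)))\<^sup>2 \<le> (\<Sum>j\<in>{p..<q}. norm (dyad_diff n u j))\<^sup>2"
    unfolding tele by (intro power_mono norm_sum) simp
  also have "\<dots> \<le> (\<Sum>j\<in>{p..<q}. (norm (dyad_diff n u j))\<^sup>2) * card {p..<q}"
    by (rule sum_squared_le_sum_of_squares)
  also have "\<dots> = (dyad n q - dyad n p) * (\<Sum>j\<in>{p..<q}. 2 ^ n * (dyad_diff n u j \<bullet> dyad_diff n u j))"
    using pq by (simp add: dyad_def power2_norm_eq_inner field_simps flip: sum_distrib_left)
  also have "\<dots> \<le> (dyad n q - dyad n p) * kinetic n u u"
    unfolding kinetic_def using pq by (intro mult_left_mono sum_mono2) (auto simp: dyad_def divide_right_mono)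
  also have "\<dots> \<le> (dyad n q - dyad n p) * a u u"
    using F.form_le[OF u, of n] potential_nonneg[of n u] pq
    by (intro mult_left_mono) (auto simp: trunc_def dyad_def divide_right_mono)
  finally show ?thesis .
qed

lemma dom_holder:
  assumes u: "u \<in> Dom"
  shows "(norm (u t - u s))\<^sup>2 \<le> \<bar>t - s\<bar> * a u u"
proof -
  have *: "(norm (u t - u s))\<^sup>2 \<le> (t - s) * a u u" if st: "s \<le> t" for s t
  proof -
    define p q where "p n = \<lfloor>2 ^ n * s\<rfloor>" and "q n = \<lfloor>2 ^ n * t\<rfloor>" for n
    have lim: "(\<lambda>n. u (dyad n \<lfloor>2 ^ n * t\<rfloor>)) \<longlonglongrightarrow> u t" for t
      using dom_cont[OF u] dyad_floor_tendsto[of t] by (rule continuous_on_tendsto_compose) auto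
    have l1: "(\<lambda>n. (norm (u (dyad n (q n)) - u (dyad n (p n))))\<^sup>2) \<longlonglongrightarrow> (norm (u t - u s))\<^sup>2"
      unfolding p_def q_def by (intro tendsto_intros lim)
    have l2: "(\<lambda>n. (dyad n (q n) - dyad n (p n)) * a u u) \<longlonglongrightarrow> (t - s) * a u u"
      unfolding p_def q_def by (intro tendsto_intros dyad_floor_tendsto)
    obtain N :: nat where N: "\<bar>s\<bar> \<le> N" "\<bar>t\<bar> \<le> N" using real_arch_simple[of "max \<bar>s\<bar> \<bar>t\<bar>"] by auto
    have "(norm (u (dyad n (q n)) - u (dyad n (p n))))\<^sup>2 \<le> (dyad n (q n) - dyad n (p n)) * a u u" if n: "n \<ge> N" for n
    proof (rule dyad_holder[OF u])
      have "2 ^ n * (- real n) \<le> 2 ^ n * s" "2 ^ n * t \<le> 2 ^ n * real n"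
        by (rule mult_left_mono; use N n in simp)+
      then show "- int n * 2 ^ n \<le> p n" "q n \<le> int n * 2 ^ n"
        unfolding p_def q_def le_floor_iff floor_le_iff
        by (simp_all only: of_int_mult of_int_of_nat_eq of_int_power of_int_numeral of_int_minus mult.commute[of _ "2 ^ n"])
      show "p n \<le> q n" unfolding p_def q_def using st by (intro floor_mono) auto
    qed
    then show ?thesis by (intro LIMSEQ_le[OF l1 l2]) blast
  qed
  show ?thesis using *[of s t] *[of t s] by (cases "s \<le> t") (auto simp: norm_minus_commute)
qed

text \<open>Compare \<open>u t\<close> with \<open>u s\<close> by the Hoelder estimate and average
  over \<open>s\<close> in \<open>[t, t + \<delta>]\<close>. Length 1 gives the uniform bound
  \<open>dom_sup\<close>; short lengths give the decay at infinity.\<close>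

lemma dom_average:
  assumes u: "u \<in> Dom" and d: "\<delta> > 0"
  shows "\<delta> * (norm (u t))\<^sup>2 \<le> 2 * (LBINT s. indicator {t..t+\<delta>} s * (u s \<bullet> u s)) + 2 * \<delta>\<^sup>2 * a u u"
proof -
  have pt: "(norm (u t))\<^sup>2 \<le> 2 * (u s \<bullet> u s) + 2 * \<delta> * a u u" if "s \<in> {t..t+\<delta>}" for s
  proof -
    have "(norm (u t))\<^sup>2 \<le> 2 * (u s \<bullet> u s) + 2 * (norm (u t - u s))\<^sup>2"
      using inner_ge_zero[of "u t - 2 *\<^sub>R u s"] unfolding power2_norm_eq_inner
      by (simp add: inner_add inner_diff inner_commute algebra_simps)
    also have "(norm (u t - u s))\<^sup>2 \<le> \<bar>t - s\<bar> * a u u" by (rule dom_holder[OF u])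
    also have "\<dots> \<le> \<delta> * a u u" using that F.nonneg[OF u] by (intro mult_right_mono) auto
    finally show ?thesis by simp
  qed
  have i: "integrable lborel (\<lambda>s. indicator {t..t+\<delta>} s * (u s \<bullet> u s))"
    by (intro integrable_on_interval continuous_intros dom_cont u)
  have "\<delta> * (norm (u t))\<^sup>2 = (LBINT s. indicator {t..t+\<delta>} s * (norm (u t))\<^sup>2)"
    using d by simp
  also have "\<dots> \<le> (LBINT s. 2 * (indicator {t..t+\<delta>} s * (u s \<bullet> u s)) + indicator {t..t+\<delta>} s * (2 * \<delta> * a u u))"
  proof (rule integral_mono)
    show "integrable lborel (\<lambda>s. indicator {t..t+\<delta>} s * (norm (u t))\<^sup>2)"
      "integrable lborel (\<lambda>s. 2 * (indicator {t..t+\<delta>} s * (u s \<bullet> u s)) + indicator {t..t+\<delta>} s * (2 * \<delta> * a u u))"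
      using d i by simp_all
  qed (use pt in \<open>simp split: split_indicator\<close>)
  also have "\<dots> = 2 * (LBINT s. indicator {t..t+\<delta>} s * (u s \<bullet> u s)) + \<delta> * (2 * \<delta> * a u u)"
    using d i by (subst Bochner_Integration.integral_add) auto
  finally show ?thesis by (simp add: power2_eq_square)
qed

lemma dom_sup:
  assumes u: "u \<in> Dom"
  shows "(norm (u t))\<^sup>2 \<le> 4 * a u u"
proof -
  have "(LBINT s. indicator {t..t+1} s * (u s \<bullet> u s)) \<le> (LBINT s. u s \<bullet> u s)"
    using dom_cont[OF u] dom_square[OF u]
    by (intro integral_mono integrable_on_interval continuous_intros) (auto simp: indicator_def)
  then show ?thesis using dom_average[OF u, of 1 t] dom_square(2)[OF u] by simp
qed

end

section \<open>Decay at infinity, the \<open>L^1\<close> bound and compactness in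
  \<open>L^2\<close>\<close>

context schroedinger_form
begin

text \<open>Outside \<open>B\<close> the weight is at least \<open>2 / \<epsilon>\<close>, so the
  potential energy pays for \<open>|u|^2\<close> with half of the allowance; on \<open>B\<close> the
  uniform bound \<open>4 * a u u\<close> times the measure \<open>\<epsilon> / 8\<close> uses the
  other half. One \<open>R\<close> serves all \<open>u\<close>, which is the source of
  compactness.\<close>

lemma dom_tail:
  assumes e: "\<epsilon> > 0"
  shows "\<exists>R>0. \<forall>u\<in>Dom. (LBINT t. indicator {t. \<bar>t\<bar> \<ge> R} t * (u t \<bullet> u t)) \<le> \<epsilon> * a u u"
proof -
  obtain R1 B where R1: "R1 \<ge> 3" and B: "B \<in> sets lborel" "emeasure lborel B \<le> ennreal (\<epsilon> / 8)"
    and g: "\<And>t x. \<bar>t\<bar> \<ge> R1 \<Longrightarrow> t \<notin> B \<Longrightarrow> \<omega> t * (x \<bullet> x) \<le> A t x \<bullet> x"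
    using growth[of "\<epsilon> / 8"] e by auto
  have "\<forall>\<^sub>F t in at_infinity. \<omega> t \<ge> 2 / \<epsilon>" using weight_top by (simp add: filterlim_at_top)
  then obtain R2 where R2: "\<And>t. \<bar>t\<bar> \<ge> R2 \<Longrightarrow> \<omega> t \<ge> 2 / \<epsilon>" by (auto simp: eventually_at_infinity)
  define R where "R = max R1 R2"
  have mB: "measure lborel B \<le> \<epsilon> / 8"
    unfolding measure_def by (rule enn2real_leI[OF _ B(2)]) (use e in simp)
  have iB: "integrable lborel (indicat_real B)"
    using B by (intro integrable_real_indicator) (auto simp: less_top[symmetric] top_unique)
  have "(LBINT t. indicator {t. \<bar>t\<bar> \<ge> R} t * (u t \<bullet> u t)) \<le> \<epsilon> * a u u" if u: "u \<in> Dom" for u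
  proof -
    have pt: "indicator {t. \<bar>t\<bar> \<ge> R} t * (u t \<bullet> u t) \<le> \<epsilon> / 2 * (A t (u t) \<bullet> u t) + 4 * a u u * indicator B t" for t
    proof (cases "\<bar>t\<bar> \<ge> R")
      case False
      then show ?thesis using e A_nonneg[of t "u t"] F.nonneg[OF u] by simp
    next
      case R: True
      show ?thesis
      proof (cases "t \<in> B")
        case True
        have "u t \<bullet> u t \<le> 4 * a u u" using dom_sup[OF u, of t] by (simp add: power2_norm_eq_inner)
        moreover have "0 \<le> \<epsilon> / 2 * (A t (u t) \<bullet> u t)" using e A_nonneg[of t "u t"] by simp
        ultimately show ?thesis using True R by simp
      next
        case False
        have "u t \<bullet> u t = \<epsilon> / 2 * (2 / \<epsilon> * (u t \<bullet> u t))" using e by simp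
        also have "\<dots> \<le> \<epsilon> / 2 * (\<omega> t * (u t \<bullet> u t))"
          using R R2[of t] e by (intro mult_left_mono mult_right_mono) (auto simp: R_def)
        also have "\<dots> \<le> \<epsilon> / 2 * (A t (u t) \<bullet> u t)"
          using g[of t "u t"] R False e by (intro mult_left_mono) (auto simp: R_def)
        finally show ?thesis using False R by simp
      qed
    qed
    have "{t::real. \<bar>t\<bar> \<ge> R} \<in> sets lborel" by measurable
    then have i1: "integrable lborel (\<lambda>t. indicator {t. \<bar>t\<bar> \<ge> R} t * (u t \<bullet> u t))"
      by (intro integrable_indicator_times dom_square u)
    have "(LBINT t. indicator {t. \<bar>t\<bar> \<ge> R} t * (u t \<bullet> u t)) \<le>
        (LBINT t. \<epsilon> / 2 * (A t (u t) \<bullet> u t) + 4 * a u u * indicator B t)"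
      using pt by (intro integral_mono i1 Bochner_Integration.integrable_add integrable_mult_right iB dom_potential u)
    also have "\<dots> = \<epsilon> / 2 * (LBINT t. A t (u t) \<bullet> u t) + 4 * a u u * measure lborel B"
      using iB B dom_potential[OF u] by simp
    also have "\<dots> \<le> \<epsilon> / 2 * a u u + 4 * a u u * (\<epsilon> / 8)"
      using e mB dom_potential[OF u] F.nonneg[OF u] by (intro add_mono mult_left_mono) auto
    finally show ?thesis by simp
  qed
  moreover have "R > 0" using R1 by (simp add: R_def)
  ultimately show ?thesis by blast
qed

text \<open>In \<open>dom_average\<close>, first \<open>\<delta>\<close> is taken so small that the
  energy term is at most \<open>e^2 / 4\<close>, then \<open>R\<close> so large that the integral
  term is as well. Dividing by \<open>a u u + 1\<close> avoids a vanishing energy.\<close>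

lemma dom_vanishes:
  assumes u: "u \<in> Dom"
  shows "(u \<longlongrightarrow> 0) at_infinity"
proof -
  have "\<forall>\<^sub>F t in at_infinity. dist (u t) 0 < e" if e: "e > 0" for e
  proof -
    define \<delta> where "\<delta> = min 1 (e\<^sup>2 / (8 * (a u u + 1)))"
    have a0: "a u u \<ge> 0" using F.nonneg[OF u] .
    have d: "\<delta> > 0" "\<delta> \<le> 1" using e a0 by (auto simp: \<delta>_def)
    have d2: "2 * \<delta> * a u u \<le> e\<^sup>2 / 4"
    proof -
      have "\<delta> * a u u \<le> e\<^sup>2 / (8 * (a u u + 1)) * (a u u + 1)"
        using a0 by (intro mult_mono) (auto simp: \<delta>_def)
      also have "\<dots> = e\<^sup>2 / 8" using a0 by (simp add: field_simps)
      finally show ?thesis by simp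
    qed
    obtain R where R: "R > 0" "(LBINT t. indicator {t. \<bar>t\<bar> \<ge> R} t * (u t \<bullet> u t)) \<le> \<delta> * e\<^sup>2 / (8 * (a u u + 1)) * a u u"
      using dom_tail[of "\<delta> * e\<^sup>2 / (8 * (a u u + 1))"] u e d a0 by auto
    have "dist (u t) 0 < e" if t: "\<bar>t\<bar> \<ge> R + 1" for t
    proof -
      have "{t::real. \<bar>t\<bar> \<ge> R} \<in> sets lborel" by measurable
      then have i1: "integrable lborel (\<lambda>t. indicator {t. \<bar>t\<bar> \<ge> R} t * (u t \<bullet> u t))"
        by (intro integrable_indicator_times dom_square u)
      have "(LBINT s. indicator {t..t+\<delta>} s * (u s \<bullet> u s)) \<le> (LBINT t. indicator {t. \<bar>t\<bar> \<ge> R} t * (u t \<bullet> u t))"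
        using t d i1
        by (intro integral_mono integrable_on_interval continuous_intros dom_cont u) (auto split: split_indicator)
      also have "\<dots> \<le> \<delta> * e\<^sup>2 / (8 * (a u u + 1)) * a u u" by (rule R)
      also have "\<dots> \<le> \<delta> * e\<^sup>2 / (8 * (a u u + 1)) * (a u u + 1)" using d e a0 by (intro mult_left_mono) auto
      also have "\<dots> = \<delta> * e\<^sup>2 / 8" using a0 by (simp add: field_simps)
      finally have "\<delta> * (norm (u t))\<^sup>2 \<le> \<delta> * (e\<^sup>2 / 4 + 2 * \<delta> * a u u)"
        using dom_average[OF u d(1), of t] by (simp add: power2_eq_square algebra_simps)
      then have "(norm (u t))\<^sup>2 \<le> e\<^sup>2 / 4 + 2 * \<delta> * a u u" using d by simp
      also have "\<dots> < e\<^sup>2"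
      proof -
        have "e\<^sup>2 > 0" using e by simp
        then show ?thesis using d2 by linarith
      qed
      finally show ?thesis using e by (simp add: power2_less_imp_less)
    qed
    then show ?thesis unfolding eventually_at_infinity by (intro exI[of _ "R + 1"]) auto
  qed
  then show ?thesis by (rule tendstoI)
qed

text \<open>Where the potential dominates the weight, Young's inequality gives
  \<open>|u| <= X / \<omega> + \<omega> |u|^2 / X\<close> with \<open>X\<close> the energy norm; the
  first term is integrable by \<open>weight_int\<close>, the second by the potential energy. On the
  remaining set, an interval together with \<open>B\<close>, the measure is finite and the uniform
  bound \<open>2 X\<close> suffices.\<close>

lemma dom_l1:
  obtains K where "K > 0" and "\<And>u. u \<in> Dom \<Longrightarrow> integrable lborel (\<lambda>t. norm (u t))"
    and "\<And>u. u \<in> Dom \<Longrightarrow> (LBINT t. norm (u t)) \<le> K * sqrt (a u u)"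
proof -
  obtain R B where R: "R \<ge> 3" and B: "B \<in> sets lborel" "emeasure lborel B \<le> ennreal 1"
    and g: "\<And>t x. \<bar>t\<bar> \<ge> R \<Longrightarrow> t \<notin> B \<Longrightarrow> \<omega> t * (x \<bullet> x) \<le> A t x \<bullet> x"
    using growth[of 1] by auto
  define I where "I = (LBINT t. indicator {t. \<bar>t\<bar> \<ge> 3} t / \<omega> t)"
  have I0: "I \<ge> 0" unfolding I_def using weight_pos
    by (intro integral_nonneg_AE AE_I2) (auto simp: indicator_def less_imp_le)
  have mB: "measure lborel B \<le> 1"
    unfolding measure_def by (rule enn2real_leI[OF _ B(2)]) simp
  have iB: "integrable lborel (indicat_real B)"
    using B by (intro integrable_real_indicator) (auto simp: less_top[symmetric] top_unique)
  \<comment> \<open>The contributions divided by the energy norm: \<open>4 * R\<close> from the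
    interval, 2 from \<open>B\<close>, \<open>I\<close> from the weight and 1 from the
    potential.\<close>
  define K where "K = 4 * R + 3 + I"
  have main: "integrable lborel (\<lambda>t. norm (u t)) \<and> (LBINT t. norm (u t)) \<le> K * sqrt (a u u)" if u: "u \<in> Dom" for u
  proof -
    define X where "X = sqrt (a u u)"
    have X2: "X * X = a u u" using F.nonneg[OF u] by (simp add: X_def)
    have sup: "norm (u t) \<le> 2 * X" for t
      using real_sqrt_le_mono[OF dom_sup[OF u, of t]] by (simp add: X_def real_sqrt_mult)
    show ?thesis
    proof (cases "X = 0")
      case True
      then have "norm (u t) = 0" for t using sup[of t] by simp
      then show ?thesis using True by (simp add: X_def)
    next
      case False
      then have X: "X > 0" using F.nonneg[OF u] by (simp add: X_def)
      define f where "f t = 2 * X * indicator {-R..R} t + 2 * X * indicator B t + X * (indicator {t. \<bar>t\<bar> \<ge> 3} t / \<omega> t)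
          + (A t (u t) \<bullet> u t) / X" for t
      have pt: "norm (u t) \<le> f t" for t
      proof -
        have nn: "0 \<le> X * (indicator {t. \<bar>t\<bar> \<ge> 3} t / \<omega> t)" "0 \<le> (A t (u t) \<bullet> u t) / X" "0 \<le> 2 * X * indicator B t"
            "0 \<le> 2 * X * indicator {-R..R} t"
          using X weight_pos[of t] A_nonneg[of t "u t"] by (auto simp: indicator_def less_imp_le)
        consider "\<bar>t\<bar> \<le> R" | "t \<in> B" | "\<bar>t\<bar> \<ge> R" "t \<notin> B" by linarith
        then show ?thesis
        proof cases
          case 1
          then have "2 * X * indicator {-R..R} t = 2 * X" by (simp add: indicator_def abs_le_iff)
          then show ?thesis unfolding f_def using nn sup[of t] by linarith
        next
          case 2
          then have "2 * X * indicator B t = 2 * X" by simp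
          then show ?thesis unfolding f_def using nn sup[of t] by linarith
        next
          case 3
          have w: "\<omega> t > 0" using weight_pos 3 R by auto
          define n where "n = norm (u t)"
          have "2 * (n * X * \<omega> t) \<le> X * X + (n * \<omega> t) * (n * \<omega> t)"
            using sum_squares_bound[of X "n * \<omega> t"] by (simp add: power2_eq_square algebra_simps)
          moreover have "0 \<le> n * X * \<omega> t" using w X by (simp add: n_def)
          ultimately have "n * X * \<omega> t \<le> X * X + (n * \<omega> t) * (n * \<omega> t)" by linarith
          then have "n \<le> X / \<omega> t + \<omega> t * (n * n) / X" using w X by (simp add: field_simps)
          also have "\<omega> t * (n * n) \<le> A t (u t) \<bullet> u t"
            using g[of t "u t"] 3 by (simp add: n_def flip: power2_norm_eq_inner power2_eq_square)
          finally have "n \<le> X / \<omega> t + (A t (u t) \<bullet> u t) / X" using X by (simp add: divide_right_mono)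
          moreover have "X * (indicator {t. \<bar>t\<bar> \<ge> 3} t / \<omega> t) = X / \<omega> t" using 3 R by simp
          ultimately show ?thesis unfolding f_def n_def using nn by linarith
        qed
      qed
      have hR: "has_bochner_integral lborel (indicat_real {-R..R}) (2 * R)"
        using has_bochner_integral_real_indicator[of "{-R..R}" lborel] R by (simp add: emeasure_lborel_Icc_eq)
      have hB: "has_bochner_integral lborel (indicat_real B) (measure lborel B)"
        using iB B by (simp add: has_bochner_integral_iff)
      have "has_bochner_integral lborel f
        (2 * X * (2 * R) + 2 * X * measure lborel B + X * I + (LBINT t. A t (u t) \<bullet> u t) / X)"
        unfolding f_def I_def
        by (intro has_bochner_integral_add has_bochner_integral_mult_right has_bochner_integral_divide hR hB
            has_bochner_integral_integrable weight_int dom_potential u)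
      then have i: "integrable lborel f"
        and fI: "(LBINT t. f t) = 2 * X * (2 * R) + 2 * X * measure lborel B + X * I + (LBINT t. A t (u t) \<bullet> u t) / X"
        by (simp_all add: has_bochner_integral_iff)
      have 1: "integrable lborel (\<lambda>t. norm (u t))"
      proof (rule Bochner_Integration.integrable_bound[OF i])
        show "(\<lambda>t. norm (u t)) \<in> borel_measurable lborel" using dom_measurable[OF u] by simp
      qed (use pt in \<open>simp add: order_trans[OF _ abs_ge_self]\<close>)
      have "(LBINT t. norm (u t)) \<le> (LBINT t. f t)" using pt by (intro integral_mono 1 i)
      also have "\<dots> = 2 * X * (2 * R) + 2 * X * measure lborel B + X * I + (LBINT t. A t (u t) \<bullet> u t) / X"
        by (rule fI)
      also have "(LBINT t. A t (u t) \<bullet> u t) / X \<le> X * X / X"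
        unfolding X2 using dom_potential(2)[OF u] X by (intro divide_right_mono) auto
      also have "2 * X * measure lborel B \<le> 2 * X * 1" using mB X by (intro mult_left_mono) auto
      finally have "(LBINT t. norm (u t)) \<le> K * X" using X by (simp add: K_def algebra_simps)
      then show ?thesis using 1 by (simp add: X_def)
    qed
  qed
  have "K > 0" using R I0 by (simp add: K_def)
  then show ?thesis using that main by blast
qed

text \<open>Arzela-Ascoli by hand: a diagonal subsequence converges at the rational points, and the
  common Hoelder estimate carries this to all points. Pointwise convergence is enough, since
  integrals are handled by dominated convergence.\<close>

lemma dom_subsequence:
  assumes U: "\<And>j. U j \<in> Dom" and C: "\<And>j. a (U j) (U j) \<le> C"
  obtains r u where "strict_mono (r::nat\<Rightarrow>nat)" "continuous_on UNIV u" "\<And>t. (\<lambda>j. U (r j) t) \<longlonglongrightarrow> u t"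
proof -
  have C0: "C \<ge> 0" using F.nonneg[OF U, of 0] C[of 0] by simp
  have bd: "norm (U j t) \<le> 2 * sqrt C" for j t
  proof -
    have "(norm (U j t))\<^sup>2 \<le> 4 * C" using dom_sup[OF U, of j t] C[of j] by simp
    from real_sqrt_le_mono[OF this] show ?thesis by (simp add: real_sqrt_mult)
  qed
  have ho: "norm (U j t - U j s) \<le> sqrt (\<bar>t - s\<bar> * C)" for j t s
  proof -
    have "(norm (U j t - U j s))\<^sup>2 \<le> \<bar>t - s\<bar> * C"
      using dom_holder[OF U, of j t s] mult_left_mono[OF C[of j], of "\<bar>t - s\<bar>"] by simp
    from real_sqrt_le_mono[OF this] show ?thesis by simp
  qed
  obtain r :: "nat \<Rightarrow> nat" where r: "strict_mono r" and rat: "\<And>q. q \<in> \<rat> \<Longrightarrow> \<exists>l. (\<lambda>j. U (r j) q) \<longlonglongrightarrow> l"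
    by (rule function_convergent_subsequence[OF countable_rat, of U "2 * sqrt C"]) (use bd in blast)+
  have "\<exists>l. (\<lambda>j. U (r j) t) \<longlonglongrightarrow> l" for t
  proof -
    have "Cauchy (\<lambda>j. U (r j) t)"
    proof (rule CauchyI)
      fix e :: real assume e: "e > 0"
      \<comment> \<open>Chosen so that points within \<open>d\<close> of \<open>t\<close> have
        values within \<open>e / 4\<close>, for all members of the sequence at once.\<close>
      define d where "d = (e / 4)\<^sup>2 / (C + 1)"
      have d: "d > 0" using e C0 by (simp add: d_def)
      obtain q where q: "q \<in> \<rat>" "t < q" "q < t + d" using Rats_dense_in_real[of t "t + d"] d by auto
      have "\<bar>t - q\<bar> * C \<le> d * (C + 1)" using q C0 by (intro mult_mono) auto
      also have "\<dots> = (e / 4)\<^sup>2" using C0 by (simp add: d_def)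
      finally have "sqrt (\<bar>t - q\<bar> * C) \<le> e / 4" using e by (intro real_le_lsqrt) auto
      then have h: "norm (U j t - U j q) \<le> e / 4" for j using ho[of j t q] by simp
      have "Cauchy (\<lambda>j. U (r j) q)" using rat[OF q(1)] by (auto intro: LIMSEQ_imp_Cauchy)
      then obtain M where M: "\<And>m n. m \<ge> M \<Longrightarrow> n \<ge> M \<Longrightarrow> norm (U (r m) q - U (r n) q) < e / 4"
        using CauchyD[of "\<lambda>j. U (r j) q" "e / 4"] e by auto
      have "norm (U (r m) t - U (r n) t) < e" if "m \<ge> M" "n \<ge> M" for m n
      proof -
        have "U (r m) t - U (r n) t = (U (r m) t - U (r m) q) + (U (r m) q - U (r n) q) - (U (r n) t - U (r n) q)" by simp
        also have "norm \<dots> \<le> norm (U (r m) t - U (r m) q) + norm (U (r m) q - U (r n) q) + norm (U (r n) t - U (r n) q)"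
          by (intro order_trans[OF norm_triangle_ineq4] add_mono norm_triangle_ineq order_refl)
        also have "\<dots> < e / 4 + e / 4 + e / 4 + e / 4" using h[of "r m"] h[of "r n"] M[OF that] e by linarith
        finally show ?thesis by simp
      qed
      then show "\<exists>M. \<forall>m\<ge>M. \<forall>n\<ge>M. norm (U (r m) t - U (r n) t) < e" by blast
    qed
    then show ?thesis by (simp add: Cauchy_convergent_iff convergent_def)
  qed
  then obtain u where u: "\<And>t. (\<lambda>j. U (r j) t) \<longlonglongrightarrow> u t" by metis
  have hu: "norm (u t - u s) \<le> sqrt (\<bar>t - s\<bar> * C)" for t s
    by (rule LIMSEQ_le_const2[OF tendsto_norm[OF tendsto_diff[OF u u]]]) (use ho in blast)
  have "continuous_on UNIV u"
    unfolding continuous_on_def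
  proof
    fix t
    have "((\<lambda>s. sqrt (\<bar>s - t\<bar> * C)) \<longlongrightarrow> sqrt (\<bar>t - t\<bar> * C)) (at t)" by (intro tendsto_intros)
    then have z: "((\<lambda>s. sqrt (\<bar>s - t\<bar> * C)) \<longlongrightarrow> 0) (at t)" by simp
    have "((\<lambda>s. u s - u t) \<longlongrightarrow> 0) (at t)"
      by (rule Lim_null_comparison[OF always_eventually z]) (use hu in blast)
    then show "(u \<longlongrightarrow> u t) (at t within UNIV)" using LIM_zero_cancel by auto
  qed
  then show ?thesis using that r u by blast
qed

text \<open>A truncation sees finitely many grid values and a compact interval, so bounded pointwise
  convergence suffices.\<close>

lemma trunc_tendsto:
  assumes U: "\<And>j. continuous_on UNIV (U j)" and u: "continuous_on UNIV u" and v: "continuous_on UNIV v"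
    and lim: "\<And>t. (\<lambda>j. U j t) \<longlonglongrightarrow> u t" and bd: "\<And>j t. norm (U j t) \<le> C"
  shows "(\<lambda>j. trunc n (U j) v) \<longlonglongrightarrow> trunc n u v" and "(\<lambda>j. trunc n (U j) (U j)) \<longlonglongrightarrow> trunc n u u"
proof -
  have "compact ((\<lambda>p. A (fst p) (snd p)) ` ({- real n..real n} \<times> cball 0 C))"
    by (intro compact_continuous_image continuous_on_subset[OF cont_A] compact_Times) auto
  then have "bounded ((\<lambda>p. A (fst p) (snd p)) ` ({- real n..real n} \<times> cball 0 C))" by (rule compact_imp_bounded)
  then obtain K where bK: "\<forall>y\<in>(\<lambda>p. A (fst p) (snd p)) ` ({- real n..real n} \<times> cball 0 C). norm y \<le> K"
    unfolding bounded_iff by blast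
  have K: "norm (A t x) \<le> K" if "t \<in> {- real n..real n}" "norm x \<le> C" for t x
  proof -
    have "A t x \<in> (\<lambda>p. A (fst p) (snd p)) ` ({- real n..real n} \<times> cball 0 C)"
      by (rule image_eqI[of _ _ "(t, x)"]) (use that in auto)
    then show ?thesis using bK by blast
  qed
  have C0: "C \<ge> 0" by (rule order_trans[OF norm_ge_zero bd])
  have Kge: "K \<ge> 0" by (rule order_trans[OF norm_ge_zero K[of 0 0]]) (use C0 in auto)
  have "bounded (v ` {- real n..real n})"
    by (intro compact_imp_bounded compact_continuous_image continuous_on_subset[OF v]) auto
  then obtain D where D: "\<And>t. t \<in> {- real n..real n} \<Longrightarrow> norm (v t) \<le> D"
    unfolding bounded_iff by blast
  have limA: "(\<lambda>j. A t (U j t)) \<longlonglongrightarrow> A t (u t)" for t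
    using continuous_on_tendsto_compose[OF cont_A tendsto_Pair[OF tendsto_const lim], of t t] by simp
  have P0: "(\<lambda>j. potential n (U j) v) \<longlonglongrightarrow> potential n u v"
    unfolding potential_def
  proof (rule integral_dominated_convergence)
    show "AE t in lborel. norm (indicator {- real n..real n} t * (A t (U j t) \<bullet> v t)) \<le> indicator {- real n..real n} t * (K * D)" for j
    proof (rule AE_I2)
      fix t
      have "\<bar>A t (U j t) \<bullet> v t\<bar> \<le> K * D" if t: "t \<in> {- real n..real n}"
        using K[OF t bd, of j] D[OF t] Kge by (intro order_trans[OF Cauchy_Schwarz_ineq2] mult_mono) auto
      then show "norm (indicator {- real n..real n} t * (A t (U j t) \<bullet> v t)) \<le> indicator {- real n..real n} t * (K * D)"
        by (auto simp: indicator_def)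
    qed
    show "AE t in lborel. (\<lambda>j. indicator {- real n..real n} t * (A t (U j t) \<bullet> v t)) \<longlonglongrightarrow> indicator {- real n..real n} t * (A t (u t) \<bullet> v t)"
      by (intro AE_I2 tendsto_intros limA)
    show "integrable lborel (\<lambda>t. indicator {- real n..real n} t * (K * D))" by simp
  qed (rule borel_measurable_integrable[OF potential_integrable[OF u v]]
      borel_measurable_integrable[OF potential_integrable[OF U v]])+
  have K0: "(\<lambda>j. kinetic n (U j) v) \<longlonglongrightarrow> kinetic n u v"
    unfolding kinetic_def dyad_diff_def by (intro tendsto_intros lim)
  show "(\<lambda>j. trunc n (U j) v) \<longlonglongrightarrow> trunc n u v"
    unfolding trunc_def by (rule tendsto_add[OF K0 P0])
  have P1: "(\<lambda>j. potential n (U j) (U j)) \<longlonglongrightarrow> potential n u u"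
    unfolding potential_def
  proof (rule integral_dominated_convergence)
    show "AE t in lborel. norm (indicator {- real n..real n} t * (A t (U j t) \<bullet> U j t)) \<le> indicator {- real n..real n} t * (K * C)" for j
    proof (rule AE_I2)
      fix t
      have "\<bar>A t (U j t) \<bullet> U j t\<bar> \<le> K * C" if t: "t \<in> {- real n..real n}"
        using K[OF t bd, of j] bd Kge by (intro order_trans[OF Cauchy_Schwarz_ineq2] mult_mono) auto
      then show "norm (indicator {- real n..real n} t * (A t (U j t) \<bullet> U j t)) \<le> indicator {- real n..real n} t * (K * C)"
        by (auto simp: indicator_def)
    qed
    show "AE t in lborel. (\<lambda>j. indicator {- real n..real n} t * (A t (U j t) \<bullet> U j t)) \<longlonglongrightarrow> indicator {- real n..real n} t * (A t (u t) \<bullet> u t)"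
      by (intro AE_I2 tendsto_intros limA lim)
    show "integrable lborel (\<lambda>t. indicator {- real n..real n} t * (K * C))" by simp
  qed (rule borel_measurable_integrable[OF potential_integrable[OF u u]]
      borel_measurable_integrable[OF potential_integrable[OF U U]])+
  have K1: "(\<lambda>j. kinetic n (U j) (U j)) \<longlonglongrightarrow> kinetic n u u"
    unfolding kinetic_def dyad_diff_def by (intro tendsto_intros lim)
  show "(\<lambda>j. trunc n (U j) (U j)) \<longlonglongrightarrow> trunc n u u"
    unfolding trunc_def by (rule tendsto_add[OF K1 P1])
qed

text \<open>Each truncation is continuous along the subsequence and bounded by \<open>a\<close>;
  passing to the limit first and to the supremum over the truncations afterwards gives the
  semicontinuity. Convergence in \<open>l2\<close> is dominated convergence on
  \<open>[-R, R]\<close> together with the uniform tail bound.\<close>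

lemma dom_compact:
  assumes U: "\<And>j. U j \<in> Dom" and C: "\<And>j. a (U j) (U j) \<le> C"
  obtains r u where "strict_mono (r::nat\<Rightarrow>nat)" "u \<in> Dom" "\<And>t. (\<lambda>j. U (r j) t) \<longlonglongrightarrow> u t"
    "(\<lambda>j. l2 (U (r j) - u) (U (r j) - u)) \<longlonglongrightarrow> 0"
    "\<And>c. \<forall>\<^sub>F j in sequentially. a (U j) (U j) \<le> c \<Longrightarrow> a u u \<le> c"
proof -
  have C0: "C \<ge> 0" using F.nonneg[OF U, of 0] C[of 0] by simp
  obtain r u where r: "strict_mono (r::nat\<Rightarrow>nat)" and cu: "continuous_on UNIV u"
    and lim: "\<And>t. (\<lambda>j. U (r j) t) \<longlonglongrightarrow> u t"
    using dom_subsequence[of U C, OF U C] by blast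
  have bd: "norm (U j t) \<le> 2 * sqrt C" for j t
  proof -
    have "(norm (U j t))\<^sup>2 \<le> 4 * C" using dom_sup[OF U, of j t] C[of j] by simp
    from real_sqrt_le_mono[OF this] show ?thesis by (simp add: real_sqrt_mult)
  qed
  have tr: "trunc n u u \<le> c" if ev: "\<forall>\<^sub>F j in sequentially. a (U j) (U j) \<le> c" for c n
  proof (rule tendsto_upperbound[OF trunc_tendsto(2)[OF _ cu cu lim bd]])
    show "\<forall>\<^sub>F j in sequentially. trunc n (U (r j)) (U (r j)) \<le> c"
      using eventually_subseq[OF r ev] by eventually_elim (rule order_trans[OF F.form_le[OF U]])
  qed (use dom_cont U in auto)
  have u: "u \<in> Dom" unfolding F.dom_def using cu tr[of C] C by auto
  have lsc: "a u u \<le> c" if "\<forall>\<^sub>F j in sequentially. a (U j) (U j) \<le> c" for c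
    by (rule F.lim_form_le[OF u tr[OF that]])
  have uC: "a u u \<le> C" using lsc[of C] C by simp
  define v where "v j = U (r j) - u" for j
  have v: "v j \<in> Dom" for j unfolding v_def using U u by (rule F.mem)
  have av: "a (v j) (v j) \<le> 4 * C" for j
  proof -
    have "a (v j) (v j) \<le> 2 * a (U (r j)) (U (r j)) + 2 * a u u"
      unfolding v_def by (rule F.quad_diff_le[OF U u])
    then show ?thesis using uC C[of "r j"] by simp
  qed
  have "(\<lambda>j. l2 (v j) (v j)) \<longlonglongrightarrow> 0"
  proof (rule LIMSEQ_I)
    fix e :: real assume e: "e > 0"
    \<comment> \<open>The differences \<open>v j\<close> have energy at most \<open>4 * C\<close>,
      so with this tolerance their tails contribute at most \<open>e / 2\<close>.\<close>
    obtain R where R: "\<And>u. u \<in> Dom \<Longrightarrow> (LBINT t. indicator {t. \<bar>t\<bar> \<ge> R} t * (u t \<bullet> u t)) \<le> e / (8 * (C + 1)) * a u u"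
      using dom_tail[of "e / (8 * (C + 1))"] e C0 by auto
    have c2: "continuous_on UNIV (\<lambda>t. v j t \<bullet> v j t)" for j by (intro continuous_intros dom_cont v)
    have "(\<lambda>j. LBINT t. indicator {-R..R} t * (v j t \<bullet> v j t)) \<longlonglongrightarrow> (LBINT t. indicator {-R..R} t * (0 \<bullet> (0::'a)))"
    proof (rule integral_dominated_convergence)
      show "AE t in lborel. norm (indicator {-R..R} t * (v j t \<bullet> v j t)) \<le> indicator {-R..R} t * (16 * C)" for j
      proof (rule AE_I2)
        fix t
        have "v j t \<bullet> v j t \<le> 16 * C" using dom_sup[OF v, of j t] av[of j] by (simp add: power2_norm_eq_inner)
        then show "norm (indicator {-R..R} t * (v j t \<bullet> v j t)) \<le> indicator {-R..R} t * (16 * C)"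
          by (auto simp: indicator_def)
      qed
      show "AE t in lborel. (\<lambda>j. indicator {-R..R} t * (v j t \<bullet> v j t)) \<longlonglongrightarrow> indicator {-R..R} t * (0 \<bullet> (0::'a))"
      proof (rule AE_I2)
        fix t
        have "(\<lambda>j. v j t) \<longlonglongrightarrow> 0" unfolding v_def using LIM_zero[OF lim[of t]] by simp
        then show "(\<lambda>j. indicator {-R..R} t * (v j t \<bullet> v j t)) \<longlonglongrightarrow> indicator {-R..R} t * (0 \<bullet> (0::'a))"
          by (intro tendsto_intros)
      qed
      show "(\<lambda>t. indicator {-R..R} t * (v j t \<bullet> v j t)) \<in> borel_measurable lborel" for j
        by (rule borel_measurable_integrable[OF integrable_on_interval[OF c2]])
    qed (simp_all add: integrable_indicator_Icc)
    then have "(\<lambda>j. LBINT t. indicator {-R..R} t * (v j t \<bullet> v j t)) \<longlonglongrightarrow> 0" by simp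
    then obtain N where N: "\<And>j. j \<ge> N \<Longrightarrow> \<bar>LBINT t. indicator {-R..R} t * (v j t \<bullet> v j t)\<bar> < e / 2"
      using LIMSEQ_D[of _ 0 "e / 2"] e by fastforce
    have "norm (l2 (v j) (v j) - 0) < e" if j: "j \<ge> N" for j
    proof -
      have "{t::real. \<bar>t\<bar> \<ge> R} \<in> sets lborel" by measurable
      then have i1: "integrable lborel (\<lambda>t. indicator {t. \<bar>t\<bar> \<ge> R} t * (v j t \<bullet> v j t))"
        by (intro integrable_indicator_times dom_square v)
      have "l2 (v j) (v j) \<le> (LBINT t. indicator {-R..R} t * (v j t \<bullet> v j t) + indicator {t. \<bar>t\<bar> \<ge> R} t * (v j t \<bullet> v j t))"
        unfolding l2_def
        by (intro integral_mono dom_square v Bochner_Integration.integrable_add i1 integrable_on_interval c2)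
           (auto simp: indicator_def)
      also have "\<dots> = (LBINT t. indicator {-R..R} t * (v j t \<bullet> v j t)) + (LBINT t. indicator {t. \<bar>t\<bar> \<ge> R} t * (v j t \<bullet> v j t))"
        by (intro Bochner_Integration.integral_add i1 integrable_on_interval c2)
      also have "\<dots> < e / 2 + e / (8 * (C + 1)) * (4 * (C + 1))"
      proof (rule add_less_le_mono)
        show "(LBINT t. indicator {-R..R} t * (v j t \<bullet> v j t)) < e / 2" using N[OF j] by simp
        have "(LBINT t. indicator {t. \<bar>t\<bar> \<ge> R} t * (v j t \<bullet> v j t)) \<le> e / (8 * (C + 1)) * a (v j) (v j)"
          by (rule R[OF v])
        also have "\<dots> \<le> e / (8 * (C + 1)) * (4 * (C + 1))"
          using av[of j] e C0 by (intro mult_left_mono) auto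
        finally show "(LBINT t. indicator {t. \<bar>t\<bar> \<ge> R} t * (v j t \<bullet> v j t)) \<le> e / (8 * (C + 1)) * (4 * (C + 1))" .
      qed
      also have "\<dots> = e" using C0 by (simp add: field_simps)
      finally show ?thesis using psd_form.nonneg[OF psd_form_l2 v, of j] by simp
    qed
    then show "\<exists>N. \<forall>j\<ge>N. norm (l2 (v j) (v j) - 0) < e" by blast
  qed
  then show ?thesis unfolding v_def by (rule that[OF r u lim _ lsc])
qed

end

section \<open>Hat functions and classical solutions\<close>

definition tent :: "real \<Rightarrow> real \<Rightarrow> real \<Rightarrow> real" where
  "tent c h t = max 0 (1 - \<bar>t - c\<bar> / h)"

lemma tent_nonneg: "0 \<le> tent c h t"
  by (simp add: tent_def)

lemma tent_le_1: "h > 0 \<Longrightarrow> tent c h t \<le> 1"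
  by (simp add: tent_def)

lemma tent_outside: "h > 0 \<Longrightarrow> \<bar>t - c\<bar> \<ge> h \<Longrightarrow> tent c h t = 0"
  by (simp add: tent_def field_simps)

lemma continuous_tent: "continuous_on UNIV (tent c h)"
  unfolding tent_def divide_inverse by (intro continuous_intros)

text \<open>Integration by parts twice: the second derivative of the tent is \<open>1 / h\<close>
  times the unit masses at \<open>c + h\<close> and \<open>c - h\<close> minus twice the one at
  \<open>c\<close>. The two sloping halves are integrated with explicit primitives.\<close>

lemma tent_second_difference:
  fixes F G f :: "real \<Rightarrow> real"
  assumes F: "\<And>t. (F has_real_derivative G t) (at t)" and G: "\<And>t. (G has_real_derivative f t) (at t)"
    and f: "continuous_on UNIV f" and h: "h > 0"
  shows "has_bochner_integral lborel (\<lambda>t. tent c h t * f t) ((F (c + h) + F (c - h) - 2 * F c) / h)"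
proof -
  have fc: "isCont f t" for t using f by (simp add: continuous_on_eq_continuous_at)
  have 1: "has_bochner_integral lborel (\<lambda>t. ((t - (c - h)) / h * f t) * indicator {c - h..c} t)
      (((c - (c - h)) * G c - F c) / h - (((c - h) - (c - h)) * G (c - h) - F (c - h)) / h)"
  proof (rule has_bochner_integral_FTC_Icc_real)
    show "((\<lambda>t. ((t - (c - h)) * G t - F t) / h) has_real_derivative (t - (c - h)) / h * f t) (at t)" for t
      using h by (auto intro!: derivative_eq_intros F G simp: field_simps)
    show "isCont (\<lambda>t. (t - (c - h)) / h * f t) t" for t using h by (intro continuous_intros fc) auto
  qed (use h in auto)
  have 2: "has_bochner_integral lborel (\<lambda>t. ((c + h - t) / h * f t) * indicator {c..c + h} t)
      (((c + h - (c + h)) * G (c + h) + F (c + h)) / h - ((c + h - c) * G c + F c) / h)"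
  proof (rule has_bochner_integral_FTC_Icc_real)
    show "((\<lambda>t. ((c + h - t) * G t + F t) / h) has_real_derivative (c + h - t) / h * f t) (at t)" for t
      using h by (auto intro!: derivative_eq_intros F G simp: field_simps)
    show "isCont (\<lambda>t. (c + h - t) / h * f t) t" for t using h by (intro continuous_intros fc) auto
  qed (use h in auto)
  have m: "(\<lambda>t. tent c h t * f t) \<in> borel_measurable lborel"
    using borel_measurable_continuous_onI[OF continuous_on_mult[OF continuous_tent f]] by simp
  have "AE t in lborel. ((t - (c - h)) / h * f t) * indicator {c - h..c} t + ((c + h - t) / h * f t) * indicator {c..c + h} t
      = tent c h t * f t"
    using AE_lborel_singleton[of c]
  proof eventually_elim
    case (elim t)
    consider "t < c - h" | "c - h \<le> t" "t < c" | "c < t" "t \<le> c + h" | "c + h < t" using elim by linarith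
    then show ?case
    proof cases
      case 2
      then have "tent c h t = (t - (c - h)) / h" using h by (simp add: tent_def abs_if field_simps)
      then show ?thesis using 2 by simp
    next
      case 3
      then have "tent c h t = (c + h - t) / h" using h by (simp add: tent_def abs_if field_simps)
      then show ?thesis using 3 by simp
    qed (use h tent_outside[of h t c] in auto)
  qed
  then have "has_bochner_integral lborel (\<lambda>t. tent c h t * f t)
     ((((c - (c - h)) * G c - F c) / h - (((c - h) - (c - h)) * G (c - h) - F (c - h)) / h) +
      (((c + h - (c + h)) * G (c + h) + F (c + h)) / h - ((c + h - c) * G c + F c) / h))"
    by (rule has_bochner_integralI_AE[OF has_bochner_integral_add[OF 1 2] m])
  then show ?thesis using h by (simp add: diff_divide_distrib add_divide_distrib algebra_simps)
qed

lemma ex_antiderivative: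
  fixes g :: "real \<Rightarrow> 'a::euclidean_space"
  assumes g: "continuous_on UNIV g"
  shows "\<exists>G. \<forall>t. (G has_vector_derivative g t) (at t)"
proof (intro exI allI)
  fix t :: real
  define b where "b = \<bar>t\<bar> + 1"
  have "((\<lambda>u. LBINT y=ereal 0..u. g y) has_vector_derivative g t) (at t within {-b..b})"
    by (rule interval_integral_FTC2) (use continuous_on_subset[OF g] in \<open>auto simp: b_def\<close>)
  then show "((\<lambda>u. LBINT y=ereal 0..u. g y) has_vector_derivative g t) (at t)"
    by (subst (asm) at_within_interior) (auto simp: b_def)
qed

text \<open>Vanishing second differences make the values on each grid an arithmetic progression.
  Every grid contains 0 and 1, so the slope is \<open>w 1 - w 0\<close> at all levels, and
  continuity reaches the remaining points.\<close>

lemma dyadic_midpoint_affine: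
  fixes w :: "real \<Rightarrow> 'a::real_normed_vector"
  assumes w: "continuous_on UNIV w"
    and mid: "\<And>m p. w (dyad m (p + 1)) + w (dyad m (p - 1)) = 2 *\<^sub>R w (dyad m p)"
  shows "w t = w 0 + t *\<^sub>R (w 1 - w 0)"
proof -
  have dy: "w (dyad m p) = w 0 + dyad m p *\<^sub>R (w 1 - w 0)" for m p
  proof -
    define c where "c = w (dyad m 1) - w 0"
    have two: "(x * 2) *\<^sub>R c = x *\<^sub>R c + x *\<^sub>R c" for x
      by (simp only: mult_2_right scaleR_left_distrib)
    \<comment> \<open>The recursion has order two, so the induction, which runs in both directions
      from 0, carries two consecutive values.\<close>
    have *: "w (dyad m p) = w 0 + of_int p *\<^sub>R c \<and> w (dyad m (p + 1)) = w 0 + of_int (p + 1) *\<^sub>R c" for p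
    proof (induction p rule: int_induct[where k=0])
      case base
      show ?case by (simp add: c_def) (simp add: dyad_def)
    next
      case (step1 i)
      have "w (dyad m (i + 1 + 1)) = 2 *\<^sub>R w (dyad m (i + 1)) - w (dyad m i)"
        using mid[of m "i + 1"] by (simp add: algebra_simps)
      then show ?case using step1 by (simp add: algebra_simps scaleR_2)
    next
      case (step2 i)
      have "w (dyad m (i - 1)) = 2 *\<^sub>R w (dyad m i) - w (dyad m (i + 1))"
        using mid[of m i] by (simp add: algebra_simps)
      also have "\<dots> = w 0 + of_int (i - 1) *\<^sub>R c" using step2.IH two[of "of_int i"] by (simp add: algebra_simps scaleR_2)
      finally show ?case using step2.IH by simp
    qed
    have "w 1 = w 0 + 2 ^ m *\<^sub>R c" using *[of "2 ^ m"] by (simp add: dyad_def)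
    then have "w 1 - w 0 = 2 ^ m *\<^sub>R c" by simp
    then show ?thesis using *[of p] by (simp add: dyad_def)
  qed
  have "(\<lambda>n. w (dyad n \<lfloor>2 ^ n * t\<rfloor>)) \<longlonglongrightarrow> w t"
    by (rule continuous_on_tendsto_compose[OF w dyad_floor_tendsto]) auto
  moreover have "(\<lambda>n. w (dyad n \<lfloor>2 ^ n * t\<rfloor>)) \<longlonglongrightarrow> w 0 + t *\<^sub>R (w 1 - w 0)"
    unfolding dy by (intro tendsto_intros dyad_floor_tendsto)
  ultimately show ?thesis by (rule LIMSEQ_unique)
qed

text \<open>A second antiderivative \<open>F\<close> of \<open>g\<close> has the same dyadic second
  differences as \<open>u\<close> by \<open>tent_second_difference\<close>, so \<open>u - F\<close>
  is affine and \<open>u\<close> inherits the regularity of \<open>F\<close>.\<close>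

lemma weak_imp_classical:
  fixes u g :: "real \<Rightarrow> 'a::euclidean_space"
  assumes u: "continuous_on UNIV u" and g: "continuous_on UNIV g"
    and weak: "\<And>m p v. 2 ^ m * ((u (dyad m (p + 1)) + u (dyad m (p - 1)) - 2 *\<^sub>R u (dyad m p)) \<bullet> v) =
      (LBINT t. tent (dyad m p) (1 / 2 ^ m) t * (g t \<bullet> v))"
  shows "\<exists>u'. \<forall>t. (u has_vector_derivative u' t) (at t) \<and> (u' has_vector_derivative g t) (at t)"
proof -
  obtain G where G: "\<And>t. (G has_vector_derivative g t) (at t)" using ex_antiderivative[OF g] by blast
  have Gc: "continuous_on UNIV G"
    using G by (meson continuous_at_imp_continuous_on has_vector_derivative_continuous)
  obtain F where F: "\<And>t. (F has_vector_derivative G t) (at t)" using ex_antiderivative[OF Gc] by blast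
  have Fc: "continuous_on UNIV F"
    using F by (meson continuous_at_imp_continuous_on has_vector_derivative_continuous)
  define w where "w t = u t - F t" for t
  have mid: "w (dyad m (p + 1)) + w (dyad m (p - 1)) = 2 *\<^sub>R w (dyad m p)" for m p
  proof -
    have "(u (dyad m (p + 1)) + u (dyad m (p - 1)) - 2 *\<^sub>R u (dyad m p)) \<bullet> v
        = (F (dyad m (p + 1)) + F (dyad m (p - 1)) - 2 *\<^sub>R F (dyad m p)) \<bullet> v" for v
    proof -
      have d: "((\<lambda>t. H t \<bullet> v) has_real_derivative H' \<bullet> v) (at t)" if "(H has_vector_derivative H') (at t)" for H H' t
        using bounded_linear.has_vector_derivative[OF bounded_linear_inner_left that, of v]
        by (simp add: has_real_derivative_iff_has_vector_derivative)
      have "has_bochner_integral lborel (\<lambda>t. tent (dyad m p) (1 / 2 ^ m) t * (g t \<bullet> v))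
          ((F (dyad m p + 1 / 2 ^ m) \<bullet> v + F (dyad m p - 1 / 2 ^ m) \<bullet> v - 2 * (F (dyad m p) \<bullet> v)) / (1 / 2 ^ m))"
        using g by (intro tent_second_difference[where G="\<lambda>t. G t \<bullet> v"] d F G continuous_intros) auto
      then have "(LBINT t. tent (dyad m p) (1 / 2 ^ m) t * (g t \<bullet> v)) =
          2 ^ m * (F (dyad m p + 1 / 2 ^ m) \<bullet> v + F (dyad m p - 1 / 2 ^ m) \<bullet> v - 2 * (F (dyad m p) \<bullet> v))"
        by (simp add: has_bochner_integral_iff)
      moreover have "dyad m p + 1 / 2 ^ m = dyad m (p + 1)" "dyad m p - 1 / 2 ^ m = dyad m (p - 1)"
        by (simp_all add: dyad_def add_divide_distrib diff_divide_distrib)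
      ultimately show ?thesis using weak[of m p v] by (simp add: inner_add_left inner_diff_left)
    qed
    then have "u (dyad m (p + 1)) + u (dyad m (p - 1)) - 2 *\<^sub>R u (dyad m p)
        = F (dyad m (p + 1)) + F (dyad m (p - 1)) - 2 *\<^sub>R F (dyad m p)"
      using vector_eq_rdot by blast
    then show ?thesis by (simp add: w_def algebra_simps)
  qed
  have wc: "continuous_on UNIV w" unfolding w_def by (intro continuous_intros u Fc)
  have "u t = F t + (w 0 + t *\<^sub>R (w 1 - w 0))" for t
    using dyadic_midpoint_affine[OF wc mid, of t] by (simp add: w_def algebra_simps)
  then have eq: "u = (\<lambda>t. F t + (w 0 + t *\<^sub>R (w 1 - w 0)))" by blast
  have 1: "(u has_vector_derivative (G t + (w 1 - w 0))) (at t)" for t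
    unfolding eq by (auto intro!: derivative_eq_intros F)
  have 2: "((\<lambda>t. G t + (w 1 - w 0)) has_vector_derivative g t) (at t)" for t
    by (auto intro!: derivative_eq_intros G)
  show ?thesis by (rule exI[of _ "\<lambda>t. G t + (w 1 - w 0)"]) (use 1 2 in blast)
qed

text \<open>Piecewise linear on the grid of level \<open>m\<close>, so interpolation on any finer
  grid is exact and the kinetic form against it becomes stationary.\<close>

definition hat :: "nat \<Rightarrow> int \<Rightarrow> 'a::real_vector \<Rightarrow> real \<Rightarrow> 'a" where
  "hat m p v t = tent (dyad m p) (1 / 2 ^ m) t *\<^sub>R v"

lemma continuous_hat: "continuous_on UNIV (hat m p (v::'a::real_normed_vector))"
  unfolding hat_def by (intro continuous_intros continuous_tent)

text \<open>On the grid of level \<open>n\<close> the hat has constant increments on two blocks of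
  cells and none elsewhere, so the sum telescopes to values of \<open>u\<close> at three points. The
  second assumption puts the support into the window \<open>[-n, n]\<close>.\<close>

lemma kinetic_hat:
  assumes n: "m \<le> n" "\<bar>p\<bar> + 1 \<le> int n * 2 ^ m"
  shows "kinetic n u (hat m p v) = - (2 ^ m * ((u (dyad m (p + 1)) + u (dyad m (p - 1)) - 2 *\<^sub>R u (dyad m p)) \<bullet> v))"
proof -
  \<comment> \<open>The number of cells of level \<open>n\<close> in one cell of level
    \<open>m\<close>.\<close>
  define K :: int where "K = 2 ^ (n - m)"
  have K: "K > 0" by (simp add: K_def)
  have Kn: "2 ^ n = 2 ^ m * real_of_int K" using n by (simp add: K_def flip: power_add)
  have Kn': "2 ^ n = 2 ^ m * K" using n by (simp add: K_def flip: power_add)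
  define S1 S2 I where "S1 = {(p-1)*K..<p*K}" and "S2 = {p*K..<(p+1)*K}" and "I = {- int n * 2 ^ n..<int n * 2 ^ n}"
  have tent: "tent (dyad m p) (1 / 2 ^ m) (dyad n j) = max 0 (1 - \<bar>of_int (j - p * K)\<bar> / of_int K)" for j
  proof -
    have "dyad n j - dyad m p = of_int (j - p * K) / (2 ^ m * of_int K)"
      using K by (simp add: dyad_def Kn field_simps)
    then have "\<bar>dyad n j - dyad m p\<bar> / (1 / 2 ^ m) = \<bar>of_int (j - p * K)\<bar> / of_int K"
      using K by (simp add: abs_mult)
    then show ?thesis by (simp add: tent_def)
  qed
  have hatd: "dyad_diff n (hat m p v) j = (if j \<in> S1 then 1 / of_int K else if j \<in> S2 then - 1 / of_int K else 0) *\<^sub>R v" for j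
  proof -
    have "max 0 (1 - \<bar>of_int (i + 1)\<bar> / of_int K) - max 0 (1 - \<bar>of_int i\<bar> / of_int K) =
      (if - K \<le> i \<and> i < 0 then 1 / of_int K else if 0 \<le> i \<and> i < K then - 1 / of_int K else (0::real))" for i
    proof -
      consider "i < - K" | "- K \<le> i" "i < 0" | "0 \<le> i" "i < K" | "K \<le> i" by linarith
      then show ?thesis
      proof cases
        case 1
        then have "real_of_int i + 1 \<le> - of_int K" "real_of_int i \<le> - of_int K" by linarith+
        then have "1 - \<bar>real_of_int (i + 1)\<bar> / of_int K \<le> 0" "1 - \<bar>real_of_int i\<bar> / of_int K \<le> 0"
          using K by (auto simp: field_simps)
        then show ?thesis using 1 K by simp
      next
        case 2
        then have "real_of_int i + 1 \<le> 0" "- of_int K \<le> real_of_int i" by linarith+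
        then have "max 0 (1 - \<bar>real_of_int (i + 1)\<bar> / of_int K) = 1 + (of_int i + 1) / of_int K"
            "max 0 (1 - \<bar>real_of_int i\<bar> / of_int K) = 1 + of_int i / of_int K"
          using K by (auto simp: field_simps)
        then show ?thesis using 2 by (simp add: add_divide_distrib)
      next
        case 3
        then have "real_of_int i + 1 \<le> of_int K" "0 \<le> real_of_int i" by linarith+
        then have "max 0 (1 - \<bar>real_of_int (i + 1)\<bar> / of_int K) = 1 - (of_int i + 1) / of_int K"
            "max 0 (1 - \<bar>real_of_int i\<bar> / of_int K) = 1 - of_int i / of_int K"
          using K by (auto simp: field_simps)
        then show ?thesis using 3 by (simp add: add_divide_distrib)
      next
        case 4
        then have "of_int K \<le> real_of_int i" by linarith
        then have "1 - \<bar>real_of_int (i + 1)\<bar> / of_int K \<le> 0" "1 - \<bar>real_of_int i\<bar> / of_int K \<le> 0"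
          using K by (auto simp: field_simps)
        then show ?thesis using 4 K by simp
      qed
    qed
    from this[of "j - p * K"] have "tent (dyad m p) (1 / 2 ^ m) (dyad n (j + 1)) - tent (dyad m p) (1 / 2 ^ m) (dyad n j) =
      (if j \<in> S1 then 1 / of_int K else if j \<in> S2 then - 1 / of_int K else 0)"
      unfolding tent by (simp add: S1_def S2_def algebra_simps)
    then show ?thesis by (simp add: dyad_diff_def hat_def flip: scaleR_diff_left)
  qed
  have sub: "S1 \<union> S2 \<subseteq> I"
  proof -
    have "- (int n * 2 ^ m) \<le> p - 1" "p + 1 \<le> int n * 2 ^ m" using n(2) by linarith+
    then have "- (int n * 2 ^ m) * K \<le> (p - 1) * K" "(p + 1) * K \<le> int n * 2 ^ m * K"
      using K by (intro mult_right_mono; simp)+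
    moreover have "(p - 1) * K \<le> p * K" "p * K \<le> (p + 1) * K" using K by (simp_all add: algebra_simps)
    ultimately show ?thesis unfolding S1_def S2_def I_def Kn' by (auto simp: mult.assoc)
  qed
  have dyK: "dyad n (q * K) = dyad m q" for q using K by (simp add: dyad_def Kn)
  have pre: "2 ^ n * (1 / of_int K) = (2 ^ m :: real)" using K by (simp add: Kn)
  have "kinetic n u (hat m p v) = (\<Sum>j\<in>S1 \<union> S2. 2 ^ n * (dyad_diff n u j \<bullet> dyad_diff n (hat m p v) j))"
    unfolding kinetic_def I_def[symmetric] using sub
    by (intro sum.mono_neutral_right) (auto simp: hatd I_def)
  also have "\<dots> = (\<Sum>j\<in>S1. 2 ^ n * (dyad_diff n u j \<bullet> dyad_diff n (hat m p v) j)) +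
      (\<Sum>j\<in>S2. 2 ^ n * (dyad_diff n u j \<bullet> dyad_diff n (hat m p v) j))"
    by (intro sum.union_disjoint) (auto simp: S1_def S2_def)
  also have "(\<Sum>j\<in>S1. 2 ^ n * (dyad_diff n u j \<bullet> dyad_diff n (hat m p v) j)) = (\<Sum>j\<in>S1. 2 ^ m * (dyad_diff n u j \<bullet> v))"
    unfolding pre[symmetric] by (intro sum.cong) (auto simp: hatd)
  also have "\<dots> = 2 ^ m * ((u (dyad m p) - u (dyad m (p-1))) \<bullet> v)"
    unfolding dyK[symmetric] using K by (subst sum_dyad_diff[symmetric]) (auto simp: S1_def inner_sum_left sum_distrib_left)
  also have "(\<Sum>j\<in>S2. 2 ^ n * (dyad_diff n u j \<bullet> dyad_diff n (hat m p v) j)) = (\<Sum>j\<in>S2. - (2 ^ m * (dyad_diff n u j \<bullet> v)))"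
    unfolding pre[symmetric] by (intro sum.cong) (auto simp: hatd S1_def S2_def)
  also have "\<dots> = - (2 ^ m * ((u (dyad m (p+1)) - u (dyad m p)) \<bullet> v))"
    unfolding dyK[symmetric] using K by (subst sum_dyad_diff[symmetric]) (auto simp: S2_def inner_sum_left sum_distrib_left sum_negf)
  finally show ?thesis by (simp add: inner_add_left inner_diff_left algebra_simps)
qed

section \<open>The form tested with hats\<close>

context schroedinger_form
begin

lemma potential_hat:
  assumes n: "\<bar>p\<bar> + 1 \<le> int n * 2 ^ m" and u: "continuous_on UNIV u"
  shows "potential n u (hat m p v) = (LBINT t. tent (dyad m p) (1 / 2 ^ m) t * (A t (u t) \<bullet> v))"
proof -
  have "indicator {- real n..real n} t * tent (dyad m p) (1 / 2 ^ m) t = tent (dyad m p) (1 / 2 ^ m) t" for t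
  proof (cases "t \<in> {- real n..real n}")
    case False
    have "real_of_int (\<bar>p\<bar> + 1) \<le> real_of_int (int n * 2 ^ m)" using n by (simp only: of_int_le_iff)
    then have "\<bar>dyad m p\<bar> + 1 / 2 ^ m \<le> n"
      by (simp add: dyad_def field_simps)
    then have "\<bar>t - dyad m p\<bar> \<ge> 1 / 2 ^ m" using False by auto
    then show ?thesis by (simp add: tent_outside)
  qed simp
  then have "indicator {- real n..real n} t * (A t (u t) \<bullet> hat m p v t) = tent (dyad m p) (1 / 2 ^ m) t * (A t (u t) \<bullet> v)" for t
    by (simp add: hat_def) (metis mult.assoc)
  then show ?thesis by (simp add: potential_def)
qed

lemma trunc_hat:
  assumes n: "m \<le> n" "\<bar>p\<bar> + 1 \<le> int n * 2 ^ m" and u: "continuous_on UNIV u"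
  shows "trunc n u (hat m p v) = - (2 ^ m * ((u (dyad m (p + 1)) + u (dyad m (p - 1)) - 2 *\<^sub>R u (dyad m p)) \<bullet> v))
    + (LBINT t. tent (dyad m p) (1 / 2 ^ m) t * (A t (u t) \<bullet> v))"
  using kinetic_hat[OF n] potential_hat[OF n(2) u] by (simp add: trunc_def)

lemma ex_large: "\<exists>N. \<forall>n\<ge>N. m \<le> n \<and> \<bar>p\<bar> + 1 \<le> int n * 2 ^ m"
proof (intro exI allI impI conjI)
  fix n assume n: "max m (nat (\<bar>p\<bar> + 1)) \<le> n"
  then show "m \<le> n" by simp
  have "\<bar>p\<bar> + 1 \<le> int n" using n by linarith
  also have "\<dots> \<le> int n * 2 ^ m" by (simp add: mult_le_cancel_left1)
  finally show "\<bar>p\<bar> + 1 \<le> int n * 2 ^ m" .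
qed

text \<open>The truncations agree from some level on and increase before it, hence they are
  bounded.\<close>

lemma hat_dom: "hat m p v \<in> Dom"
proof -
  obtain N where N: "\<And>n. n \<ge> N \<Longrightarrow> m \<le> n \<and> \<bar>p\<bar> + 1 \<le> int n * 2 ^ m" using ex_large by blast
  have c: "continuous_on UNIV (hat m p v)" by (rule continuous_hat)
  have eq: "trunc n (hat m p v) (hat m p v) = trunc N (hat m p v) (hat m p v)" if "n \<ge> N" for n
    using N[OF that] N[of N] trunc_hat[OF _ _ c] by simp
  have "trunc n (hat m p v) (hat m p v) \<le> trunc N (hat m p v) (hat m p v)" for n
    using eq[of n] F.incseq_form[of "hat m p v"] c by (cases "n \<ge> N") (auto simp: incseq_def)
  then show ?thesis using c unfolding F.dom_def by blast
qed

text \<open>The limit of a sequence that is constant from some \<open>n\<close> on. No derivative of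
  \<open>u\<close> occurs, which lets weak equations be read off from point values.\<close>

lemma form_hat:
  assumes u: "u \<in> Dom"
  shows "a u (hat m p v) = - (2 ^ m * ((u (dyad m (p + 1)) + u (dyad m (p - 1)) - 2 *\<^sub>R u (dyad m p)) \<bullet> v))
    + (LBINT t. tent (dyad m p) (1 / 2 ^ m) t * (A t (u t) \<bullet> v))"
proof (rule LIMSEQ_unique[OF F.tendsto_lim_form[OF u hat_dom]])
  obtain N where N: "\<And>n. n \<ge> N \<Longrightarrow> m \<le> n \<and> \<bar>p\<bar> + 1 \<le> int n * 2 ^ m" using ex_large by blast
  show "(\<lambda>n. trunc n u (hat m p v)) \<longlonglongrightarrow> - (2 ^ m * ((u (dyad m (p + 1)) + u (dyad m (p - 1)) - 2 *\<^sub>R u (dyad m p)) \<bullet> v))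
    + (LBINT t. tent (dyad m p) (1 / 2 ^ m) t * (A t (u t) \<bullet> v))"
  proof (rule tendsto_eventually, unfold eventually_sequentially, intro exI allI impI)
    fix n assume "N \<le> n"
    then show "trunc n u (hat m p v) = - (2 ^ m * ((u (dyad m (p + 1)) + u (dyad m (p - 1)) - 2 *\<^sub>R u (dyad m p)) \<bullet> v))
      + (LBINT t. tent (dyad m p) (1 / 2 ^ m) t * (A t (u t) \<bullet> v))"
      using N[of n] by (intro trunc_hat dom_cont u) auto
  qed
qed

lemma tent_integrable:
  assumes f: "continuous_on UNIV f" and h: "h > 0"
  shows "integrable lborel (\<lambda>t. tent c h t * f t)"
proof -
  have "tent c h t * f t = indicator {c - h..c + h} t * (tent c h t * f t)" for t
    using tent_outside[OF h, of t c] by (cases "t \<in> {c - h..c + h}") auto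
  moreover have "integrable lborel (\<lambda>t. indicator {c - h..c + h} t * (tent c h t * f t))"
    by (intro integrable_on_interval continuous_intros continuous_tent f)
  ultimately show ?thesis by presburger
qed

lemma l2_hat_pos:
  assumes v: "v \<noteq> 0"
  shows "0 < l2 (hat m p v) (hat m p v)"
proof -
  define h where "h = (1 / 2 ^ m :: real)"
  have h: "h > 0" by (simp add: h_def)
  define c where "c = dyad m p"
  have i1: "integrable lborel (\<lambda>t. indicator {c..c + h / 2} t * (v \<bullet> v / 4))"
    by (simp add: integrable_indicator_Icc)
  have "(LBINT t. indicator {c..c + h / 2} t * (v \<bullet> v / 4)) \<le> l2 (hat m p v) (hat m p v)"
    unfolding l2_def
  proof (rule integral_mono[OF i1 dom_square(1)[OF hat_dom]])
    fix t
    show "indicator {c..c + h / 2} t * (v \<bullet> v / 4) \<le> hat m p v t \<bullet> hat m p v t"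
    proof (cases "t \<in> {c..c + h / 2}")
      case True
      then have "1 / 2 \<le> tent c h t" using h by (auto simp: tent_def field_simps)
      then have "1 / 2 * (1 / 2) \<le> tent c h t * tent c h t" by (intro mult_mono) auto
      then have "1 / 4 * (v \<bullet> v) \<le> tent c h t * tent c h t * (v \<bullet> v)" by (intro mult_right_mono) auto
      then show ?thesis using True by (simp add: hat_def c_def[symmetric] h_def[symmetric] mult.assoc)
    qed simp
  qed
  moreover have "(LBINT t. indicator {c..c + h / 2} t * (v \<bullet> v / 4)) = h / 2 * (v \<bullet> v / 4)" using h by simp
  moreover have "h / 2 * (v \<bullet> v / 4) > 0" using h v by simp
  ultimately show ?thesis by linarith
qed

sublocale compact_form_pair Dom a l2
proof (intro compact_form_pair.intro compact_form_pair_axioms.intro)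
  show "psd_form Dom a" by (rule F.psd_form_axioms)
  show "psd_form Dom l2" by (rule psd_form_l2)
  show "l2 u u \<le> a u u" if "u \<in> Dom" for u using dom_square[OF that] by (simp add: l2_def)
  show "\<exists>r u. strict_mono r \<and> u \<in> Dom \<and> (\<lambda>j. l2 (U (r j) - u) (U (r j) - u)) \<longlonglongrightarrow> 0 \<and>
        (\<forall>c. (\<forall>\<^sub>F j in sequentially. a (U j) (U j) \<le> c) \<longrightarrow> a u u \<le> c)"
    if U: "\<And>j. U j \<in> Dom" "\<And>j. a (U j) (U j) \<le> C" for U :: "nat \<Rightarrow> real \<Rightarrow> 'a" and C
  proof (rule dom_compact[of U C, OF U], goal_cases)
    case (1 r u)
    then show ?case by (intro exI[of _ r] exI[of _ u]) simp
  qed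
  show "\<exists>f::nat\<Rightarrow>real\<Rightarrow>'a. \<forall>i j. f i \<in> Dom \<and> l2 (f i) (f j) = (if i = j then 1 else 0)"
  proof -
    interpret H: psd_form Dom l2 by (rule psd_form_l2)
    define v :: 'a where "v = (SOME i. i \<in> Basis)"
    have v: "v \<noteq> 0" unfolding v_def by (rule nonzero_Basis[OF SOME_Basis])
    \<comment> \<open>Tents of half-width 1 centred at multiples of 3 have disjoint
      supports.\<close>
    define \<phi> where "\<phi> i = hat 0 (3 * int i) v" for i :: nat
    have \<phi>: "\<phi> i \<in> Dom" for i by (simp add: \<phi>_def hat_dom)
    have pos: "l2 (\<phi> i) (\<phi> i) > 0" for i unfolding \<phi>_def by (rule l2_hat_pos[OF v])
    have orth: "l2 (\<phi> i) (\<phi> j) = 0" if "i \<noteq> j" for i j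
    proof -
      have "tent (real_of_int (3 * int i)) 1 t * tent (real_of_int (3 * int j)) 1 t = 0" for t
      proof -
        have "\<bar>real_of_int (3 * int i) - real_of_int (3 * int j)\<bar> \<ge> 3"
          using that by linarith
        then have "\<bar>t - real_of_int (3 * int i)\<bar> \<ge> 1 \<or> \<bar>t - real_of_int (3 * int j)\<bar> \<ge> 1" by linarith
        then show ?thesis using tent_outside[of 1] by auto
      qed
      then have "\<phi> i t \<bullet> \<phi> j t = 0" for t by (auto simp: \<phi>_def hat_def dyad_def)
      then show ?thesis by (simp add: l2_def)
    qed
    define f where "f i = (1 / sqrt (l2 (\<phi> i) (\<phi> i))) *\<^sub>R \<phi> i" for i
    have f: "f i \<in> Dom" for i unfolding f_def by (rule H.mem(3)[OF \<phi>])
    have ff: "l2 (f i) (f j) = 1 / sqrt (l2 (\<phi> i) (\<phi> i)) * (1 / sqrt (l2 (\<phi> j) (\<phi> j)) * l2 (\<phi> i) (\<phi> j))" for i j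
      unfolding f_def by (simp only: H.scale[OF \<phi> H.mem(3)[OF \<phi>]] H.scale2[OF \<phi> \<phi>])
    have "l2 (f i) (f j) = (if i = j then 1 else 0)" for i j
      using orth[of i j] pos[of i] unfolding ff by (cases "i = j") simp_all
    then show ?thesis using f by (intro exI[of _ f] allI conjI)
  qed
qed

end

section \<open>The eigenvalue problem\<close>

text \<open>An integrable function need not tend to 0, but its sum over both ends cannot stay above
  \<open>\<epsilon>\<close> from \<open>R0\<close> on. Both ends are treated at the same
  \<open>R\<close> because the intervals and tents used later are symmetric.\<close>

lemma integrable_small_ends:
  fixes f :: "real \<Rightarrow> real"
  assumes f: "integrable lborel f" and nn: "\<And>t. 0 \<le> f t" and e: "\<epsilon> > 0"
  shows "\<exists>R\<ge>R0. f R + f (- R) < \<epsilon>"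
proof (rule ccontr)
  assume "\<not> ?thesis"
  then have ge: "\<epsilon> \<le> f t + f (- t)" if "t \<ge> R0" for t using that by force
  define I where "I = (LBINT t. f t + f (- t))"
  have i: "integrable lborel (\<lambda>t. f t + f (- t))"
    using lborel_integrable_real_affine[OF f, of "-1" 0] f by simp
  have "n * \<epsilon> \<le> I" for n :: nat
  proof -
    have "n * \<epsilon> = (LBINT t. indicator {R0..R0 + real n} t * \<epsilon>)" by simp
    also have "\<dots> \<le> I"
      unfolding I_def
    proof (rule integral_mono[OF _ i])
      show "integrable lborel (\<lambda>t. indicator {R0..R0 + real n} t * \<epsilon>)" by (simp add: integrable_indicator_Icc)
      show "indicator {R0..R0 + real n} t * \<epsilon> \<le> f t + f (- t)" for t
        using ge[of t] nn[of t] nn[of "- t"] by (simp add: indicator_def)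
    qed
    finally show ?thesis .
  qed
  moreover obtain n :: nat where "I / \<epsilon> < n" using reals_Archimedean2 by blast
  ultimately show False using e by (simp add: field_simps not_le[symmetric])
qed

lemma inner_has_real_derivative:
  fixes u v :: "real \<Rightarrow> 'a::real_inner"
  assumes "(u has_vector_derivative u') (at t)" "(v has_vector_derivative v') (at t)"
  shows "((\<lambda>t. u t \<bullet> v t) has_real_derivative (u t \<bullet> v' + u' \<bullet> v t)) (at t)"
  using bounded_bilinear.has_vector_derivative[OF bounded_bilinear_inner assms]
  by (simp add: has_real_derivative_iff_has_vector_derivative)

lemma has_vector_derivative_continuous_on_UNIV:
  "(\<And>t. (u has_vector_derivative u' t) (at t)) \<Longrightarrow> continuous_on UNIV u"
  by (meson continuous_at_imp_continuous_on has_vector_derivative_continuous)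

lemma interval_integral_tendsto:
  fixes f :: "real \<Rightarrow> real"
  assumes f: "integrable lborel f" and R: "\<And>n. R n \<ge> real n"
  shows "(\<lambda>n. LBINT t. indicator {- R n..R n} t * f t) \<longlonglongrightarrow> (LBINT t. f t)"
proof (rule integral_dominated_convergence[where w="\<lambda>t. \<bar>f t\<bar>"])
  show "integrable lborel (\<lambda>t. \<bar>f t\<bar>)" by (rule integrable_abs[OF f])
  show "AE t in lborel. norm (indicator {- R n..R n} t * f t) \<le> \<bar>f t\<bar>" for n
    by (rule AE_I2) (simp add: indicator_def)
  show "f \<in> borel_measurable lborel" by (rule borel_measurable_integrable[OF f])
  show "(\<lambda>t. indicator {- R n..R n} t * f t) \<in> borel_measurable lborel" for n
    by (rule borel_measurable_integrable[OF integrable_indicator_times[OF _ f]]) simp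
  show "AE t in lborel. (\<lambda>n. indicator {- R n..R n} t * f t) \<longlonglongrightarrow> f t"
  proof (rule AE_I2, rule tendsto_eventually)
    fix t
    obtain N :: nat where N: "\<bar>t\<bar> \<le> real N" using real_arch_simple[of "\<bar>t\<bar>"] by auto
    show "\<forall>\<^sub>F n in sequentially. indicator {- R n..R n} t * f t = f t"
      unfolding eventually_sequentially
    proof (intro exI allI impI)
      fix n assume "N \<le> n"
      then have "\<bar>t\<bar> \<le> R n" using N R[of n] by linarith
      then show "indicator {- R n..R n} t * f t = f t" by (simp add: indicator_def abs_le_iff)
    qed
  qed
qed

section \<open>Weak and classical eigenfunctions\<close>

context schroedinger_form
begin

definition eigen_ode :: "real \<Rightarrow> (real \<Rightarrow> 'a) \<Rightarrow> (real \<Rightarrow> 'a) \<Rightarrow> bool" where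
  "eigen_ode \<mu> u u' \<longleftrightarrow> (\<forall>t. (u has_vector_derivative u' t) (at t) \<and>
     (u' has_vector_derivative (A t (u t) - \<mu> *\<^sub>R u t)) (at t))"

lemma classical_solution:
  assumes u: "u \<in> Dom" and f: "continuous_on UNIV f"
    and weak: "\<And>m p v. a u (hat m p v) = (LBINT t. tent (dyad m p) (1 / 2 ^ m) t * (f t \<bullet> v))"
  shows "\<exists>u'. \<forall>t. (u has_vector_derivative u' t) (at t) \<and> (u' has_vector_derivative (A t (u t) - f t)) (at t)"
proof (rule weak_imp_classical)
  show "continuous_on UNIV u" by (rule dom_cont[OF u])
  show "continuous_on UNIV (\<lambda>t. A t (u t) - f t)" by (intro continuous_intros continuous_A dom_cont u f)
  fix m p v
  have "(LBINT t. tent (dyad m p) (1 / 2 ^ m) t * ((A t (u t) - f t) \<bullet> v)) =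
    (LBINT t. tent (dyad m p) (1 / 2 ^ m) t * (A t (u t) \<bullet> v) - tent (dyad m p) (1 / 2 ^ m) t * (f t \<bullet> v))"
    by (simp add: inner_diff_left right_diff_distrib)
  also have "\<dots> = (LBINT t. tent (dyad m p) (1 / 2 ^ m) t * (A t (u t) \<bullet> v)) - (LBINT t. tent (dyad m p) (1 / 2 ^ m) t * (f t \<bullet> v))"
    by (intro Bochner_Integration.integral_diff tent_integrable continuous_intros continuous_A dom_cont u f) auto
  finally show "2 ^ m * ((u (dyad m (p + 1)) + u (dyad m (p - 1)) - 2 *\<^sub>R u (dyad m p)) \<bullet> v) =
      (LBINT t. tent (dyad m p) (1 / 2 ^ m) t * ((A t (u t) - f t) \<bullet> v))"
    using form_hat[OF u, of m p v] weak[of m p v] by simp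
qed

lemma l2_hat: "l2 u (hat m p v) = (LBINT t. tent (dyad m p) (1 / 2 ^ m) t * (u t \<bullet> v))"
  by (simp add: l2_def hat_def)

lemma eigen_ode_of_weak:
  assumes u: "u \<in> Dom" and eig: "\<And>v. v \<in> Dom \<Longrightarrow> a u v = \<mu> * l2 u v"
  shows "\<exists>u'. eigen_ode \<mu> u u'"
  unfolding eigen_ode_def
proof (rule classical_solution[OF u])
  show "continuous_on UNIV (\<lambda>t. \<mu> *\<^sub>R u t)" by (intro continuous_intros dom_cont u)
  show "a u (hat m p v) = (LBINT t. tent (dyad m p) (1 / 2 ^ m) t * (\<mu> *\<^sub>R u t \<bullet> v))" for m p v
    by (simp add: eig[OF hat_dom] l2_hat mult.left_commute)
qed

text \<open>Test \<open>(\<bar>u\<bar>\<^sup>2)'' \<ge> 2 \<bar>u'\<bar>\<^sup>2 - 2 \<bar>\<mu>\<bar> \<bar>u\<bar>\<^sup>2\<close> with wide tents.\<close>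

lemma eigen_ode_derivative_square_integrable:
  assumes ode: "eigen_ode \<mu> u u'" and sq: "integrable lborel (\<lambda>t. u t \<bullet> u t)"
  shows "integrable lborel (\<lambda>t. u' t \<bullet> u' t)"
proof -
  have d: "\<And>t. (u has_vector_derivative u' t) (at t)"
    and d2: "\<And>t. (u' has_vector_derivative (A t (u t) - \<mu> *\<^sub>R u t)) (at t)"
    using ode by (auto simp: eigen_ode_def)
  note cu = has_vector_derivative_continuous_on_UNIV[OF d] and cu' = has_vector_derivative_continuous_on_UNIV[OF d2]
  \<comment> \<open>The second derivative of \<open>|u|^2\<close> along the equation.\<close>
  define q where "q t = 2 * (u' t \<bullet> u' t + u t \<bullet> (A t (u t) - \<mu> *\<^sub>R u t))" for t
  define I where "I = (LBINT t. u t \<bullet> u t)"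
  have c1: "continuous_on UNIV (\<lambda>t. u' t \<bullet> u' t)" by (intro continuous_intros cu')
  have bound: "(LBINT t. indicator {- real n..real n} t * (u' t \<bullet> u' t)) \<le> 1 + 2 * \<bar>\<mu>\<bar> * I" for n :: nat
  proof -
    \<comment> \<open>\<open>R >= 2 n + 1\<close> makes the tent at least 1/2 on
      \<open>[-n, n]\<close>; in addition the boundary values in the second difference stay below
      1.\<close>
    obtain R where R: "R \<ge> 2 * real n + 1" and small: "u R \<bullet> u R + u (- R) \<bullet> u (- R) < 1"
      using integrable_small_ends[OF sq, of 1 "2 * real n + 1"] by auto
    have R1: "R \<ge> 1" using R by simp
    have h: "has_bochner_integral lborel (\<lambda>t. tent 0 R t * q t)
        ((u (0 + R) \<bullet> u (0 + R) + u (0 - R) \<bullet> u (0 - R) - 2 * (u 0 \<bullet> u 0)) / R)"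
    proof (rule tent_second_difference[where G="\<lambda>t. 2 * (u t \<bullet> u' t)"])
      show "((\<lambda>t. u t \<bullet> u t) has_real_derivative 2 * (u t \<bullet> u' t)) (at t)" for t
        using inner_has_real_derivative[OF d d, of t] by (simp add: inner_commute)
      show "((\<lambda>t. 2 * (u t \<bullet> u' t)) has_real_derivative q t) (at t)" for t
        unfolding q_def using DERIV_cmult[OF inner_has_real_derivative[OF d d2], of 2 t] by (simp add: add.commute)
      show "continuous_on UNIV q" unfolding q_def by (intro continuous_intros cu cu' continuous_A)
    qed (use R1 in simp)
    have i1: "integrable lborel (\<lambda>t. indicator {- real n..real n} t * (u' t \<bullet> u' t))"
      by (rule integrable_on_interval[OF c1])
    have "(LBINT t. indicator {- real n..real n} t * (u' t \<bullet> u' t)) \<le> (LBINT t. tent 0 R t * q t + 2 * \<bar>\<mu>\<bar> * (u t \<bullet> u t))"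
    proof (rule integral_mono[OF i1])
      show "integrable lborel (\<lambda>t. tent 0 R t * q t + 2 * \<bar>\<mu>\<bar> * (u t \<bullet> u t))"
        using h sq by (auto simp: has_bochner_integral_iff)
      fix t
      have T: "0 \<le> tent 0 R t" "tent 0 R t \<le> 1" using R1 by (simp_all add: tent_nonneg tent_le_1)
      have "\<mu> * (u t \<bullet> u t) \<le> \<bar>\<mu>\<bar> * (u t \<bullet> u t)" by (intro mult_right_mono) auto
      then have "2 * (u' t \<bullet> u' t) - 2 * \<bar>\<mu>\<bar> * (u t \<bullet> u t) \<le> q t"
        using A_nonneg[of t "u t"] by (simp add: q_def inner_diff_right inner_commute)
      then have "tent 0 R t * (2 * (u' t \<bullet> u' t) - 2 * \<bar>\<mu>\<bar> * (u t \<bullet> u t)) \<le> tent 0 R t * q t"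
        using T by (intro mult_left_mono)
      moreover have "tent 0 R t * (2 * \<bar>\<mu>\<bar> * (u t \<bullet> u t)) \<le> 1 * (2 * \<bar>\<mu>\<bar> * (u t \<bullet> u t))"
        using T by (intro mult_right_mono) auto
      moreover have "indicator {- real n..real n} t * (u' t \<bullet> u' t) \<le> tent 0 R t * (2 * (u' t \<bullet> u' t))"
      proof (cases "t \<in> {- real n..real n}")
        case True
        then have "1 / 2 \<le> tent 0 R t" using R R1 by (auto simp: tent_def field_simps)
        then have "1 / 2 * (2 * (u' t \<bullet> u' t)) \<le> tent 0 R t * (2 * (u' t \<bullet> u' t))" by (intro mult_right_mono) auto
        then show ?thesis using True by simp
      qed (use T in simp)
      ultimately show "indicator {- real n..real n} t * (u' t \<bullet> u' t) \<le> tent 0 R t * q t + 2 * \<bar>\<mu>\<bar> * (u t \<bullet> u t)"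
        by (simp add: right_diff_distrib)
    qed
    also have "\<dots> = (u R \<bullet> u R + u (- R) \<bullet> u (- R) - 2 * (u 0 \<bullet> u 0)) / R + 2 * \<bar>\<mu>\<bar> * I"
      using h sq by (subst Bochner_Integration.integral_add) (auto simp: has_bochner_integral_iff I_def)
    also have "(u R \<bullet> u R + u (- R) \<bullet> u (- R) - 2 * (u 0 \<bullet> u 0)) / R \<le> 1"
    proof -
      have "u R \<bullet> u R + u (- R) \<bullet> u (- R) - 2 * (u 0 \<bullet> u 0) \<le> R"
        using small R1 inner_ge_zero[of "u 0"] by linarith
      then show ?thesis using R1 by simp
    qed
    finally show ?thesis by simp
  qed
  show ?thesis by (rule integrable_bounded_intervals(1)[OF c1 _ bound]) simp
qed

text \<open>The Wronskian \<open>z = w' \<bullet> u - w \<bullet> u'\<close> is integrable, hence tends to 0 along suitable ends.\<close>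

lemma eigen_ode_orthogonal:
  assumes u: "eigen_ode \<mu> u u'" "integrable lborel (\<lambda>t. u t \<bullet> u t)"
    and w: "eigen_ode \<nu> w w'" "integrable lborel (\<lambda>t. w t \<bullet> w t)" and ne: "\<mu> \<noteq> \<nu>"
  shows "(LBINT t. w t \<bullet> u t) = 0"
proof -
  have d: "\<And>t. (u has_vector_derivative u' t) (at t)"
    and d2: "\<And>t. (u' has_vector_derivative (A t (u t) - \<mu> *\<^sub>R u t)) (at t)"
    using u by (auto simp: eigen_ode_def)
  have k: "\<And>t. (w has_vector_derivative w' t) (at t)"
    and k2: "\<And>t. (w' has_vector_derivative (A t (w t) - \<nu> *\<^sub>R w t)) (at t)"
    using w by (auto simp: eigen_ode_def)
  note cu = has_vector_derivative_continuous_on_UNIV[OF d] and cw = has_vector_derivative_continuous_on_UNIV[OF k]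
  \<comment> \<open>\<open>f\<close> dominates the Wronskian and is integrable because the
    derivatives are square integrable too; the ends \<open>R n\<close> are chosen where
    \<open>f\<close> is small.\<close>
  define f where "f t = u t \<bullet> u t + u' t \<bullet> u' t + w t \<bullet> w t + w' t \<bullet> w' t" for t
  have f: "integrable lborel f" unfolding f_def
    using eigen_ode_derivative_square_integrable[OF u] eigen_ode_derivative_square_integrable[OF w] u w by simp
  have f0: "0 \<le> f t" for t by (simp add: f_def)
  have ex: "\<forall>n. \<exists>R. R \<ge> real n \<and> f R + f (- R) < inverse (real (Suc n))"
    using integrable_small_ends[OF f f0] by simp
  obtain R where R': "\<forall>n. R n \<ge> real n \<and> f (R n) + f (- R n) < inverse (real (Suc n))"
    using choice[OF ex] by (rule exE)
  have R: "R n \<ge> real n" "f (R n) + f (- R n) < inverse (real (Suc n))" for n using R' by simp_all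
  have R0: "R n \<ge> 0" for n using R(1)[of n] by simp
  have i: "integrable lborel (\<lambda>t. w t \<bullet> u t)"
  proof (rule integrable_inner_of_squares[OF _ _ w(2) u(2)])
    show "w \<in> borel_measurable lborel" using borel_measurable_continuous_onI[OF cw] by simp
    show "u \<in> borel_measurable lborel" using borel_measurable_continuous_onI[OF cu] by simp
  qed
  define z where "z t = w' t \<bullet> u t - w t \<bullet> u' t" for t
  have z: "(z has_real_derivative (\<mu> - \<nu>) * (w t \<bullet> u t)) (at t)" for t
  proof -
    have "(z has_real_derivative ((w' t \<bullet> u' t + (A t (w t) - \<nu> *\<^sub>R w t) \<bullet> u t) -
        (w t \<bullet> (A t (u t) - \<mu> *\<^sub>R u t) + w' t \<bullet> u' t))) (at t)"
      unfolding z_def by (intro DERIV_diff inner_has_real_derivative d d2 k k2)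
    then show ?thesis using sym_A[of t "w t" "u t"]
      by (simp add: inner_diff_left inner_diff_right inner_commute algebra_simps)
  qed
  have zf: "\<bar>z t\<bar> \<le> f t" for t
    using abs_inner_le_squares[of "w' t" "u t"] abs_inner_le_squares[of "w t" "u' t"]
    unfolding z_def f_def by linarith
  have ftc: "(LBINT t. indicator {- R n..R n} t * (w t \<bullet> u t)) * (\<mu> - \<nu>) = z (R n) - z (- R n)" for n
  proof -
    have "(LBINT t. ((\<mu> - \<nu>) * (w t \<bullet> u t)) * indicator {- R n..R n} t) = z (R n) - z (- R n)"
    proof (rule integral_FTC_Icc_real)
      show "isCont (\<lambda>t. (\<mu> - \<nu>) * (w t \<bullet> u t)) t" for t
        using cu cw by (intro continuous_intros) (auto simp: continuous_on_eq_continuous_at)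
    qed (use z R0[of n] in auto)
    also have "(LBINT t. ((\<mu> - \<nu>) * (w t \<bullet> u t)) * indicator {- R n..R n} t) =
        (LBINT t. (indicator {- R n..R n} t * (w t \<bullet> u t)) * (\<mu> - \<nu>))"
      by (simp add: ac_simps)
    finally show ?thesis by simp
  qed
  have "(\<lambda>n. z (R n) - z (- R n)) \<longlonglongrightarrow> 0"
  proof (rule Lim_null_comparison[OF always_eventually LIMSEQ_inverse_real_of_nat], rule allI)
    fix n
    show "norm (z (R n) - z (- R n)) \<le> inverse (real (Suc n))"
      using zf[of "R n"] zf[of "- R n"] R(2)[of n] by simp
  qed
  moreover have "(\<lambda>n. z (R n) - z (- R n)) \<longlonglongrightarrow> (LBINT t. w t \<bullet> u t) * (\<mu> - \<nu>)"
    unfolding ftc[symmetric] by (intro tendsto_mult_right interval_integral_tendsto[OF i R(1)])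
  ultimately have "(LBINT t. w t \<bullet> u t) * (\<mu> - \<nu>) = 0" by (rule LIMSEQ_unique[symmetric])
  then show ?thesis using ne by simp
qed

text \<open>A classical eigenfunction, or the gradient of \<open>W\<close> composed with a function,
  is not known to lie in \<open>Dom\<close>; bilinearity and Cauchy-Schwarz for \<open>l2\<close>
  are needed for these as well.\<close>

lemma psd_form_l2_all:
  "psd_form {f. f \<in> borel_measurable lborel \<and> integrable lborel (\<lambda>t. f t \<bullet> f t)} l2"
proof -
  define S where "S = {f :: real \<Rightarrow> 'a. f \<in> borel_measurable lborel \<and> integrable lborel (\<lambda>t. f t \<bullet> f t)}"
  have i: "integrable lborel (\<lambda>t. u t \<bullet> v t)" if "u \<in> S" "v \<in> S" for u v
    by (rule integrable_inner_of_squares) (use that in \<open>simp_all add: S_def\<close>)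
  have "subspace S"
    unfolding subspace_def
  proof (intro conjI ballI allI)
    show "0 \<in> S" by (simp add: S_def zero_fun_def)
    fix u v assume uv: "u \<in> S" "v \<in> S"
    have "u + v \<in> borel_measurable lborel"
      unfolding plus_fun_def by (rule borel_measurable_add) (use uv in \<open>simp_all add: S_def\<close>)
    then show "u + v \<in> S" using i[OF uv] i[OF uv(2,1)] uv
      by (simp add: S_def inner_add)
  next
    fix r u assume u: "u \<in> S"
    have "r *\<^sub>R u \<in> borel_measurable lborel"
      unfolding scaleR_fun_def by (rule borel_measurable_scaleR[OF borel_measurable_const]) (use u in \<open>simp add: S_def\<close>)
    then show "r *\<^sub>R u \<in> S" using u by (simp add: S_def)
  qed
  then have "psd_form S l2"
    by unfold_locales (auto simp: l2_def inner_commute inner_add_right i)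
  then show ?thesis by (simp add: S_def)
qed

text \<open>Orthogonality to all hats makes \<open>u\<close> the second derivative of the zero function.\<close>

lemma orthogonal_hats_imp_zero:
  assumes u: "continuous_on UNIV u" and orth: "\<And>m p v. l2 u (hat m p v) = 0"
  shows "u t = 0"
proof -
  have "\<exists>u'. \<forall>t. ((\<lambda>t. 0) has_vector_derivative u' t) (at t) \<and> (u' has_vector_derivative u t) (at t)"
    by (rule weak_imp_classical[OF continuous_on_const u]) (use orth in \<open>simp add: l2_hat\<close>)
  then obtain u' where u': "\<And>t. ((\<lambda>t. 0) has_vector_derivative u' t) (at t)" "\<And>t. (u' has_vector_derivative u t) (at t)"
    by blast
  have "u' t = 0" for t
    using vector_derivative_unique_at[OF u'(1)[of t] has_vector_derivative_const] .
  then have "u' = (\<lambda>t. 0)" by blast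
  then show ?thesis
    using vector_derivative_unique_at[OF u'(2)[of t]] has_vector_derivative_const by metis
qed

text \<open>The last clause connects the construction with \<open>is_eigenvalue\<close>, which
  speaks of classical solutions: an eigenfunction for another value is orthogonal to every
  \<open>e i\<close> by the Wronskian argument. Hats are \<open>l2\<close> limits of their
  projections onto the \<open>e i\<close>, so it is orthogonal to all hats and vanishes.\<close>

theorem eigen_system:
  obtains e e' :: "nat \<Rightarrow> real \<Rightarrow> 'a" and \<mu> :: "nat \<Rightarrow> real"
  where "\<And>i. e i \<in> Dom" and "\<And>i j. l2 (e i) (e j) = (if i = j then 1 else 0)"
    and "\<And>i v. v \<in> Dom \<Longrightarrow> a (e i) v = \<mu> i * l2 (e i) v"
    and "incseq \<mu>" and "filterlim \<mu> at_top sequentially"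
    and "\<And>v. v \<in> Dom \<Longrightarrow> (\<lambda>m. l2 (v - (\<Sum>i<m. l2 v (e i) *\<^sub>R e i)) (v - (\<Sum>i<m. l2 v (e i) *\<^sub>R e i))) \<longlonglongrightarrow> 0"
    and "\<And>i. eigen_ode (\<mu> i) (e i) (e' i)"
    and "\<And>u u' \<nu>. eigen_ode \<nu> u u' \<Longrightarrow> integrable lborel (\<lambda>t. u t \<bullet> u t) \<Longrightarrow> \<exists>t. u t \<noteq> 0 \<Longrightarrow> \<nu> \<in> range \<mu>"
proof -
  obtain e :: "nat \<Rightarrow> real \<Rightarrow> 'a" and \<mu> where e: "\<And>i. e i \<in> Dom" "\<And>i j. l2 (e i) (e j) = (if i = j then 1 else 0)"
    and eig: "\<And>i v. v \<in> Dom \<Longrightarrow> a (e i) v = \<mu> i * l2 (e i) v"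
    and mono: "incseq \<mu>" and top: "filterlim \<mu> at_top sequentially"
    and proj: "\<And>m v. v \<in> Dom \<Longrightarrow> \<mu> m * l2 (v - (\<Sum>i<m. l2 v (e i) *\<^sub>R e i)) (v - (\<Sum>i<m. l2 v (e i) *\<^sub>R e i)) \<le> a v v"
    by (rule spectral) blast
  interpret H: psd_form Dom l2 by (rule psd_form_l2)
  have "\<forall>i. \<exists>u'. eigen_ode (\<mu> i) (e i) u'"
    by (intro allI eigen_ode_of_weak e eig)
  then obtain e' where e': "\<And>i. eigen_ode (\<mu> i) (e i) (e' i)" by metis
  have lim: "(\<lambda>m. l2 (v - (\<Sum>i<m. l2 v (e i) *\<^sub>R e i)) (v - (\<Sum>i<m. l2 v (e i) *\<^sub>R e i))) \<longlonglongrightarrow> 0" if v: "v \<in> Dom" for v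
  proof (rule tendsto_sandwich)
    define r where "r m = v - (\<Sum>i<m. l2 v (e i) *\<^sub>R e i)" for m
    have r: "r m \<in> Dom" for m unfolding r_def using v e by (intro H.mem) auto
    show "\<forall>\<^sub>F m in sequentially. 0 \<le> l2 (v - (\<Sum>i<m. l2 v (e i) *\<^sub>R e i)) (v - (\<Sum>i<m. l2 v (e i) *\<^sub>R e i))"
      using H.nonneg[OF r] by (simp add: r_def)
    have "\<forall>\<^sub>F m in sequentially. \<mu> m \<ge> 1" using top by (simp add: filterlim_at_top)
    then show "\<forall>\<^sub>F m in sequentially. l2 (v - (\<Sum>i<m. l2 v (e i) *\<^sub>R e i)) (v - (\<Sum>i<m. l2 v (e i) *\<^sub>R e i)) \<le> a v v / \<mu> m"
    proof eventually_elim
      case (elim m)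
      then show ?case using proj[OF v, of m] by (simp add: field_simps)
    qed
    show "(\<lambda>m. a v v / \<mu> m) \<longlonglongrightarrow> 0"
      by (rule real_tendsto_divide_at_top[OF tendsto_const top])
  qed simp
  have comp: "\<nu> \<in> range \<mu>" if ode: "eigen_ode \<nu> u u'" and sq: "integrable lborel (\<lambda>t. u t \<bullet> u t)" and ne: "\<exists>t. u t \<noteq> 0"
    for u u' \<nu>
  proof (rule ccontr)
    assume nr: "\<nu> \<notin> range \<mu>"
    have orth: "l2 (e i) u = 0" for i
      unfolding l2_def using nr by (intro eigen_ode_orthogonal[OF ode sq e' dom_square(1)[OF e(1)]]) auto
    interpret S: psd_form "{f. f \<in> borel_measurable lborel \<and> integrable lborel (\<lambda>t. f t \<bullet> f t)}" l2
      by (rule psd_form_l2_all)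
    have cu: "continuous_on UNIV u" using ode
      by (intro has_vector_derivative_continuous_on_UNIV[of u u']) (auto simp: eigen_ode_def)
    have uS: "u \<in> {f. f \<in> borel_measurable lborel \<and> integrable lborel (\<lambda>t. f t \<bullet> f t)}"
      using borel_measurable_continuous_onI[OF cu] sq by simp
    have DS: "f \<in> {f. f \<in> borel_measurable lborel \<and> integrable lborel (\<lambda>t. f t \<bullet> f t)}" if "f \<in> Dom" for f
      using dom_measurable[OF that] dom_square[OF that] by simp
    have "l2 u (hat m p v) = 0" for m p v
    proof -
      define \<phi> where "\<phi> = hat m p v"
      have \<phi>: "\<phi> \<in> Dom" by (simp add: \<phi>_def hat_dom)
      define P where "P n = (\<Sum>i<n. l2 \<phi> (e i) *\<^sub>R e i)" for n
      have P: "P n \<in> Dom" for n unfolding P_def using e by (intro H.mem) auto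
      have Pu: "l2 (P n) u = 0" for n
        unfolding P_def by (subst S.sum[OF finite_lessThan DS[OF e(1)] uS]) (simp add: orth)
      have le: "norm (l2 \<phi> u) \<le> sqrt (l2 (\<phi> - P n) (\<phi> - P n)) * sqrt (l2 u u)" for n
      proof -
        have "l2 \<phi> u = l2 (\<phi> - P n) u" using S.diff[OF DS[OF \<phi>] DS[OF P] uS, of n] Pu[of n] by simp
        then show ?thesis using S.abs_le[OF DS[OF H.mem(2)[OF \<phi> P]] uS, of n] by simp
      qed
      have "(\<lambda>n. sqrt (l2 (\<phi> - P n) (\<phi> - P n)) * sqrt (l2 u u)) \<longlonglongrightarrow> sqrt 0 * sqrt (l2 u u)"
        unfolding P_def by (intro tendsto_mult_right tendsto_real_sqrt lim \<phi>)
      then have "norm (l2 \<phi> u) \<le> sqrt 0 * sqrt (l2 u u)"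
        by (rule LIMSEQ_le_const) (use le in blast)
      then show ?thesis using S.sym[OF DS[OF \<phi>] uS] by (simp add: \<phi>_def)
    qed
    then have "u t = 0" for t by (rule orthogonal_hats_imp_zero[OF cu])
    then show False using ne by simp
  qed
  show ?thesis by (rule that[OF e eig mono top lim e' comp])
qed

end

section \<open>The functional on spans of eigenfunctions\<close>

text \<open>For \<open>X > 1\<close> divide by \<open>X powr \<theta>\<close>: the power that
  remains on the left has the positive exponent \<open>1 - \<theta>\<close>, which bounds
  \<open>X\<close>.\<close>

lemma sublinear_bound:
  fixes \<theta> D D' :: real
  assumes "0 \<le> \<theta>" "\<theta> < 1" "0 \<le> D" "0 \<le> D'"
  shows "\<exists>B\<ge>1. \<forall>X\<ge>0. X \<le> D + D' * (2 * X) powr \<theta> \<longrightarrow> X \<le> B"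
proof -
  define M where "M = D + 2 * D'"
  define B where "B = max 1 (M powr (1 / (1 - \<theta>)))"
  have "X \<le> B" if X: "X \<ge> 0" "X \<le> D + D' * (2 * X) powr \<theta>" for X
  proof (cases "X \<le> 1")
    case False
    then have X1: "X > 1" by simp
    have p1: "1 \<le> X powr \<theta>" using X1 assms by (intro ge_one_powr_ge_zero) auto
    have p2: "2 powr \<theta> \<le> 2" using powr_mono[of \<theta> 1 2] assms by simp
    have "X \<le> D + D' * (2 powr \<theta> * X powr \<theta>)" using X X1 by (simp add: powr_mult)
    also have "\<dots> \<le> D * X powr \<theta> + D' * (2 * X powr \<theta>)"
      using p1 p2 assms mult_left_mono[OF p1, of D] by (intro add_mono mult_left_mono mult_right_mono) auto
    finally have 1: "X \<le> M * X powr \<theta>" by (simp add: M_def algebra_simps)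
    have Xs: "X = X powr (1 - \<theta>) * X powr \<theta>" using X1 by (simp flip: powr_add)
    have "X powr (1 - \<theta>) * X powr \<theta> \<le> M * X powr \<theta>" using 1 Xs by simp
    then have "X powr (1 - \<theta>) \<le> M" by (rule mult_right_le_imp_le) (use p1 in linarith)
    then have "(X powr (1 - \<theta>)) powr (1 / (1 - \<theta>)) \<le> M powr (1 / (1 - \<theta>))"
      using assms by (intro powr_mono2) auto
    then show ?thesis using X1 assms by (simp add: powr_powr B_def)
  qed (simp add: B_def)
  then show ?thesis by (intro exI[of _ B]) (auto simp: B_def)
qed

text \<open>\<open>\<mu> i\<close> are the eigenvalues of \<open>H + c0\<close>, counted from 0, and \<open>k\<close> is the number of nonpositive
  eigenvalues of \<open>H\<close>: thus \<open>\<mu> k - c0\<close> is the smallest positive eigenvalue.\<close>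

locale galerkin = schroedinger_form A \<omega>
  for A :: "real \<Rightarrow> 'a::euclidean_space \<Rightarrow> 'a" and \<omega> +
  fixes W :: "real \<Rightarrow> 'a \<Rightarrow> real" and gW :: "real \<Rightarrow> 'a \<Rightarrow> 'a"
    and c0 :: real and e :: "nat \<Rightarrow> real \<Rightarrow> 'a" and \<mu> :: "nat \<Rightarrow> real" and k :: nat
    and b1 b2 b3 r1 \<nu> r2 s0 eps rinf :: real
  assumes e_dom: "e i \<in> Dom" and e_orth: "l2 (e i) (e j) = (if i = j then 1 else 0)"
    and e_eig: "v \<in> Dom \<Longrightarrow> a (e i) v = \<mu> i * l2 (e i) v"
    and mu_mono: "incseq \<mu>"
    and e_complete: "v \<in> Dom \<Longrightarrow>
      (\<lambda>m. l2 (v - (\<Sum>i<m. l2 v (e i) *\<^sub>R e i)) (v - (\<Sum>i<m. l2 v (e i) *\<^sub>R e i))) \<longlonglongrightarrow> 0"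
    and W_deriv: "(W t has_derivative (\<lambda>y. gW t x \<bullet> y)) (at x)"
    and cont_W: "continuous_on UNIV (\<lambda>p. W (fst p) (snd p))"
    and cont_gW: "continuous_on UNIV (\<lambda>p. gW (fst p) (snd p))"
    and W_zero: "W t 0 = 0" and W_nonneg: "0 \<le> W t x"
    and gW_bound: "norm (gW t x) \<le> b1 * norm x"
    and Wt_large: "norm x \<ge> r1 \<Longrightarrow> b2 * norm x powr \<nu> \<le> 2 * W t x - gW t x \<bullet> x"
    and Wt_small: "norm x < r1 \<Longrightarrow> - b3 * norm x \<le> 2 * W t x - gW t x \<bullet> x"
    and W_small: "norm x \<le> r2 \<Longrightarrow> W t x \<le> (\<mu> k - c0 - s0) / 2 * (norm x)\<^sup>2"
    and W_large: "norm x \<ge> rinf \<Longrightarrow> ((\<mu> k - c0) / 2 + eps) * (norm x)\<^sup>2 \<le> W t x"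
    and gap: "\<mu> k - c0 > 0" "i < k \<Longrightarrow> \<mu> i - c0 \<le> 0"
    and constants: "c0 \<ge> 0" "b1 > 0" "b2 > 0" "b3 > 0" "r1 > 0" "1 < \<nu>" "\<nu> \<le> 2" "r2 > 0" "s0 > 0"
      "s0 \<le> \<mu> k - c0" "eps > 0" "rinf > 0"
begin

section \<open>The functional in coordinates with respect to the eigenfunctions\<close>

interpretation H: psd_form Dom l2 by (rule psd_form_l2)

definition lam :: "nat \<Rightarrow> real" where "lam i = \<mu> i - c0"

definition U :: "nat \<Rightarrow> (nat \<Rightarrow> real) \<Rightarrow> real \<Rightarrow> 'a" where
  "U m c = (\<Sum>i<m. c i *\<^sub>R e i)"

text \<open>The energy of \<open>H\<close> is diagonal in these coordinates. Its entries are the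
  eigenvalues \<open>lam i\<close> of \<open>H\<close> itself: the shift \<open>c0\<close> contained
  in \<open>a\<close> has been taken out again.\<close>

definition J :: "nat \<Rightarrow> (nat \<Rightarrow> real) \<Rightarrow> real" where
  "J m c = (\<Sum>i<m. lam i * (c i)\<^sup>2) / 2 - (LBINT t. W t (U m c t))"

definition gJ :: "nat \<Rightarrow> (nat \<Rightarrow> real) \<Rightarrow> nat \<Rightarrow> real" where
  "gJ m c i = lam i * c i - (LBINT t. gW t (U m c t) \<bullet> e i t)"

lemma U_dom: "U m c \<in> Dom"
  unfolding U_def by (rule H.mem(5)) (rule H.mem(3)[OF e_dom])

lemma U_apply: "U m c t = (\<Sum>i<m. c i *\<^sub>R e i t)"
  by (simp add: U_def sum_fun_apply)

lemma U_add: "U m (\<lambda>i. c i + d i) t = U m c t + U m d t"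
  by (simp add: U_apply scaleR_left_distrib sum.distrib)

lemma l2_U: "v \<in> Dom \<Longrightarrow> l2 (U m c) v = (\<Sum>i<m. c i * l2 (e i) v)"
  unfolding U_def by (rule H.sum) (simp_all add: e_dom)

lemma a_U: "v \<in> Dom \<Longrightarrow> a (U m c) v = (\<Sum>i<m. c i * (\<mu> i * l2 (e i) v))"
  unfolding U_def using F.sum[of "{..<m}" e v c] e_dom e_eig by simp

lemma l2_e_U: "i < m \<Longrightarrow> l2 (e i) (U m c) = c i"
proof -
  assume i: "i < m"
  have "l2 (e i) (U m c) = (\<Sum>j<m. c j * l2 (e j) (e i))"
    using H.sym[OF e_dom U_dom] l2_U[OF e_dom] by simp
  also have "\<dots> = (\<Sum>j<m. if j = i then c j else 0)" by (intro sum.cong) (simp_all add: e_orth)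
  also have "\<dots> = c i" using i by simp
  finally show ?thesis .
qed

lemma l2_UU: "l2 (U m c) (U m c) = (\<Sum>i<m. (c i)\<^sup>2)"
  unfolding l2_U[OF U_dom] by (intro sum.cong) (simp_all add: l2_e_U power2_eq_square)

lemma a_UU: "a (U m c) (U m c) = (\<Sum>i<m. \<mu> i * (c i)\<^sup>2)"
  unfolding a_U[OF U_dom] by (intro sum.cong) (simp_all add: l2_e_U power2_eq_square)

lemma a_UU_lam: "a (U m c) (U m c) = (\<Sum>i<m. lam i * (c i)\<^sup>2) + c0 * (\<Sum>i<m. (c i)\<^sup>2)"
  unfolding a_UU by (simp add: lam_def sum_distrib_left algebra_simps flip: sum.distrib)

lemma W_increment: "\<exists>s. 0 \<le> s \<and> s \<le> 1 \<and> W t (x + y) - W t x = gW t (x + s *\<^sub>R y) \<bullet> y"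
proof -
  have "((\<lambda>s. W t (x + s *\<^sub>R y)) has_real_derivative gW t (x + s *\<^sub>R y) \<bullet> y) (at s)" for s
  proof -
    have "((\<lambda>s. x + s *\<^sub>R y) has_derivative (\<lambda>h. h *\<^sub>R y)) (at s)" by (auto intro!: derivative_eq_intros)
    from has_derivative_compose[OF this W_deriv]
    show ?thesis by (simp add: has_field_derivative_def mult_commute_abs)
  qed
  then have "\<exists>z. 0 < z \<and> z < 1 \<and> W t (x + 1 *\<^sub>R y) - W t (x + 0 *\<^sub>R y) = (1 - 0) * (gW t (x + z *\<^sub>R y) \<bullet> y)"
    by (intro MVT2) auto
  then obtain z where "0 < z" "z < 1" "W t (x + y) - W t x = gW t (x + z *\<^sub>R y) \<bullet> y" by auto
  then show ?thesis by (intro exI[of _ z]) simp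
qed

lemma W_upper: "W t x \<le> b1 * (x \<bullet> x)"
proof -
  obtain s where s: "0 \<le> s" "s \<le> 1" "W t (0 + x) - W t 0 = gW t (0 + s *\<^sub>R x) \<bullet> x"
    using W_increment by blast
  have "gW t (s *\<^sub>R x) \<bullet> x \<le> norm (gW t (s *\<^sub>R x)) * norm x" by (rule norm_cauchy_schwarz)
  also have "\<dots> \<le> b1 * norm (s *\<^sub>R x) * norm x" by (intro mult_right_mono gW_bound) simp
  also have "\<dots> \<le> b1 * (1 * norm x) * norm x"
    using s constants by (intro mult_right_mono mult_left_mono) (auto simp: mult_left_le_one_le)
  finally show ?thesis using s(3) by (simp add: W_zero power2_norm_eq_inner[symmetric] power2_eq_square)
qed

lemma continuous_W: "continuous_on UNIV u \<Longrightarrow> continuous_on UNIV (\<lambda>t. W t (u t))"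
  using continuous_on_compose2[OF cont_W continuous_on_Pair[OF continuous_on_id]] by simp

lemma continuous_gW: "continuous_on UNIV u \<Longrightarrow> continuous_on UNIV (\<lambda>t. gW t (u t))"
  using continuous_on_compose2[OF cont_gW continuous_on_Pair[OF continuous_on_id]] by simp

lemma W_integrable: "u \<in> Dom \<Longrightarrow> integrable lborel (\<lambda>t. W t (u t))"
proof (rule Bochner_Integration.integrable_bound)
  assume u: "u \<in> Dom"
  show "integrable lborel (\<lambda>t. b1 * (u t \<bullet> u t))" using dom_square[OF u] by simp
  show "(\<lambda>t. W t (u t)) \<in> borel_measurable lborel"
    using borel_measurable_continuous_onI[OF continuous_W[OF dom_cont[OF u]]] by simp
  have "W t (u t) \<le> \<bar>b1 * (u t \<bullet> u t)\<bar>" for t using W_upper[of t "u t"] by linarith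
  then show "AE t in lborel. norm (W t (u t)) \<le> norm (b1 * (u t \<bullet> u t))"
    by (intro AE_I2) (simp only: real_norm_def abs_of_nonneg[OF W_nonneg])
qed

lemma gW_inner_le: "\<bar>gW t x \<bullet> y\<bar> \<le> b1 * (norm x * norm y)"
  using order_trans[OF Cauchy_Schwarz_ineq2 mult_right_mono[OF gW_bound norm_ge_zero]]
  by (simp add: mult.assoc)

lemma norm_integrable: "v \<in> Dom \<Longrightarrow> integrable lborel (\<lambda>t. norm (v t))"
  by (rule dom_l1) blast

lemma gW_square:
  assumes u: "u \<in> Dom"
  shows "integrable lborel (\<lambda>t. gW t (u t) \<bullet> gW t (u t))"
    and "l2 (\<lambda>t. gW t (u t)) (\<lambda>t. gW t (u t)) \<le> b1\<^sup>2 * l2 u u"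
proof -
  have m: "(\<lambda>t. gW t (u t) \<bullet> gW t (u t)) \<in> borel_measurable lborel"
    using borel_measurable_continuous_onI[OF continuous_on_inner[OF continuous_gW continuous_gW]] dom_cont[OF u] by simp
  have le: "gW t (u t) \<bullet> gW t (u t) \<le> b1\<^sup>2 * (u t \<bullet> u t)" for t
    using power_mono[OF gW_bound[of t "u t"] norm_ge_zero, of 2]
    by (simp add: power_mult_distrib power2_norm_eq_inner)
  have i: "integrable lborel (\<lambda>t. b1\<^sup>2 * (u t \<bullet> u t))" using dom_square(1)[OF u] by simp
  show g: "integrable lborel (\<lambda>t. gW t (u t) \<bullet> gW t (u t))"
    by (rule Bochner_Integration.integrable_bound[OF i m]) (use le in \<open>simp add: abs_of_nonneg\<close>)
  show "l2 (\<lambda>t. gW t (u t)) (\<lambda>t. gW t (u t)) \<le> b1\<^sup>2 * l2 u u"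
    using integral_mono[OF g i le] by (simp add: l2_def)
qed

lemma gW_comp_measurable: "u \<in> Dom \<Longrightarrow> (\<lambda>t. gW t (u t)) \<in> borel_measurable lborel"
  using borel_measurable_continuous_onI[OF continuous_gW[OF dom_cont]] by simp

lemma gW_measurable: "u \<in> Dom \<Longrightarrow> v \<in> Dom \<Longrightarrow> (\<lambda>t. gW t (u t) \<bullet> v t) \<in> borel_measurable lborel"
  by (rule borel_measurable_inner[OF gW_comp_measurable dom_measurable])

lemma gW_integrable: "u \<in> Dom \<Longrightarrow> v \<in> Dom \<Longrightarrow> integrable lborel (\<lambda>t. gW t (u t) \<bullet> v t)"
  by (rule integrable_inner_of_squares[OF gW_comp_measurable dom_measurable gW_square(1) dom_square(1)])

lemma gW_integral_le:
  assumes u: "u \<in> Dom" and v: "v \<in> Dom"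
  shows "\<bar>LBINT t. gW t (u t) \<bullet> v t\<bar> \<le> b1 * (sqrt (l2 u u) * sqrt (l2 v v))"
proof -
  interpret S: psd_form "{f. f \<in> borel_measurable lborel \<and> integrable lborel (\<lambda>t. f t \<bullet> f t)}" l2
    by (rule psd_form_l2_all)
  have "\<bar>l2 (\<lambda>t. gW t (u t)) v\<bar> \<le> sqrt (l2 (\<lambda>t. gW t (u t)) (\<lambda>t. gW t (u t))) * sqrt (l2 v v)"
    by (rule S.abs_le)
       (simp_all add: gW_comp_measurable[OF u, simplified] gW_square(1)[OF u] dom_measurable[OF v, simplified] dom_square(1)[OF v])
  also have "\<dots> \<le> (b1 * sqrt (l2 u u)) * sqrt (l2 v v)"
    using real_sqrt_le_mono[OF gW_square(2)[OF u]] constants H.nonneg[OF v]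
    by (intro mult_right_mono) (simp_all add: real_sqrt_mult)
  finally show ?thesis by (simp add: l2_def mult.assoc)
qed

lemma gW_tendsto:
  assumes u: "\<And>j. u j \<in> Dom" "w \<in> Dom" and v: "v \<in> Dom"
    and bd: "\<And>j t. norm (u j t) \<le> C" and lim: "\<And>t. (\<lambda>j. u j t) \<longlonglongrightarrow> w t"
  shows "(\<lambda>j. LBINT t. gW t (u j t) \<bullet> v t) \<longlonglongrightarrow> (LBINT t. gW t (w t) \<bullet> v t)"
proof (rule integral_dominated_convergence[where w="\<lambda>t. b1 * (C * norm (v t))"])
  show "(\<lambda>t. gW t (w t) \<bullet> v t) \<in> borel_measurable lborel" by (rule gW_measurable[OF u(2) v])
  show "(\<lambda>t. gW t (u j t) \<bullet> v t) \<in> borel_measurable lborel" for j by (rule gW_measurable[OF u(1) v])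
  show "integrable lborel (\<lambda>t. b1 * (C * norm (v t)))" using norm_integrable[OF v] by simp
  show "AE t in lborel. norm (gW t (u j t) \<bullet> v t) \<le> b1 * (C * norm (v t))" for j
  proof (rule AE_I2)
    fix t
    have "b1 * (norm (u j t) * norm (v t)) \<le> b1 * (C * norm (v t))"
      using constants bd by (intro mult_left_mono mult_right_mono) auto
    then show "norm (gW t (u j t) \<bullet> v t) \<le> b1 * (C * norm (v t))" using gW_inner_le[of t "u j t" "v t"] by simp
  qed
  show "AE t in lborel. (\<lambda>j. gW t (u j t) \<bullet> v t) \<longlonglongrightarrow> gW t (w t) \<bullet> v t"
  proof (rule AE_I2)
    fix t
    have "(\<lambda>j. gW t (u j t)) \<longlonglongrightarrow> gW t (w t)"
      using continuous_on_tendsto_compose[OF cont_gW tendsto_Pair[OF tendsto_const lim], of t t] by simp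
    then show "(\<lambda>j. gW t (u j t) \<bullet> v t) \<longlonglongrightarrow> gW t (w t) \<bullet> v t" by (rule tendsto_inner[OF _ tendsto_const])
  qed
qed

lemma gJ_inner: "(\<Sum>i<m. gJ m c i * d i) = (\<Sum>i<m. lam i * (c i * d i)) - (LBINT t. gW t (U m c t) \<bullet> U m d t)"
proof -
  have "(LBINT t. gW t (U m c t) \<bullet> U m d t) = (LBINT t. (\<Sum>i<m. d i * (gW t (U m c t) \<bullet> e i t)))"
    by (simp add: U_apply[of m d] inner_sum_right)
  also have "\<dots> = (\<Sum>i<m. LBINT t. d i * (gW t (U m c t) \<bullet> e i t))"
    by (rule Bochner_Integration.integral_sum) (simp add: gW_integrable U_dom e_dom)
  finally have 1: "(LBINT t. gW t (U m c t) \<bullet> U m d t) = (\<Sum>i<m. d i * (LBINT t. gW t (U m c t) \<bullet> e i t))" by simp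
  show ?thesis unfolding 1 by (simp add: gJ_def algebra_simps sum_subtractf)
qed

section \<open>Norm, envelope and continuity on the coordinate space\<close>

definition V :: "nat \<Rightarrow> (nat \<Rightarrow> real) set" where "V m = {c. \<forall>i\<ge>m. c i = 0}"

definition N :: "nat \<Rightarrow> (nat \<Rightarrow> real) \<Rightarrow> real" where "N m c = L2_set c {..<m}"

lemma N_nonneg: "0 \<le> N m c"
  by (simp add: N_def)

lemma N_square: "(N m c)\<^sup>2 = (\<Sum>i<m. (c i)\<^sup>2)"
  by (simp add: N_def L2_set_def sum_nonneg)

lemma N_coord: "i < m \<Longrightarrow> \<bar>c i\<bar> \<le> N m c"
  using member_le_L2_set[of "{..<m}" i "\<lambda>i. \<bar>c i\<bar>"] by (simp add: N_def L2_set_def)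

lemma N_inner: "\<bar>\<Sum>i<m. c i * d i\<bar> \<le> N m c * N m d"
proof -
  have "\<bar>\<Sum>i<m. c i * d i\<bar> \<le> (\<Sum>i<m. \<bar>c i\<bar> * \<bar>d i\<bar>)"
    using sum_abs[of "\<lambda>i. c i * d i" "{..<m}"] by (simp add: abs_mult)
  also have "\<dots> \<le> N m c * N m d" unfolding N_def by (rule L2_set_mult_ineq)
  finally show ?thesis .
qed

text \<open>Envelope of the span: by \<open>U_le_E\<close> it dominates every combination with
  coefficients of norm 1. It is integrable and bounded, and supplies the majorants in
  \<open>J_tendsto\<close> and \<open>W_integral_increment\<close>.\<close>

definition E :: "nat \<Rightarrow> real \<Rightarrow> real" where "E m t = (\<Sum>i<m. norm (e i t))"

lemma E_nonneg: "0 \<le> E m t"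
  by (simp add: E_def sum_nonneg)

lemma U_le_E: "norm (U m c t) \<le> N m c * E m t"
proof -
  have "norm (U m c t) \<le> (\<Sum>i<m. norm (c i *\<^sub>R e i t))" unfolding U_apply by (rule norm_sum)
  also have "\<dots> \<le> (\<Sum>i<m. N m c * norm (e i t))"
    by (intro sum_mono) (simp add: N_coord mult_right_mono)
  finally show ?thesis by (simp add: E_def sum_distrib_left)
qed

lemma E_integrable: "integrable lborel (E m)"
  unfolding E_def by (intro Bochner_Integration.integrable_sum norm_integrable e_dom)

lemma E_bounded: "\<exists>C\<ge>0. \<forall>t. E m t \<le> C"
proof (intro exI[of _ "\<Sum>i<m. sqrt (4 * a (e i) (e i))"] conjI allI)
  show "0 \<le> (\<Sum>i<m. sqrt (4 * a (e i) (e i)))"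
    by (intro sum_nonneg real_sqrt_ge_zero mult_nonneg_nonneg F.nonneg e_dom) simp
  fix t
  show "E m t \<le> (\<Sum>i<m. sqrt (4 * a (e i) (e i)))"
    unfolding E_def by (intro sum_mono real_le_rsqrt dom_sup e_dom)
qed

lemma U_tendsto: "(\<And>i. (\<lambda>j. c j i) \<longlonglongrightarrow> d i) \<Longrightarrow> (\<lambda>j. U m (c j) t) \<longlonglongrightarrow> U m d t"
  unfolding U_apply by (intro tendsto_sum tendsto_scaleR tendsto_const)

lemma N_tendsto: "(\<And>i. (\<lambda>j. c j i) \<longlonglongrightarrow> d i) \<Longrightarrow> (\<lambda>j. N m (c j)) \<longlonglongrightarrow> N m d"
  unfolding N_def L2_set_def by (intro tendsto_real_sqrt tendsto_sum tendsto_power)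

lemma U_uniformly_bounded:
  assumes c: "\<And>i. (\<lambda>j. c j i) \<longlonglongrightarrow> d i"
  shows "\<exists>C. \<forall>j t. norm (U m (c j) t) \<le> C"
proof -
  obtain C1 where C1: "C1 \<ge> 0" "\<And>t. E m t \<le> C1" using E_bounded by blast
  have "Bseq (\<lambda>j. N m (c j))" by (rule convergent_imp_Bseq[OF convergentI[OF N_tendsto[OF c]]])
  then obtain C2 where C2: "C2 > 0" "\<forall>j. norm (N m (c j)) \<le> C2" by (rule BseqE)
  have "norm (U m (c j) t) \<le> C2 * C1" for j t
  proof -
    have "N m (c j) * E m t \<le> C2 * C1"
      using C2(2)[rule_format, of j] C1 C2(1) E_nonneg[of m t] by (intro mult_mono) auto
    then show ?thesis using U_le_E[of m "c j" t] by linarith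
  qed
  then show ?thesis by blast
qed

lemma gJ_tendsto:
  assumes c: "\<And>i. (\<lambda>j. c j i) \<longlonglongrightarrow> d i"
  shows "(\<lambda>j. gJ m (c j) i) \<longlonglongrightarrow> gJ m d i"
proof -
  obtain C where C: "\<And>j t. norm (U m (c j) t) \<le> C" using U_uniformly_bounded[of c d m, OF c] by blast
  show ?thesis unfolding gJ_def
    by (rule tendsto_diff[OF tendsto_mult[OF tendsto_const c] gW_tendsto[OF U_dom U_dom e_dom C U_tendsto[OF c]]])
qed

lemma J_tendsto:
  assumes c: "\<And>i. (\<lambda>j. c j i) \<longlonglongrightarrow> d i"
  shows "(\<lambda>j. J m (c j)) \<longlonglongrightarrow> J m d"
proof -
  obtain C2 where C2: "C2 > 0" "\<forall>j. norm (N m (c j)) \<le> C2"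
    by (rule BseqE[OF convergent_imp_Bseq[OF convergentI[OF N_tendsto[OF c]]]])
  obtain C1 where C1: "C1 \<ge> 0" "\<And>t. E m t \<le> C1" using E_bounded by blast
  have W: "(\<lambda>j. LBINT t. W t (U m (c j) t)) \<longlonglongrightarrow> (LBINT t. W t (U m d t))"
  proof (rule integral_dominated_convergence[where w="\<lambda>t. b1 * (C2 * C2 * C1 * E m t)"])
    show "(\<lambda>t. W t (U m d t)) \<in> borel_measurable lborel" by (rule borel_measurable_integrable[OF W_integrable[OF U_dom]])
    show "(\<lambda>t. W t (U m (c j) t)) \<in> borel_measurable lborel" for j by (rule borel_measurable_integrable[OF W_integrable[OF U_dom]])
    show "integrable lborel (\<lambda>t. b1 * (C2 * C2 * C1 * E m t))" using E_integrable by simp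
    show "AE t in lborel. (\<lambda>j. W t (U m (c j) t)) \<longlonglongrightarrow> W t (U m d t)"
    proof (rule AE_I2)
      fix t
      show "(\<lambda>j. W t (U m (c j) t)) \<longlonglongrightarrow> W t (U m d t)"
        using continuous_on_tendsto_compose[OF cont_W tendsto_Pair[OF tendsto_const U_tendsto[of c d m t, OF c]], of t] by simp
    qed
    show "AE t in lborel. norm (W t (U m (c j) t)) \<le> b1 * (C2 * C2 * C1 * E m t)" for j
    proof (rule AE_I2)
      fix t
      have 1: "norm (U m (c j) t) \<le> C2 * E m t"
      proof -
        have "N m (c j) * E m t \<le> C2 * E m t"
          using C2(2)[rule_format, of j] E_nonneg[of m t] by (intro mult_right_mono) auto
        then show ?thesis using U_le_E[of m "c j" t] by linarith
      qed
      have "U m (c j) t \<bullet> U m (c j) t \<le> (C2 * E m t) * (C2 * E m t)"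
        unfolding power2_norm_eq_inner[symmetric] power2_eq_square 
        by (intro mult_mono 1 mult_nonneg_nonneg E_nonneg less_imp_le[OF C2(1)]) simp
      also have "\<dots> \<le> (C2 * C1) * (C2 * E m t)"
        using C1 C2(1) E_nonneg[of m t] by (intro mult_right_mono mult_left_mono mult_nonneg_nonneg) auto
      finally have "b1 * (U m (c j) t \<bullet> U m (c j) t) \<le> b1 * (C2 * C2 * C1 * E m t)"
        using constants by (intro mult_left_mono) (auto simp: ac_simps)
      then show "norm (W t (U m (c j) t)) \<le> b1 * (C2 * C2 * C1 * E m t)"
        using W_upper[of t "U m (c j) t"] W_nonneg[of t "U m (c j) t"] by simp
    qed
  qed
  show ?thesis unfolding J_def
    by (rule tendsto_diff[OF tendsto_divide[OF tendsto_sum[OF tendsto_mult[OF tendsto_const tendsto_power[OF c]]] tendsto_const] W]) simp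
qed

lemma continuous_on_sequenceI:
  fixes f :: "(nat \<Rightarrow> real) \<Rightarrow> real"
  assumes lim: "\<And>c d. (\<And>i. (\<lambda>j. c j i) \<longlonglongrightarrow> d i) \<Longrightarrow> (\<lambda>j::nat. f (c j)) \<longlonglongrightarrow> f d"
  shows "continuous_on UNIV f"
  unfolding continuous_on_sequentially
proof (intro allI ballI impI, elim conjE)
  fix c :: "nat \<Rightarrow> nat \<Rightarrow> real" and d assume l: "c \<longlonglongrightarrow> d"
  have "(\<lambda>j. c j i) \<longlonglongrightarrow> d i" for i
    using continuous_on_tendsto_compose[OF continuous_on_product_coordinates l, of i] by simp
  from lim[of c, OF this] show "(f \<circ> c) \<longlonglongrightarrow> f d" by (simp add: o_def)
qed

text \<open>The gradient is only continuous, with no uniformity in \<open>t\<close>, so the estimate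
  comes from a contradiction: along counterexamples a subsequence of the \<open>c n\<close>
  converges, the vanishing increments are scaled to unit coefficient norm as \<open>v\<close>, and
  the mean value theorem with dominated convergence sends the errors of the difference quotients,
  \<open>f n\<close>, to 0.\<close>

lemma W_integral_increment:
  assumes eps: "\<epsilon> > 0"
  shows "\<exists>s>0. \<forall>c\<in>V m. \<forall>d\<in>V m. N m c \<le> b \<longrightarrow> N m d \<le> s \<longrightarrow>
    \<bar>(LBINT t. W t (U m c t + U m d t)) - (LBINT t. W t (U m c t)) - (LBINT t. gW t (U m c t) \<bullet> U m d t)\<bar> \<le> \<epsilon> * N m d"
proof (rule ccontr)
  define err where "err c d = (LBINT t. W t (U m c t + U m d t)) - (LBINT t. W t (U m c t)) - (LBINT t. gW t (U m c t) \<bullet> U m d t)"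
    for c d
  assume contra: "\<not> ?thesis"
  have "\<forall>s>0. \<exists>c d. c \<in> V m \<and> N m c \<le> b \<and> N m d \<le> s \<and> \<bar>err c d\<bar> > \<epsilon> * N m d"
  proof (intro allI impI, rule ccontr)
    fix s :: real
    assume s: "s > 0" and no: "\<not> (\<exists>c d. c \<in> V m \<and> N m c \<le> b \<and> N m d \<le> s \<and> \<bar>err c d\<bar> > \<epsilon> * N m d)"
    have "\<forall>c\<in>V m. \<forall>d\<in>V m. N m c \<le> b \<longrightarrow> N m d \<le> s \<longrightarrow> \<bar>err c d\<bar> \<le> \<epsilon> * N m d"
      using no by (meson not_le)
    then show False using contra s unfolding err_def by blast
  qed
  then have "\<forall>n. \<exists>p. fst p \<in> V m \<and> N m (fst p) \<le> b \<and> N m (snd p) \<le> inverse (real (Suc n)) \<and> \<bar>err (fst p) (snd p)\<bar> > \<epsilon> * N m (snd p)"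
    by (intro allI) (simp add: split_paired_Ex)
  from choice[OF this] obtain p where p: "\<forall>n. fst (p n) \<in> V m \<and> N m (fst (p n)) \<le> b \<and> N m (snd (p n)) \<le> inverse (real (Suc n)) \<and>
      \<bar>err (fst (p n)) (snd (p n))\<bar> > \<epsilon> * N m (snd (p n))" by (rule exE)
  define c d where "c n = fst (p n)" and "d n = snd (p n)" for n
  have c: "c n \<in> V m" "N m (c n) \<le> b" and d: "N m (d n) \<le> inverse (real (Suc n))" and
    er: "\<bar>err (c n) (d n)\<bar> > \<epsilon> * N m (d n)" for n using p by (simp_all add: c_def d_def)
  have Nd: "N m (d n) > 0" for n
  proof (rule ccontr)
    assume "\<not> N m (d n) > 0"
    then have 0: "N m (d n) = 0" using N_nonneg[of m "d n"] by simp
    then have "U m (d n) t = 0" for t using U_le_E[of m "d n" t] by simp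
    then have "err (c n) (d n) = 0" by (simp add: err_def)
    then show False using er[of n] 0 by simp
  qed
  have "norm (c n i) \<le> \<bar>b\<bar>" for n i
    using c[of n] N_coord[of i m "c n"] by (cases "i < m") (auto simp: V_def)
  then obtain r where r: "strict_mono (r :: nat \<Rightarrow> nat)" and "\<And>i. \<exists>l. (\<lambda>n. c (r n) i) \<longlonglongrightarrow> l"
    using function_convergent_subsequence[of "UNIV :: nat set" c "\<bar>b\<bar>"] by (metis UNIV_I countableI_type)
  then obtain l where l: "\<And>i. (\<lambda>n. c (r n) i) \<longlonglongrightarrow> l i" by metis
  define \<rho> where "\<rho> n = N m (d (r n))" for n
  have \<rho>: "\<rho> n > 0" for n by (simp add: \<rho>_def Nd)
  have \<rho>0: "\<rho> \<longlonglongrightarrow> 0"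
  proof (rule tendsto_sandwich[OF _ _ tendsto_const])
    show "(\<lambda>n. inverse (real (Suc (r n)))) \<longlonglongrightarrow> 0"
      using LIMSEQ_subseq_LIMSEQ[OF LIMSEQ_inverse_real_of_nat r] by (simp add: o_def)
  qed (use \<rho> d in \<open>simp_all add: \<rho>_def less_imp_le\<close>)
  define u v where "u n t = U m (c (r n)) t" and "v n t = (1 / \<rho> n) *\<^sub>R U m (d (r n)) t" for n t
  have v_le: "norm (v n t) \<le> E m t" for n t
    using U_le_E[of m "d (r n)" t] \<rho>[of n] by (simp add: v_def \<rho>_def[symmetric] divide_le_eq mult.commute)
  have Uv: "U m (d (r n)) t = \<rho> n *\<^sub>R v n t" for n t using \<rho>[of n] by (simp add: v_def)
  obtain C where C: "\<And>n t. norm (u n t) \<le> C"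
    using U_uniformly_bounded[of "\<lambda>n. c (r n)" l m, OF l] unfolding u_def by blast
  obtain C1 where C1: "C1 \<ge> 0" "\<And>t. E m t \<le> C1" using E_bounded by blast
  define f where "f n t = (W t (u n t + \<rho> n *\<^sub>R v n t) - W t (u n t)) / \<rho> n - gW t (u n t) \<bullet> v n t" for n t
  have f_eq: "\<exists>s. 0 \<le> s \<and> s \<le> 1 \<and> f n t = (gW t (u n t + (s * \<rho> n) *\<^sub>R v n t) - gW t (u n t)) \<bullet> v n t" for n t
  proof -
    obtain s where s: "0 \<le> s" "s \<le> 1"
      "W t (u n t + \<rho> n *\<^sub>R v n t) - W t (u n t) = gW t (u n t + s *\<^sub>R \<rho> n *\<^sub>R v n t) \<bullet> (\<rho> n *\<^sub>R v n t)"
      using W_increment by blast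
    then have "f n t = (gW t (u n t + (s * \<rho> n) *\<^sub>R v n t) - gW t (u n t)) \<bullet> v n t"
      using \<rho>[of n] by (simp add: f_def inner_diff_left)
    then show ?thesis using s by blast
  qed
  have i1: "integrable lborel (\<lambda>t. W t (u n t + \<rho> n *\<^sub>R v n t))" for n
    using W_integrable[OF U_dom, of m "\<lambda>i. c (r n) i + d (r n) i"] by (simp add: U_add u_def Uv)
  have i2: "integrable lborel (\<lambda>t. W t (u n t))" for n
    unfolding u_def by (rule W_integrable[OF U_dom])
  have i3: "integrable lborel (\<lambda>t. gW t (u n t) \<bullet> v n t)" for n
    unfolding u_def v_def using gW_integrable[OF U_dom U_dom, of m "c (r n)" m "d (r n)"] by simp
  have f_int: "integrable lborel (f n)" for n
    unfolding f_def by (intro Bochner_Integration.integrable_diff integrable_divide i1 i2 i3)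
  have err_f: "err (c (r n)) (d (r n)) = \<rho> n * (LBINT t. f n t)" for n
  proof -
    have "(LBINT t. f n t) = ((LBINT t. W t (u n t + \<rho> n *\<^sub>R v n t)) - (LBINT t. W t (u n t))) / \<rho> n - (LBINT t. gW t (u n t) \<bullet> v n t)"
      unfolding f_def using i1[of n] i2[of n] i3[of n] by simp
    moreover have "(LBINT t. gW t (u n t) \<bullet> U m (d (r n)) t) = \<rho> n * (LBINT t. gW t (u n t) \<bullet> v n t)"
      by (simp add: Uv)
    moreover have "err (c (r n)) (d (r n)) = (LBINT t. W t (u n t + \<rho> n *\<^sub>R v n t)) - (LBINT t. W t (u n t))
        - (LBINT t. gW t (u n t) \<bullet> U m (d (r n)) t)"
      by (simp add: err_def Uv u_def)
    moreover have "x - y - \<rho> n * z = \<rho> n * ((x - y) / \<rho> n - z)" for x y z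
      using \<rho>[of n] by (simp add: field_simps)
    ultimately show ?thesis by presburger
  qed
  have "(\<lambda>n. LBINT t. f n t) \<longlonglongrightarrow> (LBINT (t::real). 0)"
  proof (rule integral_dominated_convergence[where w="\<lambda>t. b1 * (C + 1 * C1) * E m t + b1 * C * E m t"])
    show "f n \<in> borel_measurable lborel" for n by (rule borel_measurable_integrable[OF f_int])
    show "integrable lborel (\<lambda>t. b1 * (C + 1 * C1) * E m t + b1 * C * E m t)"
      using E_integrable by simp
    show "AE t in lborel. norm (f n t) \<le> b1 * (C + 1 * C1) * E m t + b1 * C * E m t" for n
    proof (rule AE_I2)
      fix t
      obtain s where s: "0 \<le> s" "s \<le> 1" and fs: "f n t = (gW t (u n t + (s * \<rho> n) *\<^sub>R v n t) - gW t (u n t)) \<bullet> v n t"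
        using f_eq by blast
      have "\<rho> n \<le> 1" using d[of "r n"] by (simp add: \<rho>_def inverse_eq_divide order_trans[of _ "1 / (1 + real (r n))" 1])
      then have s\<rho>: "\<bar>s * \<rho> n\<bar> \<le> 1" using s \<rho>[of n] mult_mono[of s 1 "\<rho> n" 1] by simp
      have "norm (u n t + (s * \<rho> n) *\<^sub>R v n t) \<le> norm (u n t) + \<bar>s * \<rho> n\<bar> * norm (v n t)"
        using norm_triangle_ineq[of "u n t" "(s * \<rho> n) *\<^sub>R v n t"] by simp
      also have "\<dots> \<le> C + 1 * C1"
        using C[of n t] s\<rho> order_trans[OF v_le C1(2), of n t] by (intro add_mono mult_mono) auto
      finally have 1: "norm (u n t + (s * \<rho> n) *\<^sub>R v n t) \<le> C + 1 * C1" .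
      have C0: "0 \<le> C" by (rule order_trans[OF norm_ge_zero C])
      have A1: "\<bar>gW t (u n t + (s * \<rho> n) *\<^sub>R v n t) \<bullet> v n t\<bar> \<le> b1 * ((C + 1 * C1) * E m t)"
        using 1 v_le[of n t] constants(2) C0 C1(1)
        by (intro order_trans[OF gW_inner_le] mult_left_mono mult_mono) auto
      have A2: "\<bar>gW t (u n t) \<bullet> v n t\<bar> \<le> b1 * (C * E m t)"
        using C[of n t] v_le[of n t] constants(2) C0
        by (intro order_trans[OF gW_inner_le] mult_left_mono mult_mono) auto
      show "norm (f n t) \<le> b1 * (C + 1 * C1) * E m t + b1 * C * E m t"
        unfolding fs inner_diff_left using A1 A2 by (simp add: mult.assoc)
    qed
    show "AE t in lborel. (\<lambda>n. f n t) \<longlonglongrightarrow> 0"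
    proof (rule AE_I2)
      fix t
      have "\<forall>n. \<exists>s. 0 \<le> s \<and> s \<le> 1 \<and> f n t = (gW t (u n t + (s * \<rho> n) *\<^sub>R v n t) - gW t (u n t)) \<bullet> v n t"
        using f_eq by (rule allI)
      from choice[OF this] obtain s where s0: "\<forall>n. 0 \<le> s n \<and> s n \<le> 1 \<and>
          f n t = (gW t (u n t + (s n * \<rho> n) *\<^sub>R v n t) - gW t (u n t)) \<bullet> v n t" by (rule exE)
      have s: "0 \<le> s n" "s n \<le> 1"
        and fs: "f n t = (gW t (u n t + (s n * \<rho> n) *\<^sub>R v n t) - gW t (u n t)) \<bullet> v n t" for n
        using s0 by simp_all
      have u: "(\<lambda>n. u n t) \<longlonglongrightarrow> U m l t" unfolding u_def by (rule U_tendsto[OF l])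
      have z0: "(\<lambda>n. \<rho> n * E m t) \<longlonglongrightarrow> 0" using tendsto_mult_right[OF \<rho>0, of "E m t"] by simp
      have z1: "norm ((s n * \<rho> n) *\<^sub>R v n t) \<le> \<rho> n * E m t" for n
      proof -
        have "s n * \<rho> n * norm (v n t) \<le> 1 * \<rho> n * E m t"
          using s[of n] \<rho>[of n] v_le[of n t] by (intro mult_mono) auto
        then show ?thesis using s[of n] \<rho>[of n] by (simp add: abs_mult)
      qed
      have z: "(\<lambda>n. (s n * \<rho> n) *\<^sub>R v n t) \<longlonglongrightarrow> 0"
        by (rule Lim_null_comparison[OF always_eventually z0]) (use z1 in blast)
      have g1: "(\<lambda>n. gW t (u n t + (s n * \<rho> n) *\<^sub>R v n t)) \<longlonglongrightarrow> gW t (U m l t + 0)"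
        using continuous_on_tendsto_compose[OF cont_gW tendsto_Pair[OF tendsto_const tendsto_add[OF u z]], of t] by simp
      have g2: "(\<lambda>n. gW t (u n t)) \<longlonglongrightarrow> gW t (U m l t)"
        using continuous_on_tendsto_compose[OF cont_gW tendsto_Pair[OF tendsto_const u], of t] by simp
      have f0: "(\<lambda>n. norm (gW t (u n t + (s n * \<rho> n) *\<^sub>R v n t) - gW t (u n t)) * E m t) \<longlonglongrightarrow> 0"
        using tendsto_mult_right[OF tendsto_norm[OF tendsto_diff[OF g1 g2]], of "E m t"] by simp
      have f1: "norm (f n t) \<le> norm (gW t (u n t + (s n * \<rho> n) *\<^sub>R v n t) - gW t (u n t)) * E m t" for n
        unfolding fs real_norm_def
        by (rule order_trans[OF Cauchy_Schwarz_ineq2 mult_left_mono[OF v_le norm_ge_zero]])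
      show "(\<lambda>n. f n t) \<longlonglongrightarrow> 0"
        by (rule Lim_null_comparison[OF always_eventually f0]) (use f1 in blast)
    qed
  qed simp
  then have lim0: "(\<lambda>n. \<bar>LBINT t. f n t\<bar>) \<longlonglongrightarrow> 0" using tendsto_rabs_zero by simp
  have ge: "\<epsilon> \<le> \<bar>LBINT t. f n t\<bar>" for n
  proof -
    have "\<epsilon> * \<rho> n < \<rho> n * \<bar>LBINT t. f n t\<bar>"
      using er[of "r n"] \<rho>[of n] unfolding err_f by (simp add: abs_mult \<rho>_def)
    then show ?thesis using \<rho>[of n] by (simp add: mult.commute)
  qed
  have "\<epsilon> \<le> 0" by (rule LIMSEQ_le_const[OF lim0]) (use ge in blast)
  then show False using eps by simp
qed

lemma J_increment:
  assumes eps: "\<epsilon> > 0"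
  shows "\<exists>s>0. \<forall>c\<in>V m. \<forall>d\<in>V m. N m c \<le> b \<longrightarrow> N m d \<le> s \<longrightarrow>
    \<bar>J m (\<lambda>i. c i + d i) - J m c - (\<Sum>i<m. gJ m c i * d i)\<bar> \<le> \<epsilon> * N m d"
proof -
  define \<Lambda> where "\<Lambda> = (\<Sum>i<m. \<bar>lam i\<bar>) + 1"
  have L: "\<Lambda> \<ge> 1" unfolding \<Lambda>_def by (simp add: sum_nonneg)
  obtain s1 where s1: "s1 > 0" and W: "\<And>c d. c \<in> V m \<Longrightarrow> d \<in> V m \<Longrightarrow> N m c \<le> b \<Longrightarrow> N m d \<le> s1 \<Longrightarrow>
     \<bar>(LBINT t. W t (U m c t + U m d t)) - (LBINT t. W t (U m c t)) - (LBINT t. gW t (U m c t) \<bullet> U m d t)\<bar> \<le> \<epsilon> / 2 * N m d"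
    using W_integral_increment[of "\<epsilon> / 2" m b] eps by (meson half_gt_zero)
  \<comment> \<open>For increments below \<open>\<epsilon> / \<Lambda>\<close> the quadratic
    remainder is at most \<open>\<epsilon> / 2\<close> times the norm; the integral uses the other
    half.\<close>
  define s where "s = min s1 (\<epsilon> / \<Lambda>)"
  have "\<bar>J m (\<lambda>i. c i + d i) - J m c - (\<Sum>i<m. gJ m c i * d i)\<bar> \<le> \<epsilon> * N m d"
    if cd: "c \<in> V m" "d \<in> V m" "N m c \<le> b" "N m d \<le> s" for c d
  proof -
    have q: "\<bar>\<Sum>i<m. lam i * (d i)\<^sup>2\<bar> \<le> \<epsilon> * N m d"
    proof -
      have "\<bar>\<Sum>i<m. lam i * (d i)\<^sup>2\<bar> \<le> (\<Sum>i<m. \<bar>lam i * (d i)\<^sup>2\<bar>)" by (rule sum_abs)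
      also have "\<dots> \<le> (\<Sum>i<m. \<bar>lam i\<bar> * (N m d)\<^sup>2)"
      proof (rule sum_mono)
        fix i assume "i \<in> {..<m}"
        then have "\<bar>d i\<bar>\<^sup>2 \<le> (N m d)\<^sup>2" by (intro power_mono N_coord) auto
        then show "\<bar>lam i * (d i)\<^sup>2\<bar> \<le> \<bar>lam i\<bar> * (N m d)\<^sup>2" by (simp add: abs_mult mult_left_mono)
      qed
      also have "\<dots> = (\<Sum>i<m. \<bar>lam i\<bar>) * (N m d)\<^sup>2" by (simp add: sum_distrib_right)
      also have "\<dots> \<le> \<Lambda> * (N m d)\<^sup>2" by (intro mult_right_mono) (simp_all add: \<Lambda>_def)
      also have "\<dots> \<le> \<Lambda> * ((\<epsilon> / \<Lambda>) * N m d)"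
        unfolding power2_eq_square using cd(4) L N_nonneg[of m d]
        by (intro mult_left_mono mult_right_mono) (auto simp: s_def)
      also have "\<dots> = \<epsilon> * N m d" using L by simp
      finally show ?thesis .
    qed
    have sq: "(\<Sum>i<m. lam i * (c i + d i)\<^sup>2) = (\<Sum>i<m. lam i * (c i)\<^sup>2) + 2 * (\<Sum>i<m. lam i * (c i * d i)) + (\<Sum>i<m. lam i * (d i)\<^sup>2)"
      unfolding sum_distrib_left sum.distrib[symmetric]
      by (intro sum.cong) (simp_all add: power2_eq_square algebra_simps)
    have eq: "J m (\<lambda>i. c i + d i) - J m c - (\<Sum>i<m. gJ m c i * d i) = (\<Sum>i<m. lam i * (d i)\<^sup>2) / 2
      - ((LBINT t. W t (U m c t + U m d t)) - (LBINT t. W t (U m c t)) - (LBINT t. gW t (U m c t) \<bullet> U m d t))"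
      unfolding gJ_inner J_def sq U_add by (simp add: field_simps)
    have "N m d \<le> s1" using cd(4) by (simp add: s_def)
    from W[OF cd(1,2,3) this] q show ?thesis unfolding eq by linarith
  qed
  moreover have "s > 0" using s1 eps L by (simp add: s_def)
  ultimately show ?thesis by blast
qed

lemma N_le_form: "N m c \<le> sqrt (a (U m c) (U m c))"
proof -
  have "(N m c)\<^sup>2 \<le> a (U m c) (U m c)" unfolding N_square l2_UU[symmetric] by (rule le[OF U_dom])
  then show ?thesis by (rule real_le_rsqrt)
qed

text \<open>Since \<open>2 J(c) - \<langle>J'(c), c\<rangle>\<close> is minus the integral of \<open>2 W - \<nabla>W \<cdot> u\<close>, the growth conditions and the
  \<open>L\<^sup>1\<close> bound control the square of the \<open>L\<^sup>2\<close> norm by \<open>X + X powr (3 - \<nu>)\<close>, where \<open>X\<close> is the energy norm;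
  on the other hand \<open>X\<^sup>2\<close> is at most \<open>X\<close> plus a multiple of that square.\<close>

lemma palais_smale_bound:
  "\<exists>B. \<forall>m c. 0 \<le> J m c \<longrightarrow> N m (gJ m c) \<le> 1 \<longrightarrow> a (U m c) (U m c) \<le> B"
proof -
  obtain K where K: "K > 0" "\<And>u. u \<in> Dom \<Longrightarrow> (LBINT t. norm (u t)) \<le> K * sqrt (a u u)" by (rule dom_l1) blast
  \<comment> \<open>Coefficients of \<open>X <= D + D' * (2 * X) powr (2 - \<nu>)\<close>, the
    inequality that is left after dividing the energy estimate by \<open>X\<close>.\<close>
  define D where "D = 1 + (b1 + c0) * (r1 * K)"
  define D' where "D' = (b1 + c0) * ((1 + b3 * K) / b2)"
  have DD: "0 \<le> D" "0 \<le> D'" using constants K by (simp_all add: D_def D'_def)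
  obtain B where B: "B \<ge> 1" "\<And>X. X \<ge> 0 \<Longrightarrow> X \<le> D + D' * (2 * X) powr (2 - \<nu>) \<Longrightarrow> X \<le> B"
    using sublinear_bound[of "2 - \<nu>" D D'] constants DD by auto
  have "a (U m c) (U m c) \<le> B\<^sup>2" if J0: "0 \<le> J m c" and g1: "N m (gJ m c) \<le> 1" for m c
  proof -
    define u where "u = U m c"
    define X where "X = sqrt (a u u)"
    define Wt where "Wt t = 2 * W t (u t) - gW t (u t) \<bullet> u t" for t
    have u: "u \<in> Dom" by (simp add: u_def U_dom)
    have X0: "X \<ge> 0" and X2: "X\<^sup>2 = a u u" using F.nonneg[OF u] by (simp_all add: X_def)
    have sup: "norm (u t) \<le> 2 * X" for t
      using real_sqrt_le_mono[OF dom_sup[OF u, of t]] by (simp add: X_def real_sqrt_mult)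
    define gc where "gc = (\<Sum>i<m. gJ m c i * c i)"
    have gc: "\<bar>gc\<bar> \<le> X"
    proof -
      have "\<bar>gc\<bar> \<le> N m (gJ m c) * N m c" unfolding gc_def by (rule N_inner)
      also have "\<dots> \<le> 1 * N m c" using g1 N_nonneg by (intro mult_right_mono) auto
      finally show ?thesis using N_le_form[of m c] by (simp add: X_def u_def)
    qed
    have gc_eq: "gc = (\<Sum>i<m. lam i * (c i)\<^sup>2) - (LBINT t. gW t (u t) \<bullet> u t)"
      unfolding gc_def gJ_inner u_def by (simp add: power2_eq_square)
    have WtI: "integrable lborel Wt" unfolding Wt_def
      using W_integrable[OF u] gW_integrable[OF u u] by simp
    have "(LBINT t. Wt t) = 2 * (LBINT t. W t (u t)) - (LBINT t. gW t (u t) \<bullet> u t)"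
      unfolding Wt_def using W_integrable[OF u] gW_integrable[OF u u] by simp
    then have IWt: "(LBINT t. Wt t) \<le> X" using gc J0 unfolding gc_eq J_def u_def[symmetric] by linarith
    have nI: "integrable lborel (\<lambda>t. norm (u t))" by (rule norm_integrable[OF u])
    define P where "P = (2 * X) powr (2 - \<nu>)"
    have P0: "P \<ge> 0" by (simp add: P_def)
    \<comment> \<open>Where \<open>|u| >= r1\<close>, split \<open>|u|^2\<close> into the powers
      \<open>2 - \<nu>\<close> and \<open>\<nu>\<close>, and use the uniform bound
      \<open>2 X\<close> for the first and (W2) for the second. Where \<open>|u| < r1\<close>, (W3)
      makes the bracket nonnegative and the first term suffices.\<close>
    have pt: "u t \<bullet> u t \<le> r1 * norm (u t) + P / b2 * (Wt t + b3 * norm (u t))" for t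
    proof (cases "norm (u t) < r1")
      case True
      have "u t \<bullet> u t = norm (u t) * norm (u t)" by (simp add: power2_norm_eq_inner flip: power2_eq_square)
      also have "\<dots> \<le> r1 * norm (u t)" using True by (intro mult_right_mono) auto
      finally have 1: "u t \<bullet> u t \<le> r1 * norm (u t)" .
      have "0 \<le> Wt t + b3 * norm (u t)" using Wt_small[OF True, of t] by (simp add: Wt_def)
      then have "0 \<le> P / b2 * (Wt t + b3 * norm (u t))" using P0 constants by (intro mult_nonneg_nonneg) auto
      then show ?thesis using 1 by linarith
    next
      case False
      then have n: "norm (u t) \<ge> r1" and n0: "norm (u t) > 0" using constants by linarith+
      have "u t \<bullet> u t = norm (u t) powr 2" using n0 by (simp add: power2_norm_eq_inner[symmetric])
      also have "\<dots> = norm (u t) powr (2 - \<nu>) * norm (u t) powr \<nu>" using n0 by (simp flip: powr_add)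
      also have "\<dots> \<le> P * norm (u t) powr \<nu>"
        unfolding P_def using sup[of t] constants n0 by (intro mult_right_mono powr_mono2) auto
      also have "\<dots> \<le> P * (Wt t / b2)"
        using Wt_large[OF n, of t] constants P0 by (intro mult_left_mono) (auto simp: Wt_def field_simps)
      finally have 1: "u t \<bullet> u t \<le> P / b2 * Wt t" by simp
      have "0 \<le> r1 * norm (u t)" "0 \<le> P / b2 * (b3 * norm (u t))" using constants P0 by simp_all
      then show ?thesis using 1 by (simp only: distrib_left)
    qed
    have "l2 u u \<le> (LBINT t. r1 * norm (u t) + P / b2 * (Wt t + b3 * norm (u t)))"
      unfolding l2_def
      by (rule integral_mono[OF dom_square(1)[OF u] _ pt]) (use nI WtI in simp)
    also have "\<dots> = r1 * (LBINT t. norm (u t)) + P / b2 * ((LBINT t. Wt t) + b3 * (LBINT t. norm (u t)))"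
      using nI WtI by simp
    also have "\<dots> \<le> r1 * (K * X) + P / b2 * (X + b3 * (K * X))"
      using K(2)[OF u] IWt constants P0 unfolding X_def[symmetric]
      by (intro add_mono mult_left_mono) auto
    finally have l2_le: "l2 u u \<le> X * (r1 * K + P * ((1 + b3 * K) / b2))"
      by (simp add: algebra_simps add_divide_distrib)
    have "(LBINT t. gW t (u t) \<bullet> u t) \<le> b1 * l2 u u"
      using gW_integral_le[OF u u] H.nonneg[OF u] by simp
    then have "X\<^sup>2 \<le> X + (b1 + c0) * l2 u u"
      using a_UU_lam[of m c] gc gc_eq unfolding X2 l2_UU[symmetric] u_def[symmetric]
      by (simp add: distrib_right)
    also have "\<dots> \<le> X + (b1 + c0) * (X * (r1 * K + P * ((1 + b3 * K) / b2)))"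
      using constants by (intro add_left_mono mult_left_mono l2_le) auto
    also have "\<dots> = X * (D + D' * P)" by (simp add: D_def D'_def algebra_simps)
    finally have XX: "X * X \<le> X * (D + D' * P)" by (simp add: power2_eq_square)
    have "X \<le> B"
    proof (cases "X = 0")
      case False
      then have "X \<le> D + D' * P" using XX X0 by (simp add: mult_le_cancel_left)
      then show ?thesis using B(2)[OF X0] by (simp add: P_def)
    qed (use B in simp)
    then have "X\<^sup>2 \<le> B\<^sup>2" using X0 by (rule power_mono)
    then show ?thesis by (simp add: X2 u_def)
  qed
  then show ?thesis by blast
qed

section \<open>The linking geometry\<close>

lemma lam_mono: "i \<le> j \<Longrightarrow> lam i \<le> lam j"
  using incseqD[OF mu_mono] by (simp add: lam_def)

text \<open>Without components below \<open>k\<close> the energy on the sphere is at most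
  \<open>q * \<rho>\<^sup>2\<close>, so by \<open>dom_sup\<close> the choice of
  \<open>\<rho>\<close> keeps the functions within the range \<open>r2\<close> of (W4); there the
  gap \<open>s0\<close> leaves \<open>\<rho>\<^sup>2 * s0 / (2 * l)\<close>. No constant depends on
  \<open>m\<close>.\<close>

lemma sphere_bound:
  "\<exists>\<rho>>0. \<exists>\<delta>>0. \<forall>m c. (\<forall>i<k. c i = 0) \<longrightarrow> (\<Sum>i=k..<m. lam i * (c i)\<^sup>2) = \<rho>\<^sup>2 \<longrightarrow> k < m \<longrightarrow> \<delta> \<le> J m c"
proof -
  define l where "l = lam k"
  have l: "l > 0" using gap(1) by (simp add: l_def lam_def)
  define q where "q = 1 + c0 / l"
  have q: "q \<ge> 1" using l constants by (simp add: q_def)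
  define \<rho> where "\<rho> = r2 / (2 * sqrt q)"
  have \<rho>: "\<rho> > 0" using q constants by (simp add: \<rho>_def)
  define \<delta> where "\<delta> = \<rho>\<^sup>2 * s0 / (2 * l)"
  have \<delta>: "\<delta> > 0" using \<rho> constants l by (simp add: \<delta>_def)
  have "\<delta> \<le> J m c" if c: "\<forall>i<k. c i = 0" and sp: "(\<Sum>i=k..<m. lam i * (c i)\<^sup>2) = \<rho>\<^sup>2" and km: "k < m" for m c
  proof -
    define S where "S = (\<Sum>i<m. (c i)\<^sup>2)"
    have lamS: "(\<Sum>i<m. lam i * (c i)\<^sup>2) = \<rho>\<^sup>2"
    proof -
      have "(\<Sum>i=0..<k. lam i * (c i)\<^sup>2) = 0" by (rule sum.neutral) (use c in simp)
      then show ?thesis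
        using sum.atLeastLessThan_concat[of 0 k m "\<lambda>i. lam i * (c i)\<^sup>2"] km sp by (simp add: lessThan_atLeast0)
    qed
    have lS: "l * S \<le> \<rho>\<^sup>2"
    proof -
      have "l * S = (\<Sum>i<m. l * (c i)\<^sup>2)" by (simp add: S_def sum_distrib_left)
      also have "\<dots> \<le> (\<Sum>i<m. lam i * (c i)\<^sup>2)"
      proof (rule sum_mono)
        fix i
        show "l * (c i)\<^sup>2 \<le> lam i * (c i)\<^sup>2"
          using c lam_mono[of k i] by (cases "i < k") (auto simp: l_def intro: mult_right_mono)
      qed
      finally show ?thesis by (simp add: lamS)
    qed
    have Sle: "S \<le> \<rho>\<^sup>2 / l" using lS l by (simp add: pos_le_divide_eq mult.commute)
    have "a (U m c) (U m c) = \<rho>\<^sup>2 + c0 * S" unfolding a_UU_lam lamS S_def ..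
    also have "\<dots> \<le> \<rho>\<^sup>2 + c0 * (\<rho>\<^sup>2 / l)" using Sle constants by (intro add_left_mono mult_left_mono) auto
    also have "\<dots> = q * \<rho>\<^sup>2" by (simp add: q_def algebra_simps)
    finally have aU: "a (U m c) (U m c) \<le> q * \<rho>\<^sup>2" .
    have "norm (U m c t) \<le> r2" for t
    proof -
      have "(norm (U m c t))\<^sup>2 \<le> 4 * (q * \<rho>\<^sup>2)" using dom_sup[OF U_dom, of m c t] aU by linarith
      also have "\<dots> = r2\<^sup>2" using q by (simp add: \<rho>_def power_divide power_mult_distrib)
      finally show ?thesis by (rule power2_le_imp_le) (use constants in simp)
    qed
    then have Wle: "W t (U m c t) \<le> (l - s0) / 2 * (U m c t \<bullet> U m c t)" for t
      using W_small[of "U m c t" t] by (simp add: l_def lam_def power2_norm_eq_inner)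
    have "(LBINT t. W t (U m c t)) \<le> (LBINT t. (l - s0) / 2 * (U m c t \<bullet> U m c t))"
      by (rule integral_mono[OF W_integrable[OF U_dom] _ Wle]) (use dom_square(1)[OF U_dom] in simp)
    also have "\<dots> = (l - s0) / 2 * S" using l2_UU[of m c] by (simp add: S_def l2_def)
    also have "\<dots> \<le> (l - s0) / 2 * (\<rho>\<^sup>2 / l)"
      using Sle constants(10) by (intro mult_left_mono) (auto simp: l_def lam_def)
    finally have "J m c \<ge> \<rho>\<^sup>2 / 2 - (l - s0) / 2 * (\<rho>\<^sup>2 / l)" unfolding J_def lamS by simp
    also have "\<rho>\<^sup>2 / 2 - (l - s0) / 2 * (\<rho>\<^sup>2 / l) = \<delta>" using l by (simp add: \<delta>_def field_simps)
    finally show ?thesis .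
  qed
  then show ?thesis using \<rho> \<delta> by (intro exI[of _ \<rho>] exI[of _ \<delta>] conjI allI impI)
qed

lemma J_le_quadratic: "J m c \<le> (\<Sum>i<m. lam i * (c i)\<^sup>2) / 2"
  unfolding J_def using integral_nonneg_AE[OF AE_I2[OF W_nonneg], of lborel "\<lambda>t. t" "\<lambda>t. U m c t"] by simp

text \<open>With \<open>c k = 0\<close> only nonpositive eigenvalues occur and \<open>W >= 0\<close>
  is enough. Otherwise the quadratic part is at most \<open>l / 2\<close> times the square norm,
  (W5) subtracts \<open>l / 2 + eps\<close> times it, and the error from the region
  \<open>|u| < rinf\<close> is linear in the norm by the \<open>L^1\<close> bound; hence large norms
  give \<open>J <= 0\<close>.\<close>

lemma low_bound:
  "\<exists>R0>0. \<forall>R\<ge>R0. \<forall>m c. k < m \<longrightarrow> (\<forall>i>k. c i = 0) \<longrightarrow> c k = 0 \<or> (\<exists>i\<le>k. \<bar>c i\<bar> \<ge> R) \<longrightarrow> J m c \<le> 0"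
proof -
  define l where "l = lam k"
  have l: "l > 0" using gap(1) by (simp add: l_def lam_def)
  have mu: "\<mu> k > 0" using gap(1) constants by simp
  obtain K where K: "K > 0" "\<And>u. u \<in> Dom \<Longrightarrow> (LBINT t. norm (u t)) \<le> K * sqrt (a u u)" by (rule dom_l1) blast
  define K' where "K' = (l / 2 + eps) * rinf * K * sqrt (\<mu> k)"
  have K': "K' > 0" using K l mu constants by (simp add: K'_def)
  define R0 where "R0 = K' / eps"
  have "J m c \<le> 0" if R: "R \<ge> R0" and km: "k < m" and c: "\<forall>i>k. c i = 0" and alt: "c k = 0 \<or> (\<exists>i\<le>k. \<bar>c i\<bar> \<ge> R)" for R m c
  proof (cases "c k = 0")
    case True
    have "(\<Sum>i<m. lam i * (c i)\<^sup>2) \<le> 0"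
    proof (rule sum_nonpos)
      fix i
      show "lam i * (c i)\<^sup>2 \<le> 0"
        using True c gap(2)[of i] by (cases i k rule: linorder_cases) (auto simp: lam_def mult_nonpos_nonneg)
    qed
    then show ?thesis using J_le_quadratic[of m c] by simp
  next
    case False
    then obtain i where i: "i \<le> k" "\<bar>c i\<bar> \<ge> R" using alt by blast
    define u where "u = U m c"
    have u: "u \<in> Dom" by (simp add: u_def U_dom)
    define S where "S = N m c"
    have S0: "S \<ge> 0" by (simp add: S_def N_nonneg)
    have SR: "S \<ge> R0" using i km N_coord[of i m c] R by (simp add: S_def)
    have S2: "S\<^sup>2 = l2 u u" by (simp add: S_def N_square u_def l2_UU)
    have lamS: "(\<Sum>i<m. lam i * (c i)\<^sup>2) \<le> l * S\<^sup>2"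
      unfolding S_def N_square sum_distrib_left
    proof (rule sum_mono)
      fix i
      show "lam i * (c i)\<^sup>2 \<le> l * (c i)\<^sup>2"
        using c lam_mono[of i k] by (cases "i \<le> k") (auto simp: l_def intro: mult_right_mono)
    qed
    have "a u u \<le> \<mu> k * S\<^sup>2"
      unfolding u_def a_UU S_def N_square sum_distrib_left
    proof (rule sum_mono)
      fix i
      show "\<mu> i * (c i)\<^sup>2 \<le> \<mu> k * (c i)\<^sup>2"
        using c incseqD[OF mu_mono, of i k] by (cases "i \<le> k") (auto intro: mult_right_mono)
    qed
    from real_sqrt_le_mono[OF this] have aS: "sqrt (a u u) \<le> sqrt (\<mu> k) * S" using S0 by (simp add: real_sqrt_mult)
    have pt: "(l / 2 + eps) * (u t \<bullet> u t) - (l / 2 + eps) * rinf * norm (u t) \<le> W t (u t)" for t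
    proof (cases "norm (u t) \<ge> rinf")
      case True
      have "0 \<le> (l / 2 + eps) * rinf * norm (u t)" using l constants by simp
      then show ?thesis using W_large[OF True, of t] by (simp add: l_def lam_def power2_norm_eq_inner)
    next
      case False
      have "(l / 2 + eps) * (norm (u t) * norm (u t)) \<le> (l / 2 + eps) * (rinf * norm (u t))"
        using False l constants by (intro mult_left_mono mult_right_mono) auto
      then show ?thesis using W_nonneg[of t "u t"] by (simp add: power2_norm_eq_inner[symmetric] power2_eq_square)
    qed
    have "(l / 2 + eps) * S\<^sup>2 - (l / 2 + eps) * rinf * (LBINT t. norm (u t)) =
        (LBINT t. (l / 2 + eps) * (u t \<bullet> u t) - (l / 2 + eps) * rinf * norm (u t))"
      using dom_square(1)[OF u] norm_integrable[OF u] by (simp add: S2 l2_def)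
    also have "\<dots> \<le> (LBINT t. W t (u t))"
      by (rule integral_mono[OF _ W_integrable[OF u] pt]) (use dom_square(1)[OF u] norm_integrable[OF u] in simp)
    finally have IW: "(l / 2 + eps) * S\<^sup>2 - (l / 2 + eps) * rinf * (LBINT t. norm (u t)) \<le> (LBINT t. W t (u t))" .
    have "(l / 2 + eps) * rinf * (LBINT t. norm (u t)) \<le> (l / 2 + eps) * rinf * (K * (sqrt (\<mu> k) * S))"
      using l constants K(1) by (intro mult_left_mono order_trans[OF K(2)[OF u]] aS) auto
    also have "\<dots> = K' * S" by (simp add: K'_def)
    finally have "J m c \<le> l * S\<^sup>2 / 2 - ((l / 2 + eps) * S\<^sup>2 - K' * S)"
      using IW lamS unfolding J_def u_def[symmetric] by linarith
    also have "\<dots> = S * (K' - eps * S)" by (simp add: power2_eq_square algebra_simps)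
    also have "\<dots> \<le> 0"
      using S0 SR constants by (intro mult_nonneg_nonpos) (auto simp: R0_def field_simps)
    finally show ?thesis .
  qed
  moreover have "R0 > 0" using K' constants by (simp add: R0_def)
  ultimately show ?thesis by blast
qed

lemma almost_critical:
  "\<exists>\<delta>>0. \<forall>m>k. \<forall>\<epsilon>>0. \<exists>c. \<delta> \<le> J m c \<and> N m (gJ m c) \<le> \<epsilon>"
proof -
  obtain \<rho> \<delta> where \<rho>: "\<rho> > 0" and \<delta>: "\<delta> > 0"
    and sph: "\<And>m c. \<forall>i<k. c i = 0 \<Longrightarrow> (\<Sum>i=k..<m. lam i * (c i)\<^sup>2) = \<rho>\<^sup>2 \<Longrightarrow> k < m \<Longrightarrow> \<delta> \<le> J m c"
    using sphere_bound by blast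
  obtain R0 where R0: "R0 > 0" and low: "\<And>R m c. R \<ge> R0 \<Longrightarrow> k < m \<Longrightarrow> \<forall>i>k. c i = 0 \<Longrightarrow>
      c k = 0 \<or> (\<exists>i\<le>k. \<bar>c i\<bar> \<ge> R) \<Longrightarrow> J m c \<le> 0"
    using low_bound by blast
  have lk: "lam k > 0" using gap(1) by (simp add: lam_def)
  \<comment> \<open>Large enough for \<open>low_bound\<close>, and for the box to reach at least to
    the sphere in direction \<open>k\<close>.\<close>
  define R where "R = max R0 (\<rho> / sqrt (lam k))"
  have R: "R > 0" "R \<ge> R0" using R0 by (auto simp: R_def)
  have R2: "\<rho>\<^sup>2 \<le> lam k * R\<^sup>2"
  proof -
    have "(\<rho> / sqrt (lam k))\<^sup>2 \<le> R\<^sup>2" using \<rho> lk by (intro power_mono) (auto simp: R_def)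
    then show ?thesis using lk by (simp add: power_divide field_simps)
  qed
  have "\<exists>c. \<delta> / 2 \<le> J m c \<and> N m (gJ m c) \<le> \<epsilon>" if km: "k < m" and eps: "\<epsilon> > 0" for m \<epsilon>
  proof -
    have "\<exists>c\<in>{c. \<forall>i\<ge>m. c i = 0}. \<delta> / 2 \<le> J m c \<and> L2_set (gJ m c) {..<m} \<le> \<epsilon>"
    proof (rule linking_almost_critical[where J="J m" and g="gJ m" and lam=lam and k=k and m=m and \<rho>=\<rho> and \<delta>=\<delta>
          and R=R and C="lam k * (R\<^sup>2 * m)" and \<epsilon>=\<epsilon>])
      show "k < m" by (rule km)
      show "continuous_on UNIV (J m)" by (rule continuous_on_sequenceI) (rule J_tendsto)
      show "continuous_on UNIV (\<lambda>c. gJ m c i)" for i by (rule continuous_on_sequenceI) (rule gJ_tendsto)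
      show "\<exists>s>0. \<forall>c\<in>{c. \<forall>i\<ge>m. c i = 0}. \<forall>d\<in>{c. \<forall>i\<ge>m. c i = 0}. L2_set c {..<m} \<le> b \<longrightarrow> L2_set d {..<m} \<le> s \<longrightarrow>
        \<bar>J m (\<lambda>i. c i + d i) - J m c - (\<Sum>i<m. gJ m c i * d i)\<bar> \<le> \<epsilon> * L2_set d {..<m}" if "\<epsilon> > 0" for b \<epsilon>
        using J_increment[OF that, of m b] unfolding V_def N_def .
      show "\<delta> \<le> J m c" if "\<And>i. i < k \<Longrightarrow> c i = 0" "(\<Sum>i=k..<m. lam i * (c i)\<^sup>2) = \<rho>\<^sup>2" for c
        using sph[OF _ that(2) km] that(1) by blast
      show "J m c \<le> 0" if "\<And>i. i > k \<Longrightarrow> c i = 0" "c k = 0 \<or> (\<exists>i\<le>k. \<bar>c i\<bar> \<ge> R)" for c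
        using low[OF R(2) km _ that(2)] that(1) by blast
      show "J m c \<le> lam k * (R\<^sup>2 * m)" if c: "\<And>i. i > k \<Longrightarrow> c i = 0" "\<And>i. \<bar>c i\<bar> \<le> R" for c
      proof -
        have "(\<Sum>i<m. lam i * (c i)\<^sup>2) \<le> (\<Sum>i<m. lam k * R\<^sup>2)"
        proof (rule sum_mono)
          fix i
          have sq: "(c i)\<^sup>2 \<le> R\<^sup>2" using c(2)[of i] by (simp add: abs_le_square_iff[symmetric])
          have "lam i * (c i)\<^sup>2 \<le> lam k * (c i)\<^sup>2"
            using c(1)[of i] lam_mono[of i k] by (cases "i \<le> k") (auto intro: mult_right_mono)
          also have "\<dots> \<le> lam k * R\<^sup>2" using sq lk by (intro mult_left_mono) auto
          finally show "lam i * (c i)\<^sup>2 \<le> lam k * R\<^sup>2" .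
        qed
        also have "\<dots> = lam k * (R\<^sup>2 * m)" by simp
        finally have "(\<Sum>i<m. lam i * (c i)\<^sup>2) \<le> lam k * (R\<^sup>2 * m)" .
        moreover have "0 \<le> lam k * (R\<^sup>2 * m)" using lk by simp
        ultimately show ?thesis using J_le_quadratic[of m c] by linarith
      qed
      show "\<delta> > 0" "R > 0" "0 \<le> lam k * (R\<^sup>2 * m)" "\<epsilon> > 0" using \<delta> R eps lk by simp_all
      show "\<rho>\<^sup>2 \<le> lam k * R\<^sup>2" by (rule R2)
    qed
    then show ?thesis unfolding N_def by blast
  qed
  then show ?thesis using \<delta> by (intro exI[of _ "\<delta> / 2"]) auto
qed

text \<open>Stands in for weak convergence: against a fixed hat, \<open>a\<close> equals a single
  truncation, for which bounded pointwise convergence suffices.\<close>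

lemma a_hat_tendsto:
  assumes u: "\<And>j. u j \<in> Dom" "w \<in> Dom" and lim: "\<And>t. (\<lambda>j. u j t) \<longlonglongrightarrow> w t" and bd: "\<And>j t. norm (u j t) \<le> C"
  shows "(\<lambda>j. a (u j) (hat m p v)) \<longlonglongrightarrow> a w (hat m p v)"
proof -
  obtain n where n: "m \<le> n" "\<bar>p\<bar> + 1 \<le> int n * 2 ^ m" using ex_large by blast
  have "a z (hat m p v) = trunc n z (hat m p v)" if "z \<in> Dom" for z
    using form_hat[OF that] trunc_hat[OF n dom_cont[OF that]] by simp
  then have eq: "a (u j) (hat m p v) = trunc n (u j) (hat m p v)" "a w (hat m p v) = trunc n w (hat m p v)" for j
    using u by simp_all
  show ?thesis unfolding eq
    by (rule trunc_tendsto(1)[OF dom_cont[OF u(1)] dom_cont[OF u(2)] continuous_hat lim bd])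
qed

text \<open>Almost criticality controls only directions in the span of the first \<open>M j\<close>
  eigenfunctions, where a hat need not lie. Its projection replaces it in the gradient term, with an
  error that tends to 0 in \<open>L^2\<close>; the quadratic part sees only the projected
  coefficients anyway.\<close>

theorem homoclinic_solution:
  "\<exists>u u'. (\<forall>t. (u has_vector_derivative u' t) (at t) \<and>
      (u' has_vector_derivative (A t (u t) - c0 *\<^sub>R u t - gW t (u t))) (at t)) \<and>
    (u \<longlongrightarrow> 0) at_infinity \<and> (\<exists>t. u t \<noteq> 0)"
proof -
  obtain \<delta> where \<delta>: "\<delta> > 0" and crit: "\<And>m \<epsilon>. m > k \<Longrightarrow> \<epsilon> > 0 \<Longrightarrow> \<exists>c. \<delta> \<le> J m c \<and> N m (gJ m c) \<le> \<epsilon>"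
    using almost_critical by blast
  \<comment> \<open>Dimensions above \<open>k\<close>, as the linking requires; they tend to
    infinity while the tolerance \<open>1 / (j + 1)\<close> tends to 0.\<close>
  define M where "M j = j + Suc k" for j
  have "\<forall>j. \<exists>c. \<delta> \<le> J (M j) c \<and> N (M j) (gJ (M j) c) \<le> inverse (real (Suc j))"
    using crit by (simp add: M_def)
  from choice[OF this] obtain c where c': "\<forall>j. \<delta> \<le> J (M j) (c j) \<and> N (M j) (gJ (M j) (c j)) \<le> inverse (real (Suc j))"
    by (rule exE)
  have Jc: "\<delta> \<le> J (M j) (c j)" and gc: "N (M j) (gJ (M j) (c j)) \<le> inverse (real (Suc j))" for j
    using c' by simp_all
  obtain B where B: "\<And>m c. 0 \<le> J m c \<Longrightarrow> N m (gJ m c) \<le> 1 \<Longrightarrow> a (U m c) (U m c) \<le> B"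
    using palais_smale_bound by blast
  define u where "u j = U (M j) (c j)" for j
  have u: "u j \<in> Dom" for j by (simp add: u_def U_dom)
  have uB: "a (u j) (u j) \<le> B" for j
    unfolding u_def
  proof (rule B)
    show "0 \<le> J (M j) (c j)" using Jc[of j] \<delta> by simp
    have "inverse (real (Suc j)) \<le> 1" by (simp add: inverse_le_1_iff)
    then show "N (M j) (gJ (M j) (c j)) \<le> 1" using gc[of j] by linarith
  qed
  have bd: "norm (u j t) \<le> sqrt (4 * B)" for j t
    using dom_sup[OF u, of j t] uB[of j] by (intro real_le_rsqrt) linarith
  have "\<exists>r w. strict_mono (r::nat\<Rightarrow>nat) \<and> w \<in> Dom \<and> (\<forall>t. (\<lambda>j. u (r j) t) \<longlonglongrightarrow> w t) \<and>
      (\<lambda>j. l2 (u (r j) - w) (u (r j) - w)) \<longlonglongrightarrow> 0"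
  proof (rule dom_compact[of u B, OF u uB], goal_cases)
    case (1 r w)
    then show ?case by (intro exI[of _ r] exI[of _ w] conjI allI)
  qed
  then obtain r w where rw: "strict_mono (r::nat\<Rightarrow>nat) \<and> w \<in> Dom \<and> (\<forall>t. (\<lambda>j. u (r j) t) \<longlonglongrightarrow> w t) \<and>
      (\<lambda>j. l2 (u (r j) - w) (u (r j) - w)) \<longlonglongrightarrow> 0"
    by (elim exE)
  note r = conjunct1[OF rw] and w = conjunct1[OF conjunct2[OF rw]]
    and lim = spec[OF conjunct1[OF conjunct2[OF conjunct2[OF rw]]]]
    and l2lim = conjunct2[OF conjunct2[OF conjunct2[OF rw]]]
  have inv0: "(\<lambda>j. inverse (real (Suc (r j)))) \<longlonglongrightarrow> 0"
    using LIMSEQ_subseq_LIMSEQ[OF LIMSEQ_inverse_real_of_nat r] by (simp add: o_def)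
  have weak: "a w (hat m p v) = (LBINT t. tent (dyad m p) (1 / 2 ^ m) t * ((gW t (w t) + c0 *\<^sub>R w t) \<bullet> v))" for m p v
  proof -
    define \<phi> where "\<phi> = hat m p v"
    have \<phi>: "\<phi> \<in> Dom" by (simp add: \<phi>_def hat_dom)
    define d where "d i = l2 \<phi> (e i)" for i
    define Pr where "Pr n = U n d" for n
    have Pr: "Pr n \<in> Dom" for n by (simp add: Pr_def U_dom)
    have Plim: "(\<lambda>n. l2 (\<phi> - Pr n) (\<phi> - Pr n)) \<longlonglongrightarrow> 0"
      using e_complete[OF \<phi>] by (simp add: Pr_def U_def d_def)
    \<comment> \<open>Bessel's inequality bounds the coefficients of \<open>\<phi>\<close>
      independently of \<open>n\<close>, so that pairing them with the almost vanishing gradient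
      gives 0 in the limit.\<close>
    have Nd: "N n d \<le> sqrt (l2 \<phi> \<phi>)" for n
    proof -
      have einj: "i = j" if "e i = e j" for i j
      proof -
        have "l2 (e i) (e j) = 1" using e_orth[of i i] that by simp
        then show ?thesis using e_orth[of i j] by (simp split: if_splits)
      qed
      have inj: "inj_on e {..<n}" by (rule inj_onI) (rule einj)
      have o: "H.orthonormal (e ` {..<n})"
        unfolding H.orthonormal_def by (auto simp: e_dom e_orth dest: einj)
      have "(N n d)\<^sup>2 \<le> l2 \<phi> \<phi>"
        using H.bessel[OF o \<phi>] by (simp add: N_square d_def sum.reindex[OF inj])
      then show ?thesis by (rule real_le_rsqrt)
    qed
    have au: "a (u j) \<phi> = (\<Sum>i<M j. gJ (M j) (c j) i * d i) + (LBINT t. gW t (u j t) \<bullet> Pr (M j) t) + c0 * l2 (u j) \<phi>" for j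
    proof -
      have "a (u j) \<phi> = (\<Sum>i<M j. c j i * (\<mu> i * d i))"
        unfolding u_def a_U[OF \<phi>] d_def by (intro sum.cong) (simp_all add: H.sym[OF \<phi> e_dom])
      also have "\<dots> = (\<Sum>i<M j. lam i * (c j i * d i)) + c0 * (\<Sum>i<M j. c j i * d i)"
        by (simp add: lam_def sum_distrib_left algebra_simps flip: sum.distrib)
      also have "(\<Sum>i<M j. c j i * d i) = l2 (u j) \<phi>"
        unfolding u_def l2_U[OF \<phi>] d_def by (intro sum.cong) (simp_all add: H.sym[OF \<phi> e_dom])
      finally show ?thesis unfolding gJ_inner u_def Pr_def by simp
    qed
    have l1: "(\<lambda>j. \<Sum>i<M (r j). gJ (M (r j)) (c (r j)) i * d i) \<longlonglongrightarrow> 0"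
    proof (rule Lim_null_comparison[OF always_eventually], rule allI)
      fix j
      have "\<bar>\<Sum>i<M (r j). gJ (M (r j)) (c (r j)) i * d i\<bar> \<le> N (M (r j)) (gJ (M (r j)) (c (r j))) * N (M (r j)) d" by (rule N_inner)
      also have "\<dots> \<le> inverse (real (Suc (r j))) * sqrt (l2 \<phi> \<phi>)"
        by (intro mult_mono gc Nd N_nonneg) simp
      finally show "norm (\<Sum>i<M (r j). gJ (M (r j)) (c (r j)) i * d i) \<le> inverse (real (Suc (r j))) * sqrt (l2 \<phi> \<phi>)" by simp
    next
      show "(\<lambda>j. inverse (real (Suc (r j))) * sqrt (l2 \<phi> \<phi>)) \<longlonglongrightarrow> 0"
        using tendsto_mult_right[OF inv0, of "sqrt (l2 \<phi> \<phi>)"] by simp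
    qed
    have Mr: "filterlim (\<lambda>j. M (r j)) at_top sequentially"
    proof -
      have "strict_mono (\<lambda>j. M (r j))" using r by (simp add: strict_mono_def M_def)
      then show ?thesis by (rule filterlim_subseq)
    qed
    have l2l: "(\<lambda>j. (LBINT t. gW t (u (r j) t) \<bullet> Pr (M (r j)) t) - (LBINT t. gW t (u (r j) t) \<bullet> \<phi> t)) \<longlonglongrightarrow> 0"
    proof (rule Lim_null_comparison[OF always_eventually], rule allI)
      fix j
      define z where "z = \<phi> - Pr (M (r j))"
      have z: "z \<in> Dom" unfolding z_def by (rule H.mem(2)[OF \<phi> Pr])
      have "(LBINT t. gW t (u (r j) t) \<bullet> Pr (M (r j)) t) - (LBINT t. gW t (u (r j) t) \<bullet> \<phi> t) =
          (LBINT t. gW t (u (r j) t) \<bullet> Pr (M (r j)) t - gW t (u (r j) t) \<bullet> \<phi> t)"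
        by (rule Bochner_Integration.integral_diff[symmetric]) (rule gW_integrable[OF u Pr], rule gW_integrable[OF u \<phi>])
      also have "\<dots> = - (LBINT t. gW t (u (r j) t) \<bullet> z t)"
        by (simp add: z_def inner_diff_right flip: Bochner_Integration.integral_minus)
      finally have "norm ((LBINT t. gW t (u (r j) t) \<bullet> Pr (M (r j)) t) - (LBINT t. gW t (u (r j) t) \<bullet> \<phi> t))
          \<le> b1 * (sqrt (l2 (u (r j)) (u (r j))) * sqrt (l2 z z))"
        using gW_integral_le[OF u z, of "r j"] by simp
      also have "\<dots> \<le> b1 * (sqrt B * sqrt (l2 z z))"
        using constants uB[of "r j"] le[OF u, of "r j"] H.nonneg[OF z]
        by (intro mult_left_mono mult_right_mono) auto
      finally show "norm ((LBINT t. gW t (u (r j) t) \<bullet> Pr (M (r j)) t) - (LBINT t. gW t (u (r j) t) \<bullet> \<phi> t))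
          \<le> b1 * (sqrt B * sqrt (l2 (\<phi> - Pr (M (r j))) (\<phi> - Pr (M (r j)))))" by (simp add: z_def)
    next
      have "(\<lambda>j. l2 (\<phi> - Pr (M (r j))) (\<phi> - Pr (M (r j)))) \<longlonglongrightarrow> 0" by (rule filterlim_compose[OF Plim Mr])
      from tendsto_mult_left[OF tendsto_mult_left[OF tendsto_real_sqrt[OF this]], of b1 "sqrt B"]
      show "(\<lambda>j. b1 * (sqrt B * sqrt (l2 (\<phi> - Pr (M (r j))) (\<phi> - Pr (M (r j)))))) \<longlonglongrightarrow> 0" by simp
    qed
    have l3: "(\<lambda>j. LBINT t. gW t (u (r j) t) \<bullet> \<phi> t) \<longlonglongrightarrow> (LBINT t. gW t (w t) \<bullet> \<phi> t)"
      by (rule gW_tendsto[OF u w \<phi> bd lim])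
    have l4: "(\<lambda>j. l2 (u (r j)) \<phi>) \<longlonglongrightarrow> l2 w \<phi>" by (rule H.tendsto_form[OF u w \<phi> l2lim])
    have "(\<lambda>j. (\<Sum>i<M (r j). gJ (M (r j)) (c (r j)) i * d i) +
        (((LBINT t. gW t (u (r j) t) \<bullet> Pr (M (r j)) t) - (LBINT t. gW t (u (r j) t) \<bullet> \<phi> t)) + (LBINT t. gW t (u (r j) t) \<bullet> \<phi> t)) +
        c0 * l2 (u (r j)) \<phi>) \<longlonglongrightarrow> 0 + (0 + (LBINT t. gW t (w t) \<bullet> \<phi> t)) + c0 * l2 w \<phi>"
      by (rule tendsto_add[OF tendsto_add[OF l1 tendsto_add[OF l2l l3]] tendsto_mult_left[OF l4]])
    then have "(\<lambda>j. a (u (r j)) \<phi>) \<longlonglongrightarrow> (LBINT t. gW t (w t) \<bullet> \<phi> t) + c0 * l2 w \<phi>"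
      unfolding au by simp
    moreover have "(\<lambda>j. a (u (r j)) \<phi>) \<longlonglongrightarrow> a w \<phi>"
      unfolding \<phi>_def by (rule a_hat_tendsto[OF u w lim bd])
    ultimately have "a w \<phi> = (LBINT t. gW t (w t) \<bullet> \<phi> t) + c0 * l2 w \<phi>" by (rule LIMSEQ_unique[symmetric])
    also have "\<dots> = (LBINT t. gW t (w t) \<bullet> \<phi> t + c0 * (w t \<bullet> \<phi> t))"
      using gW_integrable[OF w \<phi>] dom_inner[OF w \<phi>] by (simp add: l2_def)
    also have "\<dots> = (LBINT t. tent (dyad m p) (1 / 2 ^ m) t * ((gW t (w t) + c0 *\<^sub>R w t) \<bullet> v))"
      by (simp add: \<phi>_def hat_def inner_add_left algebra_simps)
    finally show ?thesis by (simp add: \<phi>_def)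
  qed
  have cf: "continuous_on UNIV (\<lambda>t. gW t (w t) + c0 *\<^sub>R w t)"
    by (intro continuous_intros continuous_gW dom_cont w)
  obtain w' where w': "\<And>t. (w has_vector_derivative w' t) (at t)"
    "\<And>t. (w' has_vector_derivative (A t (w t) - (gW t (w t) + c0 *\<^sub>R w t))) (at t)"
    using classical_solution[OF w cf weak] by blast
  \<comment> \<open>If the limit vanished, the \<open>L^2\<close> norms and with them the gradient
    terms would tend to 0; almost criticality then makes the quadratic part small, which contradicts
    \<open>J >= \<delta>\<close> because \<open>W >= 0\<close>.\<close>
  have "\<exists>t. w t \<noteq> 0"
  proof (rule ccontr)
    assume "\<not> ?thesis"
    then have w0: "w = 0" by (simp add: fun_eq_iff)
    have "\<delta> \<le> inverse (real (Suc (r j))) * sqrt B / 2 + b1 * l2 (u (r j)) (u (r j)) / 2" for j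
    proof -
      define x where "x = u (r j)"
      have x: "x \<in> Dom" by (simp add: x_def u)
      have eq: "(\<Sum>i<M (r j). gJ (M (r j)) (c (r j)) i * c (r j) i) =
          (\<Sum>i<M (r j). lam i * (c (r j) i)\<^sup>2) - (LBINT t. gW t (x t) \<bullet> x t)"
        unfolding gJ_inner x_def u_def by (simp add: power2_eq_square)
      have "\<bar>\<Sum>i<M (r j). gJ (M (r j)) (c (r j)) i * c (r j) i\<bar> \<le> N (M (r j)) (gJ (M (r j)) (c (r j))) * N (M (r j)) (c (r j))"
        by (rule N_inner)
      also have "\<dots> \<le> inverse (real (Suc (r j))) * sqrt B"
      proof (rule mult_mono[OF gc _ _ N_nonneg])
        show "N (M (r j)) (c (r j)) \<le> sqrt B"
          by (rule order_trans[OF N_le_form real_sqrt_le_mono[OF uB[of "r j", unfolded u_def]]])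
      qed simp
      finally have 1: "(\<Sum>i<M (r j). lam i * (c (r j) i)\<^sup>2) - (LBINT t. gW t (x t) \<bullet> x t) \<le> inverse (real (Suc (r j))) * sqrt B"
        unfolding eq by linarith
      have 2: "(LBINT t. gW t (x t) \<bullet> x t) \<le> b1 * l2 x x"
        using gW_integral_le[OF x x] H.nonneg[OF x] by simp
      have 3: "\<delta> \<le> (\<Sum>i<M (r j). lam i * (c (r j) i)\<^sup>2) / 2"
        using Jc[of "r j"] J_le_quadratic[of "M (r j)" "c (r j)"] by linarith
      show ?thesis using 1 2 3 unfolding x_def[symmetric] by linarith
    qed
    note ge = this
    have "(\<lambda>j. inverse (real (Suc (r j))) * sqrt B / 2 + b1 * l2 (u (r j)) (u (r j)) / 2) \<longlonglongrightarrow> 0 * sqrt B / 2 + b1 * 0 / 2"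
      using l2lim unfolding w0 diff_zero
      by (intro tendsto_add tendsto_divide tendsto_mult tendsto_const inv0) simp_all
    then have "\<delta> \<le> 0 * sqrt B / 2 + b1 * 0 / 2"
      by (rule LIMSEQ_le_const) (use ge in blast)
    then show False using \<delta> by simp
  qed
  then show ?thesis
    using w' dom_vanishes[OF w] by (intro exI[of _ w] exI[of _ w'] conjI allI) (simp_all add: algebra_simps)
qed

end

section \<open>The homoclinic solution\<close>

definition log_weight :: "real \<Rightarrow> real \<Rightarrow> real \<Rightarrow> real" where
  "log_weight \<alpha> M t = M * \<bar>t\<bar> * (ln \<bar>t\<bar>) powr \<alpha>"

lemma ln_ge_1: "x \<ge> 3 \<Longrightarrow> ln x \<ge> (1::real)"
  using exp_le by (subst ln_ge_iff) linarith+

lemma log_weight_pos: "M > 0 \<Longrightarrow> \<bar>t\<bar> \<ge> 3 \<Longrightarrow> log_weight \<alpha> M t > 0"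
  using ln_ge_1[of "\<bar>t\<bar>"] by (simp add: log_weight_def)

lemma log_weight_at_top:
  assumes "\<alpha> > 1" "M > 0"
  shows "filterlim (log_weight \<alpha> M) at_top at_infinity"
proof (rule filterlim_at_top_mono)
  show "filterlim (\<lambda>t::real. M * norm t) at_top at_infinity"
    by (rule filterlim_tendsto_pos_mult_at_top[OF tendsto_const assms(2) filterlim_norm_at_top])
  have "M * norm t \<le> log_weight \<alpha> M t" if t: "3 \<le> norm t" for t :: real
  proof -
    have "1 \<le> ln \<bar>t\<bar> powr \<alpha>" using ln_ge_1[of "\<bar>t\<bar>"] t assms by (intro ge_one_powr_ge_zero) auto
    then have "M * \<bar>t\<bar> * 1 \<le> M * \<bar>t\<bar> * ln \<bar>t\<bar> powr \<alpha>" using assms by (intro mult_left_mono) auto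
    then show ?thesis by (simp add: log_weight_def)
  qed
  then show "\<forall>\<^sub>F t::real in at_infinity. M * norm t \<le> log_weight \<alpha> M t"
    unfolding eventually_at_infinity by blast
qed

lemma log_weight_integrable:
  assumes \<alpha>: "\<alpha> > 1" and M: "M > 0"
  shows "integrable lborel (\<lambda>t. indicator {t. \<bar>t\<bar> \<ge> 3} t / log_weight \<alpha> M t)"
proof -
  define f where "f t = 1 / (M * t * (ln t) powr \<alpha>)" for t :: real
  have f_meas: "f \<in> borel_measurable borel" unfolding f_def by measurable
  have f0: "f t \<ge> 0" if "t \<ge> 3" for t using that M by (simp add: f_def)
  \<comment> \<open>A primitive of \<open>f\<close> on \<open>t >= 3\<close>; it tends to 0 at
    infinity because \<open>\<alpha> > 1\<close>.\<close>
  define F where "F t = - ((ln t) powr (1 - \<alpha>)) / (M * (\<alpha> - 1))" for t :: real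
  have "(F has_real_derivative f t) (at t)" if t: "t \<ge> 3" for t
  proof -
    have l: "ln t > 0" using ln_ge_1[OF t] by simp
    have "((\<lambda>t. (ln t) powr (1 - \<alpha>)) has_real_derivative (1 - \<alpha>) * (ln t) powr (1 - \<alpha> - 1) * (1 / t)) (at t)"
      by (rule DERIV_fun_powr[THEN DERIV_cong]) (use t l in \<open>auto intro!: derivative_eq_intros\<close>)
    from DERIV_cdivide[OF DERIV_minus[OF this], of "M * (\<alpha> - 1)"]
    have "(F has_real_derivative - ((1 - \<alpha>) * (ln t) powr (1 - \<alpha> - 1) * (1 / t)) / (M * (\<alpha> - 1))) (at t)"
      unfolding F_def .
    moreover have pw: "(ln t) powr (1 - \<alpha> - 1) = 1 / (ln t) powr \<alpha>" by (simp add: powr_minus_divide)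
    have cancel: "- ((1 - \<alpha>) * (1 / P) * (1 / t)) / (M * (\<alpha> - 1)) = 1 / (M * t * P)" if "P > 0" for P
      using that \<alpha> M t by (simp add: divide_simps)
    have "- ((1 - \<alpha>) * (ln t) powr (1 - \<alpha> - 1) * (1 / t)) / (M * (\<alpha> - 1)) = f t"
      unfolding pw f_def by (rule cancel) (use l in simp)
    ultimately show ?thesis by simp
  qed
  note F = this
  have lim: "(F \<longlongrightarrow> 0) at_top"
  proof -
    have "((\<lambda>t. ln t powr (1 - \<alpha>)) \<longlongrightarrow> 0) at_top"
      using \<alpha> by (intro tendsto_neg_powr[OF _ ln_at_top]) simp
    then have "((\<lambda>t. - (ln t powr (1 - \<alpha>)) / (M * (\<alpha> - 1))) \<longlongrightarrow> - 0 / (M * (\<alpha> - 1))) at_top"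
      using \<alpha> M by (intro tendsto_divide tendsto_minus tendsto_const) auto
    then show ?thesis by (simp add: F_def[abs_def])
  qed
  define g where "g t = indicator {3..} t * f t" for t
  have "(\<integral>\<^sup>+t. ennreal (f t) * indicator {3..} t \<partial>lborel) = ennreal (0 - F 3)"
    by (rule nn_integral_FTC_atLeast[OF f_meas F f0 lim])
  also have "(\<lambda>t. ennreal (f t) * indicator {3..} t) = (\<lambda>t. ennreal (g t))"
    by (auto simp: g_def indicator_def)
  finally have nn: "(\<integral>\<^sup>+t. ennreal (g t) \<partial>lborel) = ennreal (0 - F 3)" .
  have gi: "integrable lborel g"
  proof (rule integrableI_nonneg)
    show "g \<in> borel_measurable lborel" unfolding g_def using f_meas by simp
    show "AE t in lborel. 0 \<le> g t" by (intro AE_I2) (simp add: g_def f0 indicator_def)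
    show "(\<integral>\<^sup>+t. ennreal (g t) \<partial>lborel) < \<infinity>" unfolding nn by simp
  qed
  have "integrable lborel (\<lambda>t. g t + g (- t))"
    using gi lborel_integrable_real_affine[OF gi, of "-1" 0] by simp
  moreover have "g t + g (- t) = indicator {t. \<bar>t\<bar> \<ge> 3} t / log_weight \<alpha> M t" for t
    by (auto simp: g_def f_def log_weight_def indicator_def)
  ultimately show ?thesis by simp
qed

section \<open>The smallest eigenvalue of \<open>L t\<close> and the growth condition\<close>

lemma ex_norm_1: "\<exists>x::real^'n. norm x = 1"
  by (rule exI[of _ "axis undefined 1"]) simp

context
  fixes L :: "real \<Rightarrow> real^'n^'n" and L0 :: real
  assumes L_cont: "continuous_on UNIV L"
    and L_low: "\<And>t x. (L t *v x) \<bullet> x \<ge> - L0 * (norm x)\<^sup>2"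
begin

lemma continuous_quadratic_form: "continuous_on UNIV (\<lambda>t. (L t *v x) \<bullet> y)"
  unfolding matrix_vector_mult_def inner_vec_def
  by (intro continuous_intros L_cont)

lemma bdd_below_unit_sphere: "bdd_below {(L t *v x) \<bullet> x | x. norm x = 1}"
proof (rule bdd_belowI[of _ "- L0"])
  fix z assume "z \<in> {(L t *v x) \<bullet> x | x. norm x = 1}"
  then obtain x where "z = (L t *v x) \<bullet> x" "norm x = 1" by blast
  then show "- L0 \<le> z" using L_low[where t=t and x=x] by simp
qed

lemma lmin_le: "lmin L t * (norm x)\<^sup>2 \<le> (L t *v x) \<bullet> x"
proof (cases "x = 0")
  case False
  define y where "y = (1 / norm x) *\<^sub>R x"
  have y: "norm y = 1" using False by (simp add: y_def)
  have "lmin L t \<le> (L t *v y) \<bullet> y"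
    unfolding lmin_def using y by (intro cInf_lower bdd_below_unit_sphere) blast
  then have "lmin L t * (norm x)\<^sup>2 \<le> ((L t *v y) \<bullet> y) * (norm x)\<^sup>2" by (intro mult_right_mono) auto
  also have "\<dots> = (L t *v x) \<bullet> x"
    using False by (simp add: y_def matrix_vector_mult_scaleR power2_eq_square)
  finally show ?thesis .
qed simp

text \<open>An infimum of continuous functions has closed superlevel sets. Measurability makes the
  exceptional set of (L1) a Borel set, so that its Lebesgue measure can be taken in
  \<open>lborel\<close>.\<close>

lemma lmin_measurable: "lmin L \<in> borel_measurable borel"
  unfolding borel_measurable_iff_ge
proof
  fix c
  have "{t. c \<le> lmin L t} = (\<Inter>x\<in>{x. norm x = 1}. {t. c \<le> (L t *v x) \<bullet> x})"
  proof (intro set_eqI)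
    fix t
    have "c \<le> lmin L t \<longleftrightarrow> (\<forall>z\<in>{(L t *v x) \<bullet> x | x. norm x = 1}. c \<le> z)"
      unfolding lmin_def by (rule le_cInf_iff) (use ex_norm_1 bdd_below_unit_sphere in auto)
    then show "t \<in> {t. c \<le> lmin L t} \<longleftrightarrow> t \<in> (\<Inter>x\<in>{x. norm x = 1}. {t. c \<le> (L t *v x) \<bullet> x})" by auto
  qed
  moreover have "closed (\<Inter>x\<in>{x. norm x = 1}. {t. c \<le> (L t *v x) \<bullet> x})"
    by (intro closed_INT ballI closed_Collect_le continuous_quadratic_form continuous_on_const)
  ultimately show "{t \<in> space borel. c \<le> lmin L t} \<in> sets borel" by simp
qed

lemma growth_from_measure:
  assumes \<alpha>: "\<alpha> > 1" and M: "M > 0"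
    and lim: "((\<lambda>R. emeasure lebesgue {t. \<bar>t\<bar> \<ge> R \<and> lmin L t \<le> M * \<bar>t\<bar> * (ln \<bar>t\<bar>) powr \<alpha>}) \<longlongrightarrow> 0) at_top"
    and e: "\<epsilon> > 0"
  shows "\<exists>R\<ge>3. \<exists>B\<in>sets lborel. emeasure lborel B \<le> ennreal \<epsilon> \<and>
      (\<forall>t x. \<bar>t\<bar> \<ge> R \<longrightarrow> t \<notin> B \<longrightarrow> log_weight \<alpha> M t * (x \<bullet> x) \<le> (L t *v x) \<bullet> x)"
proof -
  have "\<forall>\<^sub>F R in at_top. emeasure lebesgue {t. \<bar>t\<bar> \<ge> R \<and> lmin L t \<le> M * \<bar>t\<bar> * (ln \<bar>t\<bar>) powr \<alpha>} < ennreal \<epsilon>"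
    using e by (intro order_tendstoD(2)[OF lim]) simp
  then obtain R0 where R0: "\<And>R. R \<ge> R0 \<Longrightarrow> emeasure lebesgue {t. \<bar>t\<bar> \<ge> R \<and> lmin L t \<le> M * \<bar>t\<bar> * (ln \<bar>t\<bar>) powr \<alpha>} < ennreal \<epsilon>"
    unfolding eventually_at_top_linorder by blast
  define R where "R = max R0 3"
  define B where "B = {t. \<bar>t\<bar> \<ge> R \<and> lmin L t \<le> M * \<bar>t\<bar> * (ln \<bar>t\<bar>) powr \<alpha>}"
  note lmin_measurable[measurable]
  have B: "B \<in> sets borel" unfolding B_def by measurable
  then have "emeasure lborel B = emeasure lebesgue B" by simp
  then have "emeasure lborel B \<le> ennreal \<epsilon>" using R0[of R] by (simp add: B_def R_def)
  moreover have "log_weight \<alpha> M t * (x \<bullet> x) \<le> (L t *v x) \<bullet> x" if "\<bar>t\<bar> \<ge> R" "t \<notin> B" for t x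
  proof -
    have "log_weight \<alpha> M t \<le> lmin L t" using that by (simp add: B_def log_weight_def)
    then have "log_weight \<alpha> M t * (norm x)\<^sup>2 \<le> lmin L t * (norm x)\<^sup>2" by (intro mult_right_mono) auto
    also have "\<dots> \<le> (L t *v x) \<bullet> x" by (rule lmin_le)
    finally show ?thesis by (simp add: power2_norm_eq_inner)
  qed
  moreover have "R \<ge> 3" by (simp add: R_def)
  ultimately show ?thesis using B by (intro exI[of _ R] conjI bexI[of _ B]) auto
qed

end

text \<open>\<open>gradW\<close> is built from derivatives in \<open>x\<close> alone; these are
  restrictions of the joint derivative to vectors \<open>(0, y)\<close>, from which joint continuity
  in \<open>(t, x)\<close> is inherited.\<close>

lemma C1_fun_gradW:
  fixes W :: "real \<Rightarrow> real^'n \<Rightarrow> real"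
  assumes W: "C1_fun (\<lambda>p::real \<times> (real^'n). W (fst p) (snd p))"
  shows "(W t has_derivative (\<lambda>y. gradW W t x \<bullet> y)) (at x)"
    and "continuous_on UNIV (\<lambda>p. gradW W (fst p) (snd p))"
    and "continuous_on UNIV (\<lambda>p. W (fst p) (snd p))"
proof -
  obtain f' where f': "\<And>p. ((\<lambda>p. W (fst p) (snd p)) has_derivative blinfun_apply (f' p)) (at p)"
    and cf: "continuous_on UNIV f'"
    using W unfolding C1_fun_def by blast
  have d: "(W t has_derivative (\<lambda>y. blinfun_apply (f' (t, x)) (0, y))) (at x)" for t x
  proof -
    have "((\<lambda>x. (t, x)) has_derivative (\<lambda>y. (0, y))) (at x)" by (auto intro!: derivative_eq_intros)
    from has_derivative_compose[OF this f'] show ?thesis by simp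
  qed
  have fd: "frechet_derivative (W t) (at x) = (\<lambda>y. blinfun_apply (f' (t, x)) (0, y))" for t x
    using frechet_derivative_at[OF d[of t x]] by simp
  have g: "gradW W t x = (\<chi> i. blinfun_apply (f' (t, x)) (0, axis i 1))" for t x
    by (simp add: gradW_def fd)
  have "gradW W t x \<bullet> y = blinfun_apply (f' (t, x)) (0, y)" for y
  proof -
    have lin: "linear (\<lambda>y. blinfun_apply (f' (t, x)) (0, y))"
      using has_derivative_linear[OF d[of t x]] .
    have "blinfun_apply (f' (t, x)) (0, y) = blinfun_apply (f' (t, x)) (0, \<Sum>i\<in>UNIV. (y $ i) *\<^sub>R axis i 1)"
      using basis_expansion[of y] by (simp add: scalar_mult_eq_scaleR)
    also have "\<dots> = (\<Sum>i\<in>UNIV. (y $ i) *\<^sub>R blinfun_apply (f' (t, x)) (0, axis i 1))"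
      using linear_sum[OF lin, of "\<lambda>i. (y $ i) *\<^sub>R axis i 1" UNIV] linear_cmul[OF lin] by simp
    finally show ?thesis by (simp add: g inner_vec_def mult.commute)
  qed
  then show "(W t has_derivative (\<lambda>y. gradW W t x \<bullet> y)) (at x)" using d by simp
  show "continuous_on UNIV (\<lambda>p. gradW W (fst p) (snd p))"
    unfolding g by (intro continuous_intros cf) (simp add: cf)
  show "continuous_on UNIV (\<lambda>p. W (fst p) (snd p))"
    using f' by (intro continuous_at_imp_continuous_on) (auto intro: has_derivative_continuous)
qed

section \<open>Application to the shifted operator \<open>L + c0\<close>\<close>

theorem theorem1p1:
  fixes L :: "real \<Rightarrow> real^'n^'n" and W :: "real \<Rightarrow> real^'n \<Rightarrow> real"
  assumes L_cont: "continuous_on UNIV L"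
    and L_sym: "\<And>t. transpose (L t) = L t"
    and W_C1: "C1_fun (\<lambda>p::real \<times> (real^'n). W (fst p) (snd p))"
    and L1: "\<exists>\<alpha> M. \<alpha> > 1 \<and> M > 0 \<and>
       ((\<lambda>R. emeasure lebesgue {t. \<bar>t\<bar> \<ge> R \<and> lmin L t \<le> M * \<bar>t\<bar> * (ln \<bar>t\<bar>) powr \<alpha>})
          \<longlongrightarrow> 0) at_top"
    and L2: "\<exists>L0>0. \<forall>t x. (L t *v x) \<bullet> x \<ge> - L0 * (norm x)\<^sup>2"
    and W1: "(\<forall>t. W t 0 = 0) \<and> (\<exists>b1>0. \<forall>t x. norm (gradW W t x) \<le> b1 * norm x)"
    and W2: "\<exists>b2 r1 \<mu>. b2 > 0 \<and> r1 > 0 \<and> \<mu> > 1 \<and>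
       (\<forall>t x. norm x \<ge> r1 \<longrightarrow> Wtilde W t x \<ge> b2 * norm x powr \<mu>) \<and>
       (\<exists>b3>0. \<forall>t x. norm x < r1 \<longrightarrow> Wtilde W t x \<ge> - b3 * norm x)"
    and W4: "\<exists>r2 \<sigma>0. r2 > 0 \<and> \<sigma>0 > 0 \<and>
       (\<forall>t x. norm x \<le> r2 \<longrightarrow> \<bar>W t x\<bar> \<le> (lambda_pos L - \<sigma>0) / 2 * (norm x)\<^sup>2)"
    and W5: "\<exists>\<epsilon>0 rinf. \<epsilon>0 > 0 \<and> rinf > 0 \<and>
       (\<forall>t x. norm x \<ge> rinf \<longrightarrow> W t x \<ge> (lambda_pos L / 2 + \<epsilon>0) * (norm x)\<^sup>2)"
    and W6: "\<forall>t x. W t x \<ge> 0"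
  shows "\<exists>u. is_solution L W u \<and> homoclinic u \<and> (\<exists>t. u t \<noteq> 0)"
proof -
  obtain \<alpha> M where \<alpha>: "\<alpha> > 1" and M: "M > 0"
    and lim: "((\<lambda>R. emeasure lebesgue {t. \<bar>t\<bar> \<ge> R \<and> lmin L t \<le> M * \<bar>t\<bar> * (ln \<bar>t\<bar>) powr \<alpha>}) \<longlongrightarrow> 0) at_top"
    using L1 by blast
  obtain L0 where L0: "L0 > 0" and L_low: "\<And>t x. (L t *v x) \<bullet> x \<ge> - L0 * (norm x)\<^sup>2" using L2 by blast
  obtain b1 where b1: "b1 > 0" "\<And>t x. norm (gradW W t x) \<le> b1 * norm x" using W1 by blast
  obtain b2 r1 m b3 where b2: "b2 > 0" and r1: "r1 > 0" and m: "m > 1" and b3: "b3 > 0"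
    and large: "\<And>t x. norm x \<ge> r1 \<Longrightarrow> Wtilde W t x \<ge> b2 * norm x powr m"
    and small: "\<And>t x. norm x < r1 \<Longrightarrow> Wtilde W t x \<ge> - b3 * norm x"
    using W2 by blast
  obtain r2 \<sigma>0 where r2: "r2 > 0" and \<sigma>0: "\<sigma>0 > 0"
    and near: "\<And>t x. norm x \<le> r2 \<Longrightarrow> \<bar>W t x\<bar> \<le> (lambda_pos L - \<sigma>0) / 2 * (norm x)\<^sup>2"
    using W4 by blast
  obtain \<epsilon>0 rinf where \<epsilon>0: "\<epsilon>0 > 0" and rinf: "rinf > 0"
    and far: "\<And>t x. norm x \<ge> rinf \<Longrightarrow> W t x \<ge> (lambda_pos L / 2 + \<epsilon>0) * (norm x)\<^sup>2"
    using W5 by blast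
  \<comment> \<open>(L2) bounds the form of \<open>L\<close> below by \<open>- L0\<close>; one more
    unit makes the shifted form dominate the square norm.\<close>
  define c0 where "c0 = L0 + 1"
  define A where "A t x = L t *v x + c0 *\<^sub>R x" for t x
  have A_low: "(L t *v x) \<bullet> x + x \<bullet> x \<le> A t x \<bullet> x \<and> x \<bullet> x \<le> A t x \<bullet> x" for t x
  proof -
    have "- L0 * (x \<bullet> x) \<le> (L t *v x) \<bullet> x" using L_low[of x t] by (simp add: power2_norm_eq_inner)
    moreover have "0 \<le> L0 * (x \<bullet> x)" using L0 by simp
    ultimately show ?thesis by (simp add: A_def c0_def inner_add_left distrib_right)
  qed
  interpret S: schroedinger_form A "log_weight \<alpha> M"
  proof (rule schroedinger_form.intro)
    show "continuous_on UNIV (\<lambda>p. A (fst p) (snd p))"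
      unfolding A_def matrix_vector_mult_def
      by (intro continuous_intros continuous_on_compose2[OF L_cont]) auto
    show "linear (A t)" for t
      unfolding A_def by (intro linear_compose_add matrix_vector_mul_linear linear_scaleR)
    show "A t x \<bullet> y = A t y \<bullet> x" for t x y
    proof -
      have "(L t *v x) \<bullet> y = x \<bullet> (L t *v y)"
        using dot_lmul_matrix[of x "L t" y] L_sym[of t] by (metis transpose_matrix_vector)
      then show ?thesis by (simp add: A_def inner_add_left inner_add_right inner_commute)
    qed
    show "x \<bullet> x \<le> A t x \<bullet> x" for t x using A_low by blast
    show "log_weight \<alpha> M t > 0" if "\<bar>t\<bar> \<ge> 3" for t by (rule log_weight_pos[OF M that])
    show "integrable lborel (\<lambda>t. indicator {t. \<bar>t\<bar> \<ge> 3} t / log_weight \<alpha> M t)"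
      by (rule log_weight_integrable[OF \<alpha> M])
    show "filterlim (log_weight \<alpha> M) at_top at_infinity" by (rule log_weight_at_top[OF \<alpha> M])
    fix \<epsilon> :: real assume e: "\<epsilon> > 0"
    obtain R B where R: "R \<ge> 3" and B: "B \<in> sets lborel" "emeasure lborel B \<le> ennreal \<epsilon>"
      and g: "\<And>t x. \<bar>t\<bar> \<ge> R \<Longrightarrow> t \<notin> B \<Longrightarrow> log_weight \<alpha> M t * (x \<bullet> x) \<le> (L t *v x) \<bullet> x"
      using growth_from_measure[OF L_cont L_low \<alpha> M lim e] by blast
    have "log_weight \<alpha> M t * (x \<bullet> x) \<le> A t x \<bullet> x" if "\<bar>t\<bar> \<ge> R" "t \<notin> B" for t x
      using g[OF that, of x] A_low[of t x] inner_ge_zero[of x] by linarith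
    then show "\<exists>R\<ge>3. \<exists>B\<in>sets lborel. emeasure lborel B \<le> ennreal \<epsilon> \<and>
      (\<forall>t x. \<bar>t\<bar> \<ge> R \<longrightarrow> t \<notin> B \<longrightarrow> log_weight \<alpha> M t * (x \<bullet> x) \<le> A t x \<bullet> x)"
      using R B by blast
  qed
  obtain e e' :: "nat \<Rightarrow> real \<Rightarrow> real^'n" and \<mu> :: "nat \<Rightarrow> real"
    where e: "\<And>i. e i \<in> S.Dom" "\<And>i j. S.l2 (e i) (e j) = (if i = j then 1 else 0)"
    and eig: "\<And>i v. v \<in> S.Dom \<Longrightarrow> S.a (e i) v = \<mu> i * S.l2 (e i) v"
    and mono: "incseq \<mu>" and top: "filterlim \<mu> at_top sequentially"
    and comp: "\<And>v. v \<in> S.Dom \<Longrightarrow> (\<lambda>m. S.l2 (v - (\<Sum>i<m. S.l2 v (e i) *\<^sub>R e i)) (v - (\<Sum>i<m. S.l2 v (e i) *\<^sub>R e i))) \<longlonglongrightarrow> 0"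
    and ode: "\<And>i. S.eigen_ode (\<mu> i) (e i) (e' i)"
    and all: "\<And>u u' \<nu>. S.eigen_ode \<nu> u u' \<Longrightarrow> integrable lborel (\<lambda>t. u t \<bullet> u t) \<Longrightarrow> \<exists>t. u t \<noteq> 0 \<Longrightarrow> \<nu> \<in> range \<mu>"
    by (rule S.eigen_system) blast
  \<comment> \<open>The equations for \<open>L\<close> and \<open>A\<close> differ only by the
    shift. One direction rests on the clause that excludes further square integrable eigenfunctions,
    the other on the \<open>e i\<close> being classical solutions.\<close>
  have eigen: "is_eigenvalue L lam \<longleftrightarrow> lam + c0 \<in> range \<mu>" for lam
  proof
    assume "is_eigenvalue L lam"
    then obtain u u' where u: "\<And>t. (u has_vector_derivative u' t) (at t)"
      "\<And>t. (u' has_vector_derivative (L t *v u t - lam *\<^sub>R u t)) (at t)"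
      "\<exists>t. u t \<noteq> 0" "integrable lborel (\<lambda>t. (norm (u t))\<^sup>2)"
      unfolding is_eigenvalue_def by blast
    have "S.eigen_ode (lam + c0) u u'" using u(1,2) by (simp add: S.eigen_ode_def A_def algebra_simps)
    then show "lam + c0 \<in> range \<mu>" by (rule all) (use u in \<open>simp_all add: power2_norm_eq_inner\<close>)
  next
    assume "lam + c0 \<in> range \<mu>"
    then obtain i where i: "\<mu> i = lam + c0" by auto
    have "\<exists>t. e i t \<noteq> 0"
    proof (rule ccontr)
      assume "\<not> ?thesis"
      then have "S.l2 (e i) (e i) = 0" by (simp add: S.l2_def)
      then show False using e(2)[of i i] by simp
    qed
    moreover have "(e i has_vector_derivative e' i t) (at t)"
        "(e' i has_vector_derivative (L t *v e i t - lam *\<^sub>R e i t)) (at t)" for t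
      using ode[of i] by (simp_all add: S.eigen_ode_def A_def i algebra_simps)
    moreover have "integrable lborel (\<lambda>t. (norm (e i t))\<^sup>2)"
      using S.dom_square(1)[OF e(1)] by (simp add: power2_norm_eq_inner)
    ultimately show "is_eigenvalue L lam" unfolding is_eigenvalue_def by blast
  qed
  define k where "k = (LEAST i. \<mu> i > c0)"
  have "\<exists>i. \<mu> i > c0"
    using top unfolding filterlim_at_top_dense by (meson eventually_sequentially order_refl)
  then have k: "\<mu> k > c0" unfolding k_def by (rule LeastI_ex)
  have below: "\<mu> i \<le> c0" if "i < k" for i using not_less_Least[OF that[unfolded k_def]] by simp
  have lp: "lambda_pos L = \<mu> k - c0"
    unfolding lambda_pos_def
  proof (rule cInf_eq_minimum)
    show "\<mu> k - c0 \<in> {lam. lam > 0 \<and> is_eigenvalue L lam}" using k by (simp add: eigen)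
    fix lam assume "lam \<in> {lam. lam > 0 \<and> is_eigenvalue L lam}"
    then obtain i where i: "lam > 0" "\<mu> i = lam + c0" by (auto simp: eigen)
    then have "k \<le> i" using below[of i] by (cases "i < k") simp_all
    then show "\<mu> k - c0 \<le> lam" using incseqD[OF mono, of k i] i by simp
  qed
  \<comment> \<open>(W1) forces \<open>m \<le> 2\<close> anyway; the minimum avoids proving it.\<close>
  define \<nu> where "\<nu> = min m 2"
  \<comment> \<open>A smaller gap only weakens (W4), and it keeps the factor
    \<open>\<mu> k - c0 - s0\<close> nonnegative, as \<open>sphere_bound\<close> requires.\<close>
  define s0 where "s0 = min \<sigma>0 (\<mu> k - c0)"
  \<comment> \<open>For \<open>norm x >= r1\<close> the power with exponent \<open>m\<close> is at
    least \<open>r1 powr (m - \<nu>)\<close> times the power with exponent \<open>\<nu>\<close>;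
    this factor pays for lowering the exponent.\<close>
  define b where "b = b2 * r1 powr (m - \<nu>)"
  interpret G: galerkin A "log_weight \<alpha> M" W "gradW W" c0 e \<mu> k b1 b b3 r1 \<nu> r2 s0 \<epsilon>0 rinf
  proof
    show "(W t has_derivative (\<lambda>y. gradW W t x \<bullet> y)) (at x)" for t x by (rule C1_fun_gradW(1)[OF W_C1])
    show "b * norm x powr \<nu> \<le> 2 * W t x - gradW W t x \<bullet> x" if x: "r1 \<le> norm x" for t x
    proof -
      have x0: "norm x > 0" using x r1 by linarith
      have "b * norm x powr \<nu> = b2 * (r1 powr (m - \<nu>) * norm x powr \<nu>)" by (simp add: b_def)
      also have "\<dots> \<le> b2 * (norm x powr (m - \<nu>) * norm x powr \<nu>)"
        using b2 r1 x by (intro mult_left_mono mult_right_mono powr_mono2) (auto simp: \<nu>_def)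
      also have "norm x powr (m - \<nu>) * norm x powr \<nu> = norm x powr m" using x0 by (simp flip: powr_add)
      also have "b2 * norm x powr m \<le> 2 * W t x - gradW W t x \<bullet> x" using large[OF x, of t] by (simp add: Wtilde_def)
      finally show ?thesis .
    qed
    show "- b3 * norm x \<le> 2 * W t x - gradW W t x \<bullet> x" if "norm x < r1" for t x
      using small[OF that, of t] by (simp add: Wtilde_def)
    show "W t x \<le> (\<mu> k - c0 - s0) / 2 * (norm x)\<^sup>2" if "norm x \<le> r2" for t x
    proof -
      have "W t x \<le> (\<mu> k - c0 - \<sigma>0) / 2 * (norm x)\<^sup>2" using near[OF that, of t] by (simp add: lp)
      also have "\<dots> \<le> (\<mu> k - c0 - s0) / 2 * (norm x)\<^sup>2" by (intro mult_right_mono) (auto simp: s0_def)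
      finally show ?thesis .
    qed
    show "((\<mu> k - c0) / 2 + \<epsilon>0) * (norm x)\<^sup>2 \<le> W t x" if "rinf \<le> norm x" for t x
      using far[OF that, of t] by (simp add: lp)
  qed (use e eig mono comp C1_fun_gradW(2,3)[OF W_C1] W1 W6 b1 k below L0 b2 b3 r1 m r2 \<sigma>0 \<epsilon>0 rinf in
      \<open>auto simp: c0_def b_def \<nu>_def s0_def\<close>)
  obtain u u' where u: "\<And>t. (u has_vector_derivative u' t) (at t)"
      "\<And>t. (u' has_vector_derivative (A t (u t) - c0 *\<^sub>R u t - gradW W t (u t))) (at t)"
    and u0: "(u \<longlongrightarrow> 0) at_infinity" and ne: "\<exists>t. u t \<noteq> 0"
    using G.homoclinic_solution by blast
  have "is_solution L W u"
    unfolding is_solution_def using u by (intro exI[of _ u']) (simp add: A_def)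
  moreover have "homoclinic u"
    unfolding homoclinic_def
    using u0 tendsto_mono[OF at_top_le_at_infinity] tendsto_mono[OF at_bot_le_at_infinity] by blast
  ultimately show ?thesis using ne by blast
qed

end
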